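(* Assume that there exists a vector function $F_1\in H^3_N(\Omega)$ satisfying the boundary conditions $F_1=\varphi_0$, $\partial_n F_1=\varphi_1$ on $S_{bsc}$, $\partial_nF_1=0$ on the lateral faces $\{|x|=A \text{ or } |y|=A,\ z\in(-A,A)\}$ of $\Omega$, and $\partial_n F_1=0$ on $S_{tr}$. Consider the problem of minimizing the functional $$J_\gamma(V)=\int_\Omega |L(V+F_1)|^2\,d\mathbf x+\gamma\|V\|^2_{H^3_N(\Omega)}$$ on the space $H^3_{0,bsc,N}(\Omega)$. For any $\gamma>0$ there exists a unique minimizer $V_{\min}\in H^3_{0,bsc,N}(\Omega)$ of the functional $J_\gamma(V)$, and the following estimate holds: $$\|V_{\min}\|_{H^3_N(\Omega)}\le \frac{C}{\sqrt\gamma}\,\|F_1\|_{H^3_N(\Omega)},$$ where $C=C(A,R)>0$ is a constant depending only on the numbers $A$ and $R$.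
   Context: All functions are real valued. Let $A,b,d>0$, let $R>A$ be a fixed number, let $N>1$ be an integer, and $\Omega=\{\mathbf x=(x,y,z)\in\mathbb R^3:-A<x,y,z<A\}$. Put $S_{bsc}=\{-A<x,y<A,\ z=-A\}$, $S_{tr}=\{-A<x,y<A,\ z=A\}$, $\partial_1\Omega=\partial\Omega\setminus\{z=A\}$; $n$ is the unit normal on the boundary. For a Banach space $Z$, $Z_m$ denotes the space of $m$-vectors $D=(D_1,\dots,D_m)$ with entries in $Z$ and norm $\|D\|_{Z_m}=(\sum_j\|D_j\|_Z^2)^{1/2}$; thus $H^3_N(\Omega)$ is the space of $N$-vector functions with components in $H^3(\Omega)$. Let $$H^3_{0,bsc}(\Omega)=\{u\in H^3(\Omega): u|_{S_{bsc}}=0,\ \partial_nu|_{\partial_1\Omega}=0\},$$ and let $H^3_{0,bsc,N}(\Omega)$ be the corresponding space of $N$-vector functions. The functions $\varphi_0,\varphi_1$ are given $N$-vector boundary data on $S_{bsc}$. The operator $L$: let $\Psi_1,\dots,\Psi_N$ be the first $N$ functions obtained by Gram–Schmidt orthonormalization in $L_2(-d,d)$ of the sequence $e^{x_0},x_0e^{x_0},x_0^2e^{x_0},\dots$. The $N\times N$ matrix $M_N=(a_{mn})$, $a_{mn}=\int_{-d}^d\Psi_n'\Psi_m\,dx_0$, is invertible. For $\mathbf x\in\overline\Omega$, $x_0\in(-d,d)$ let $\mathbf x_0=(x_0,0,-A-b)$ and $r=(r_1,r_2,r_3)=\mathbf x-\mathbf x_0=(x-x_0,\,y,\,z+A+b)$.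 Define $N\times N$ matrices $D_j(\mathbf x)$ with entries $$(D_j)_{mn}=-\int_{-d}^d\partial_{x_0}\!\left[\frac{2r_j\Psi_n(x_0)}{|r|^2}\right]\Psi_m(x_0)\,dx_0\ (j=1,2,3),\qquad (D_0)_{mn}=\int_{-d}^d\partial_{x_0}\!\left[\frac{4\Psi_n(x_0)}{|r|^2}\right]\Psi_m(x_0)\,dx_0,$$ and $A_j=M_N^{-1}D_j$, $j=0,1,2,3$; these have entries in $C(\overline\Omega)$. For an $N$-vector function $U$, $$L(U)=\Delta U+A_1(\mathbf x)U_x+A_2(\mathbf x)U_y+A_3(\mathbf x)U_z+A_0(\mathbf x)U.$$
   Formalization: The constant C may depend on the fixed parameters b, d and N as well as on A and R (not on γ, F_1, φ_0, φ_1); a constant depending only on A and R is impossible, since the coefficients of L blow up near (d,0,-A) as b→0 when d<A. *)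

theory Defs
  imports "HOL-Analysis.Analysis"
begin

section \<open>Smooth functions, weak derivatives and Sobolev spaces on $R^3$\<close>

definition partial :: "3 \<Rightarrow> (real^3 \<Rightarrow> real) \<Rightarrow> real^3 \<Rightarrow> real" where
  "partial i f = (\<lambda>x. frechet_derivative f (at x) (axis i 1))"

fun Ck :: "nat \<Rightarrow> (real^3 \<Rightarrow> real) \<Rightarrow> bool" where
  "Ck 0 f \<longleftrightarrow> continuous_on UNIV f"
| "Ck (Suc k) f \<longleftrightarrow> (\<forall>x. f differentiable at x) \<and> (\<forall>i. Ck k (partial i f))"

definition smooth :: "(real^3 \<Rightarrow> real) \<Rightarrow> bool" where
  "smooth f \<longleftrightarrow> (\<forall>k. Ck k f)"

definition test_function :: "(real^3) set \<Rightarrow> (real^3 \<Rightarrow> real) \<Rightarrow> bool" where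
  "test_function \<Omega> \<phi> \<longleftrightarrow>
     smooth \<phi> \<and> (\<exists>K. compact K \<and> K \<subseteq> \<Omega> \<and> (\<forall>x. x \<notin> K \<longrightarrow> \<phi> x = 0))"

type_synonym mindex = "3 \<Rightarrow> nat"

definition deg :: "mindex \<Rightarrow> nat" where
  "deg \<alpha> = (\<Sum>i\<in>UNIV. \<alpha> i)"

definition mi1 :: "3 \<Rightarrow> mindex" where
  "mi1 i = (\<lambda>k. if k = i then 1 else 0)"

definition mi2 :: "3 \<Rightarrow> mindex" where
  "mi2 i = (\<lambda>k. if k = i then 2 else 0)"

definition mpartial :: "mindex \<Rightarrow> (real^3 \<Rightarrow> real) \<Rightarrow> real^3 \<Rightarrow> real" where
  "mpartial \<alpha> f = (partial 1 ^^ \<alpha> 1) ((partial 2 ^^ \<alpha> 2) ((partial 3 ^^ \<alpha> 3) f))"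

definition locally_integrable :: "(real^3) set \<Rightarrow> (real^3 \<Rightarrow> real) \<Rightarrow> bool" where
  "locally_integrable \<Omega> f \<longleftrightarrow> (\<forall>K. compact K \<and> K \<subseteq> \<Omega> \<longrightarrow> integrable (lebesgue_on K) f)"

definition has_weak_deriv ::
  "(real^3) set \<Rightarrow> mindex \<Rightarrow> (real^3 \<Rightarrow> real) \<Rightarrow> (real^3 \<Rightarrow> real) \<Rightarrow> bool" where
  "has_weak_deriv \<Omega> \<alpha> u g \<longleftrightarrow>
     locally_integrable \<Omega> u \<and> locally_integrable \<Omega> g \<and>
     (\<forall>\<phi>. test_function \<Omega> \<phi> \<longrightarrow>
        (LINT x|lebesgue_on \<Omega>. u x * mpartial \<alpha> \<phi> x)
          = (-1) ^ deg \<alpha> * (LINT x|lebesgue_on \<Omega>. g x * \<phi> x))"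

text \<open>The weak derivative is determined only up to null sets; every use below is
  insensitive to the choice of representative.\<close>

definition weak_deriv :: "(real^3) set \<Rightarrow> mindex \<Rightarrow> (real^3 \<Rightarrow> real) \<Rightarrow> real^3 \<Rightarrow> real" where
  "weak_deriv \<Omega> \<alpha> u = (SOME g. has_weak_deriv \<Omega> \<alpha> u g)"

definition L2 :: "'a measure \<Rightarrow> ('a \<Rightarrow> real) set" where
  "L2 M = {f \<in> borel_measurable M. integrable M (\<lambda>x. (f x)\<^sup>2)}"

definition L2_norm :: "'a measure \<Rightarrow> ('a \<Rightarrow> real) \<Rightarrow> real" where
  "L2_norm M f = sqrt (LINT x|M. (f x)\<^sup>2)"

definition Hm :: "nat \<Rightarrow> (real^3) set \<Rightarrow> (real^3 \<Rightarrow> real) set" where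
  "Hm m \<Omega> = {u \<in> L2 (lebesgue_on \<Omega>).
      \<forall>\<alpha>. deg \<alpha> \<le> m \<longrightarrow> (\<exists>g \<in> L2 (lebesgue_on \<Omega>). has_weak_deriv \<Omega> \<alpha> u g)}"

definition Hm_norm :: "nat \<Rightarrow> (real^3) set \<Rightarrow> (real^3 \<Rightarrow> real) \<Rightarrow> real" where
  "Hm_norm m \<Omega> u =
     sqrt (\<Sum>\<alpha> | deg \<alpha> \<le> m. (L2_norm (lebesgue_on \<Omega>) (weak_deriv \<Omega> \<alpha> u))\<^sup>2)"

lemma finite_deg_le: "finite {\<alpha>. deg \<alpha> \<le> m}"
proof -
  have "\<alpha> i \<le> deg \<alpha>" for \<alpha> i
    unfolding deg_def by (rule member_le_sum) auto
  then have "{\<alpha>. deg \<alpha> \<le> m} \<subseteq> PiE UNIV (\<lambda>_. {..m})"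
    using order_trans by (fastforce simp: PiE_def)
  then show ?thesis
    by (rule finite_subset) (intro finite_PiE; simp)
qed

definition HmN :: "nat \<Rightarrow> (real^3) set \<Rightarrow> (real^3 \<Rightarrow> real^'n) set" where
  "HmN m \<Omega> = {U. \<forall>k. (\<lambda>x. U x $ k) \<in> Hm m \<Omega>}"

definition HmN_norm :: "nat \<Rightarrow> (real^3) set \<Rightarrow> (real^3 \<Rightarrow> real^'n) \<Rightarrow> real" where
  "HmN_norm m \<Omega> U = sqrt (\<Sum>k\<in>UNIV. (Hm_norm m \<Omega> (\<lambda>x. U x $ k))\<^sup>2)"

definition weak_derivN :: "(real^3) set \<Rightarrow> mindex \<Rightarrow> (real^3 \<Rightarrow> real^'n) \<Rightarrow> real^3 \<Rightarrow> real^'n" where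
  "weak_derivN \<Omega> \<alpha> U x = (\<chi> k. weak_deriv \<Omega> \<alpha> (\<lambda>y. U y $ k) x)"


section \<open>The cube, its faces, and traces\<close>

definition cube :: "real \<Rightarrow> (real^3) set" where
  "cube A = {x. \<forall>i. - A < x $ i \<and> x $ i < A}"

text \<open>The open face on which the coordinate \<open>j\<close> equals \<open>s * A\<close> is named by the pair \<open>(j, s)\<close>
  with \<open>s = 1\<close> or \<open>s = -1\<close>. The edges of the cube are null sets for surface measure, so a boundary
  condition on a union of faces (edges included or not) is a condition on each open face.\<close>

type_synonym face = "3 \<times> real"

definition S_bsc :: face where "S_bsc = (3, -1)"
definition S_tr :: face where "S_tr = (3, 1)"

definition all_faces :: "face set" where
  "all_faces = UNIV \<times> {-1, 1}"

definition lateral_faces :: "face set" where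
  "lateral_faces = {1, 2} \<times> {-1, 1}"

definition partial1_faces :: "face set" where
  "partial1_faces = all_faces - {S_tr}"

definition face_set :: "real \<Rightarrow> face \<Rightarrow> (real^3) set" where
  "face_set A F = {x. x $ fst F = snd F * A \<and> (\<forall>i. i \<noteq> fst F \<longrightarrow> - A < x $ i \<and> x $ i < A)}"

definition square :: "real \<Rightarrow> (real \<times> real) set" where
  "square A = {-A<..<A} \<times> {-A<..<A}"

text \<open>Isometric parametrization of a face by the square. The addition in \<open>j + 1\<close> is cyclic
  in the type \<open>3\<close>. Surface integrals are integrals over the square.\<close>

definition face_pt :: "real \<Rightarrow> face \<Rightarrow> real \<times> real \<Rightarrow> real^3" where
  "face_pt A F p =
     (\<chi> i. if i = fst F then snd F * A else if i = fst F + 1 then fst p else snd p)"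

lemma face_pt_image: "face_pt A F ` square A = face_set A F"
proof
  show "face_pt A F ` square A \<subseteq> face_set A F"
    by (auto simp: face_pt_def face_set_def square_def)
  show "face_set A F \<subseteq> face_pt A F ` square A"
  proof
    fix x assume x: "x \<in> face_set A F"
    let ?j = "fst F"
    have c: "i = ?j \<or> i = ?j + 1 \<or> i = ?j + 2" for i :: 3
      using exhaust_3[of i] exhaust_3[of ?j] by auto
    have d: "?j + 1 \<noteq> ?j" "?j + 2 \<noteq> ?j" "?j + 2 \<noteq> ?j + 1"
      by auto
    have "x = face_pt A F (x $ (?j + 1), x $ (?j + 2))"
      unfolding vec_eq_iff
    proof
      fix i
      show "x $ i = face_pt A F (x $ (?j + 1), x $ (?j + 2)) $ i"
        using c[of i] d x by (auto simp: face_pt_def face_set_def)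
    qed
    moreover have "(x $ (?j + 1), x $ (?j + 2)) \<in> square A"
      using x d by (auto simp: face_set_def square_def)
    ultimately show "x \<in> face_pt A F ` square A" by blast
  qed
qed

definition face_normal :: "face \<Rightarrow> real^3" where
  "face_normal F = snd F *\<^sub>R axis (fst F) 1"

text \<open>The trace on a face of a function in $H^1$ of the cube: the $L_2$-limit of the restrictions
  of smooth functions approximating it in $H^1$, i.e. the trace operator is the closure of the
  restriction of functions smooth up to the boundary.\<close>

definition has_trace :: "real \<Rightarrow> face \<Rightarrow> (real^3 \<Rightarrow> real) \<Rightarrow> (real^3 \<Rightarrow> real) \<Rightarrow> bool" where
  "has_trace A F u g \<longleftrightarrow>
     u \<in> Hm 1 (cube A) \<and>
     (\<lambda>p. g (face_pt A F p)) \<in> L2 (lebesgue_on (square A)) \<and>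
     (\<exists>w. (\<forall>k::nat. smooth (w k)) \<and>
          (\<lambda>k. Hm_norm 1 (cube A) (\<lambda>x. w k x - u x)) \<longlonglongrightarrow> 0 \<and>
          (\<lambda>k. L2_norm (lebesgue_on (square A))
                 (\<lambda>p. w k (face_pt A F p) - g (face_pt A F p))) \<longlonglongrightarrow> 0)"

definition has_normal_deriv :: "real \<Rightarrow> face \<Rightarrow> (real^3 \<Rightarrow> real) \<Rightarrow> (real^3 \<Rightarrow> real) \<Rightarrow> bool" where
  "has_normal_deriv A F u g \<longleftrightarrow>
     has_trace A F (\<lambda>x. \<Sum>i\<in>UNIV. face_normal F $ i * weak_deriv (cube A) (mi1 i) u x) g"

definition has_traceN ::
  "real \<Rightarrow> face \<Rightarrow> (real^3 \<Rightarrow> real^'n) \<Rightarrow> (real^3 \<Rightarrow> real^'n) \<Rightarrow> bool" where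
  "has_traceN A F U G \<longleftrightarrow> (\<forall>k. has_trace A F (\<lambda>x. U x $ k) (\<lambda>x. G x $ k))"

definition has_normal_derivN ::
  "real \<Rightarrow> face \<Rightarrow> (real^3 \<Rightarrow> real^'n) \<Rightarrow> (real^3 \<Rightarrow> real^'n) \<Rightarrow> bool" where
  "has_normal_derivN A F U G \<longleftrightarrow> (\<forall>k. has_normal_deriv A F (\<lambda>x. U x $ k) (\<lambda>x. G x $ k))"

definition H3_0_bsc :: "real \<Rightarrow> (real^3 \<Rightarrow> real) set" where
  "H3_0_bsc A = {u \<in> Hm 3 (cube A).
      has_trace A S_bsc u (\<lambda>_. 0) \<and> (\<forall>F\<in>partial1_faces. has_normal_deriv A F u (\<lambda>_. 0))}"

definition H3_0_bscN :: "real \<Rightarrow> (real^3 \<Rightarrow> real^'n) set" where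
  "H3_0_bscN A = {U. \<forall>k. (\<lambda>x. U x $ k) \<in> H3_0_bsc A}"


section \<open>The operator L and the functional\<close>

definition ip :: "real \<Rightarrow> (real \<Rightarrow> real) \<Rightarrow> (real \<Rightarrow> real) \<Rightarrow> real" where
  "ip d f g = (LBINT t:{-d<..<d}. f t * g t)"

text \<open>Gram-Schmidt orthonormalization of \<open>t ^ k * exp t\<close>, \<open>k = 0, 1, 2, \<dots>\<close>;
  indices are shifted by one, so that \<open>gs d 0\<close> is $\Psi_1$.\<close>

fun gs :: "real \<Rightarrow> nat \<Rightarrow> real \<Rightarrow> real" where
  "gs d k =
     (let f = (\<lambda>t. t ^ k * exp t);
          v = (\<lambda>t. f t - (\<Sum>l<k. ip d f (gs d l) * gs d l t))
      in (\<lambda>t. v t / sqrt (ip d v v)))"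

declare gs.simps [simp del]

text \<open>Vectors and matrices of size \<open>N\<close> are indexed by an arbitrary finite linearly ordered type
  with \<open>N\<close> elements; \<open>pos\<close> is the zero-based position of an index.\<close>

definition pos :: "'n::{finite,linorder} \<Rightarrow> nat" where
  "pos n = card {k. k < n}"

definition Psi :: "real \<Rightarrow> 'n::{finite,linorder} \<Rightarrow> real \<Rightarrow> real" where
  "Psi d n = gs d (pos n)"

definition M_N :: "real \<Rightarrow> real^'n::{finite,linorder}^'n::{finite,linorder}" where
  "M_N d = (\<chi> m n. LBINT t:{-d<..<d}. deriv (Psi d n) t * Psi d m t)"

definition rvec :: "real \<Rightarrow> real \<Rightarrow> real^3 \<Rightarrow> real \<Rightarrow> real^3" where
  "rvec A b x t = x - vector [t, 0, - A - b]"

definition D_mat ::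
  "real \<Rightarrow> real \<Rightarrow> real \<Rightarrow> 3 \<Rightarrow> real^3 \<Rightarrow> real^'n::{finite,linorder}^'n::{finite,linorder}" where
  "D_mat A b d j x = (\<chi> m n. - (LBINT t:{-d<..<d}.
      deriv (\<lambda>s. 2 * rvec A b x s $ j * Psi d n s / (norm (rvec A b x s))\<^sup>2) t * Psi d m t))"

definition D0_mat ::
  "real \<Rightarrow> real \<Rightarrow> real \<Rightarrow> real^3 \<Rightarrow> real^'n::{finite,linorder}^'n::{finite,linorder}" where
  "D0_mat A b d x = (\<chi> m n. LBINT t:{-d<..<d}.
      deriv (\<lambda>s. 4 * Psi d n s / (norm (rvec A b x s))\<^sup>2) t * Psi d m t)"

definition A_mat ::
  "real \<Rightarrow> real \<Rightarrow> real \<Rightarrow> 3 \<Rightarrow> real^3 \<Rightarrow> real^'n::{finite,linorder}^'n::{finite,linorder}" where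
  "A_mat A b d j x = matrix_inv (M_N d) ** D_mat A b d j x"

definition A0_mat ::
  "real \<Rightarrow> real \<Rightarrow> real \<Rightarrow> real^3 \<Rightarrow> real^'n::{finite,linorder}^'n::{finite,linorder}" where
  "A0_mat A b d x = matrix_inv (M_N d) ** D0_mat A b d x"

definition Lop ::
  "real \<Rightarrow> real \<Rightarrow> real \<Rightarrow> (real^3 \<Rightarrow> real^'n::{finite,linorder}) \<Rightarrow> real^3 \<Rightarrow> real^'n::{finite,linorder}" where
  "Lop A b d U x =
     (\<Sum>i\<in>UNIV. weak_derivN (cube A) (mi2 i) U x)
     + (\<Sum>j\<in>UNIV. A_mat A b d j x *v weak_derivN (cube A) (mi1 j) U x)
     + A0_mat A b d x *v U x"

definition J_fun ::
  "real \<Rightarrow> real \<Rightarrow> real \<Rightarrow> real \<Rightarrow> (real^3 \<Rightarrow> real^'n::{finite,linorder})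
    \<Rightarrow> (real^3 \<Rightarrow> real^'n::{finite,linorder}) \<Rightarrow> real" where
  "J_fun A b d \<gamma> F1 V =
     (LINT x|lebesgue_on (cube A). (norm (Lop A b d (\<lambda>y. V y + F1 y) x))\<^sup>2)
     + \<gamma> * (HmN_norm 3 (cube A) V)\<^sup>2"

end

theory Submission
  imports Defs
begin

text \<open>
  The functional is quadratic and \<open>\<gamma>\<close>-strongly convex in the \<open>H\<^sup>3\<close> norm. By the parallelogram law the
  value at a midpoint lies below the average of the values by at least \<open>\<gamma> / 4\<close> times the squared
  \<open>H\<^sup>3\<close> distance, so every minimizing sequence is Cauchy and two minimizers coincide almost everywhere
  (\<open>uniformly_convex_minimizer\<close>). A limit exists and is admissible because \<open>H\<^sup>3\<close> is complete
  (\<open>HmN_complete\<close>) and the boundary conditions define a closed subspace (\<open>H3_0_bscN_closed\<close>); it is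
  a minimizer because the functional is continuous. The estimate compares the minimizer with the
  competitor \<open>0\<close>: \<open>\<gamma> \<parallel>V\<parallel>\<^sup>2 \<le> J V \<le> J 0 = \<parallel>L F\<^sub>1\<parallel>\<^sup>2\<close>. Continuity and the last step both rest on one bound, that
  \<open>L\<close> maps \<open>H\<^sup>3\<close> boundedly to \<open>L\<^sub>2\<close> (\<open>Lop_bounded\<close>). It holds because the coefficients of \<open>L\<close> are
  continuous on the closed cube: the sources keep a distance of at least \<open>b\<close> from it, so the kernels stay bounded.

  The weak derivative is an arbitrary choice among all functions that satisfy the defining
  identity. Every algebraic law for it, and hence for the Sobolev norm, therefore depends on uniqueness up to null sets
  (\<open>has_weak_deriv_unique\<close>), which is the fundamental lemma of the calculus of variations. The test
  functions for that lemma are products of the functions \<open>exp (- c / t)\<close>, which approximate the indicator function of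
  a box; a locally integrable function with vanishing integrals over boxes vanishes almost everywhere.

  A trace is an \<open>L\<^sub>2\<close> limit of restrictions of smooth functions, so its kernel is closed in \<open>H\<^sup>1\<close> as
  soon as the triangle inequality applies to the approximating functions, that is, once smooth functions are known to
  belong to \<open>H\<^sup>1\<close> (\<open>smooth_Hm_1\<close>, an integration by parts). For the normal derivatives the closedness is
  transported from \<open>H\<^sup>1\<close> to \<open>H\<^sup>3\<close> by the rule that weak derivatives of weak derivatives are weak
  derivatives of higher order. Since the iterated classical derivative of a test function is taken in a fixed order of the coordinates,
  this rule needs the symmetry of second derivatives (\<open>partial_commute\<close>).
\<close>

section \<open>Calculus of smooth functions\<close>

lemma partial_eqI:
  assumes "(f has_derivative f') (at x)"
  shows "partial i f x = f' (axis i 1)"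
  unfolding partial_def using frechet_derivative_at[OF assms] by simp

lemma partial_const: "partial i (\<lambda>x. c) = (\<lambda>x. 0)"
  by (rule ext, rule partial_eqI[where f' = "\<lambda>_. 0"]) auto

lemma partial_add:
  assumes "\<And>x. f differentiable at x" "\<And>x. g differentiable at x"
  shows "partial i (\<lambda>x. f x + g x) = (\<lambda>x. partial i f x + partial i g x)"
proof
  fix x
  show "partial i (\<lambda>x. f x + g x) x = partial i f x + partial i g x"
    using partial_eqI[OF has_derivative_add[OF frechet_derivative_works[THEN iffD1, OF assms(1)[of x]]
        frechet_derivative_works[THEN iffD1, OF assms(2)[of x]]], of i]
    by (simp only: partial_def)
qed

lemma partial_mult:
  assumes "\<And>x. f differentiable at x" "\<And>x. g differentiable at x"
  shows "partial i (\<lambda>x. f x * g x) = (\<lambda>x. f x * partial i g x + partial i f x * g x)"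
proof
  fix x
  show "partial i (\<lambda>x. f x * g x) x = f x * partial i g x + partial i f x * g x"
    using partial_eqI[OF has_derivative_mult[OF frechet_derivative_works[THEN iffD1, OF assms(1)[of x]]
        frechet_derivative_works[THEN iffD1, OF assms(2)[of x]]], of i]
    by (simp only: partial_def)
qed

lemma Ck_Suc_imp_Ck: "Ck (Suc k) f \<Longrightarrow> Ck k f"
proof (induction k arbitrary: f)
  case 0
  then show ?case
    by (auto intro!: differentiable_imp_continuous_on simp: differentiable_on_def)
next
  case (Suc k)
  then show ?case by simp
qed

lemma Ck_const: "Ck k (\<lambda>x. c)"
  by (induction k arbitrary: c) (auto simp: partial_const)

lemma Ck_add: "Ck k f \<Longrightarrow> Ck k g \<Longrightarrow> Ck k (\<lambda>x. f x + g x)"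
proof (induction k arbitrary: f g)
  case 0
  then show ?case by (auto intro: continuous_intros)
next
  case (Suc k)
  then show ?case by (auto simp: partial_add)
qed

lemma Ck_mult: "Ck k f \<Longrightarrow> Ck k g \<Longrightarrow> Ck k (\<lambda>x. f x * g x)"
proof (induction k arbitrary: f g)
  case 0
  then show ?case by (auto intro: continuous_intros)
next
  case (Suc k)
  then have "Ck k f" "Ck k g" by (blast intro: Ck_Suc_imp_Ck)+
  with Suc show ?case by (auto simp: partial_mult intro!: Ck_add)
qed

lemma smooth_const: "smooth (\<lambda>x. c)"
  and smooth_add: "smooth f \<Longrightarrow> smooth g \<Longrightarrow> smooth (\<lambda>x. f x + g x)"
  and smooth_mult: "smooth f \<Longrightarrow> smooth g \<Longrightarrow> smooth (\<lambda>x. f x * g x)"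
  by (auto simp: smooth_def Ck_const Ck_add Ck_mult)

lemma smooth_prod:
  "finite I \<Longrightarrow> (\<And>i. i \<in> I \<Longrightarrow> smooth (f i)) \<Longrightarrow> smooth (\<lambda>x. \<Prod>i\<in>I. f i x)"
  by (induction I rule: finite_induct) (auto simp: smooth_const intro: smooth_mult)

lemma smooth_partial: "smooth f \<Longrightarrow> smooth (partial i f)"
  unfolding smooth_def using Ck.simps(2) by blast

lemma smooth_imp_differentiable: "smooth f \<Longrightarrow> f differentiable at x"
  unfolding smooth_def using Ck.simps(2) by blast

lemma smooth_imp_continuous_on: "smooth f \<Longrightarrow> continuous_on S f"
  unfolding smooth_def using Ck.simps(1) continuous_on_subset by blast

lemma DERIV_along_axis:
  fixes g :: "real^3 \<Rightarrow> real"
  assumes "\<And>x. g differentiable at x"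
  shows "((\<lambda>t. g (y + t *\<^sub>R axis k 1)) has_real_derivative partial k g (y + t *\<^sub>R axis k 1)) (at t)"
proof -
  have "(g has_derivative frechet_derivative g (at (y + t *\<^sub>R axis k 1))) (at (y + t *\<^sub>R axis k 1))"
    using assms frechet_derivative_works by blast
  then have "((\<lambda>t. g (y + t *\<^sub>R axis k 1)) has_derivative
      (\<lambda>u. frechet_derivative g (at (y + t *\<^sub>R axis k 1)) (0 + u *\<^sub>R axis k 1))) (at t)"
    by (intro has_derivative_compose[of "\<lambda>t. y + t *\<^sub>R axis k 1" _ t UNIV g, simplified]
        derivative_eq_intros) auto
  moreover from assms have "linear (frechet_derivative g (at (y + t *\<^sub>R axis k 1)))"
    by (rule linear_frechet_derivative)
  then have "(\<lambda>u. frechet_derivative g (at (y + t *\<^sub>R axis k 1)) (0 + u *\<^sub>R axis k 1))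
      = (*) (partial k g (y + t *\<^sub>R axis k 1))"
    by (auto simp: partial_def linear_cmul)
  ultimately show ?thesis
    by (simp add: has_field_derivative_def)
qed

text \<open>Two applications of the mean value theorem express the second difference of \<open>f\<close> over a
  coordinate rectangle by a mixed derivative. The difference is symmetric in the two directions, which
  is why the mixed derivatives agree.\<close>

lemma second_difference:
  fixes f :: "real^3 \<Rightarrow> real"
  assumes f: "\<And>x. f differentiable at x" "\<And>x. partial i f differentiable at x" and h: "0 < h"
  obtains s t where "0 < s" "s < h" "0 < t" "t < h"
    "f (x + h *\<^sub>R axis i 1 + h *\<^sub>R axis j 1) - f (x + h *\<^sub>R axis i 1) - f (x + h *\<^sub>R axis j 1) + f x
      = h * h * partial j (partial i f) (x + s *\<^sub>R axis i 1 + t *\<^sub>R axis j 1)"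
proof -
  have line: "((\<lambda>t. g (y + t *\<^sub>R axis k 1)) has_real_derivative partial k g (y + t *\<^sub>R axis k 1)) (at t)"
    if "\<And>x. g differentiable at x" for g :: "real^3 \<Rightarrow> real" and y k t
    using that by (rule DERIV_along_axis)
  let ?\<phi> = "\<lambda>s. f (x + h *\<^sub>R axis j 1 + s *\<^sub>R axis i 1) - f (x + s *\<^sub>R axis i 1)"
  have "\<exists>s. 0 < s \<and> s < h \<and> ?\<phi> h - ?\<phi> 0 = (h - 0) * (partial i f (x + h *\<^sub>R axis j 1 + s *\<^sub>R axis i 1)
      - partial i f (x + s *\<^sub>R axis i 1))"
    using h by (intro MVT2) (auto intro!: DERIV_diff line f)
  then obtain s where s: "0 < s" "s < h"
    "?\<phi> h - ?\<phi> 0 = (h - 0) * (partial i f (x + h *\<^sub>R axis j 1 + s *\<^sub>R axis i 1)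
      - partial i f (x + s *\<^sub>R axis i 1))" by blast
  let ?\<psi> = "\<lambda>t. partial i f (x + s *\<^sub>R axis i 1 + t *\<^sub>R axis j 1)"
  have "\<exists>t. 0 < t \<and> t < h \<and> ?\<psi> h - ?\<psi> 0
      = (h - 0) * partial j (partial i f) (x + s *\<^sub>R axis i 1 + t *\<^sub>R axis j 1)"
    using h by (intro MVT2) (auto intro!: line f)
  then obtain t where t: "0 < t" "t < h" "?\<psi> h - ?\<psi> 0
      = h * partial j (partial i f) (x + s *\<^sub>R axis i 1 + t *\<^sub>R axis j 1)" by auto
  show thesis
    using s t by (intro that[of s t]) (auto simp: algebra_simps)
qed

lemma partial_commute:
  assumes f: "Ck 2 f"
  shows "partial i (partial j f) = partial j (partial i f)"
proof
  fix x :: "real^3"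
  have Ck: "Ck (Suc (Suc 0)) f" using f by (simp add: numeral_2_eq_2)
  then have d: "\<And>x. f differentiable at x" "\<And>k x. partial k f differentiable at x"
    and c: "\<And>k l. continuous_on UNIV (partial k (partial l f))"
    by simp_all
  let ?h = "\<lambda>n::nat. inverse (real (Suc n))"
  let ?pt = "\<lambda>i j s t. x + s *\<^sub>R axis i 1 + t *\<^sub>R axis j 1"
  have ex: "\<exists>p. 0 < fst p \<and> fst p < ?h n \<and> 0 < snd p \<and> snd p < ?h n \<and>
     f (x + ?h n *\<^sub>R axis i 1 + ?h n *\<^sub>R axis j 1) - f (x + ?h n *\<^sub>R axis i 1)
       - f (x + ?h n *\<^sub>R axis j 1) + f x
      = ?h n * ?h n * partial j (partial i f) (?pt i j (fst p) (snd p))" for n i j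
    by (rule second_difference[where f = f and i = i and j = j and x = x, OF d, of "?h n"]) auto
  have lim: "\<exists>p. (\<forall>n. f (x + ?h n *\<^sub>R axis i 1 + ?h n *\<^sub>R axis j 1) - f (x + ?h n *\<^sub>R axis i 1)
       - f (x + ?h n *\<^sub>R axis j 1) + f x = ?h n * ?h n * p n) \<and> p \<longlonglongrightarrow> partial j (partial i f) x" for i j
  proof -
    from ex[of _ i j] obtain q where q: "\<And>n. 0 < fst (q n)" "\<And>n. fst (q n) < ?h n"
       "\<And>n. 0 < snd (q n)" "\<And>n. snd (q n) < ?h n"
       "\<And>n. f (x + ?h n *\<^sub>R axis i 1 + ?h n *\<^sub>R axis j 1) - f (x + ?h n *\<^sub>R axis i 1)
       - f (x + ?h n *\<^sub>R axis j 1) + f x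
      = ?h n * ?h n * partial j (partial i f) (?pt i j (fst (q n)) (snd (q n)))"
      by metis
    have z: "(\<lambda>n. ?h n) \<longlonglongrightarrow> 0" by (rule LIMSEQ_inverse_real_of_nat)
    have f0: "(\<lambda>n. fst (q n)) \<longlonglongrightarrow> 0"
      by (rule tendsto_sandwich[OF _ _ tendsto_const z])
         (intro always_eventually allI less_imp_le q)+
    have "(\<lambda>n. snd (q n)) \<longlonglongrightarrow> 0"
      by (rule tendsto_sandwich[OF _ _ tendsto_const z])
         (intro always_eventually allI less_imp_le q)+
    with f0 have "(\<lambda>n. ?pt i j (fst (q n)) (snd (q n))) \<longlonglongrightarrow> ?pt i j 0 0"
      by (intro tendsto_intros)
    with f0 have "(\<lambda>n. ?pt i j (fst (q n)) (snd (q n))) \<longlonglongrightarrow> x" by simp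
    moreover have "isCont (partial j (partial i f)) x"
      using c[of j i] by (simp add: continuous_on_eq_continuous_at)
    ultimately have "(\<lambda>n. partial j (partial i f) (?pt i j (fst (q n)) (snd (q n))))
        \<longlonglongrightarrow> partial j (partial i f) x"
      using isCont_tendsto_compose by blast
    with q(5) show ?thesis by (intro exI conjI allI)
  qed
  obtain p where p: "\<And>n. f (x + ?h n *\<^sub>R axis i 1 + ?h n *\<^sub>R axis j 1) - f (x + ?h n *\<^sub>R axis i 1)
       - f (x + ?h n *\<^sub>R axis j 1) + f x = ?h n * ?h n * p n" "p \<longlonglongrightarrow> partial j (partial i f) x"
    using lim[of i j] by blast
  obtain q where q: "\<And>n. f (x + ?h n *\<^sub>R axis j 1 + ?h n *\<^sub>R axis i 1) - f (x + ?h n *\<^sub>R axis j 1)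
       - f (x + ?h n *\<^sub>R axis i 1) + f x = ?h n * ?h n * q n" "q \<longlonglongrightarrow> partial i (partial j f) x"
    using lim[of j i] by blast
  have "p n = q n" for n
  proof -
    have "?h n * ?h n * p n = ?h n * ?h n * q n"
      unfolding p(1)[symmetric] q(1)[symmetric] by (simp add: algebra_simps)
    then show ?thesis by simp
  qed
  then have "p = q" by auto
  then show "partial i (partial j f) x = partial j (partial i f) x"
    using p q LIMSEQ_unique by blast
qed

lemma smooth_partial_commute: "smooth f \<Longrightarrow> partial i (partial j f) = partial j (partial i f)"
  by (simp add: partial_commute smooth_def)

lemma smooth_funpow_partial: "smooth f \<Longrightarrow> smooth ((partial i ^^ n) f)"
  by (induction n) (auto intro: smooth_partial)

lemma smooth_mpartial: "smooth f \<Longrightarrow> smooth (mpartial \<alpha> f)"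
  by (simp add: mpartial_def smooth_funpow_partial)

lemma funpow_partial_commute:
  "smooth f \<Longrightarrow> (partial i ^^ n) (partial j f) = partial j ((partial i ^^ n) f)"
  by (induction n) (auto simp: smooth_partial_commute[OF smooth_funpow_partial])

text \<open>The multi-index derivative applies the coordinate derivatives in a fixed order; one more
  derivative reaches its place in that order by symmetry.\<close>

lemma mpartial_partial:
  assumes "smooth f"
  shows "mpartial \<alpha> (partial j f) = mpartial (\<lambda>k. \<alpha> k + mi1 j k) f"
  using exhaust_3[of j]
  by (auto simp: mpartial_def mi1_def funpow_partial_commute assms smooth_funpow_partial)

lemma partial_mpartial:
  assumes "smooth f"
  shows "partial j (mpartial \<alpha> f) = mpartial (\<lambda>k. \<alpha> k + mi1 j k) f"
  unfolding mpartial_partial[OF assms, symmetric]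
  by (simp add: mpartial_def funpow_partial_commute assms smooth_funpow_partial)

lemma mpartial_mi1: "mpartial (mi1 j) f = partial j f"
  using exhaust_3[of j] by (auto simp: mpartial_def mi1_def)

lemma mpartial_0: "mpartial (\<lambda>_. 0) f = f"
  by (simp add: mpartial_def)

lemma deg_0: "deg (\<lambda>_. 0) = 0"
  and deg_mi1: "deg (mi1 i) = 1"
  and deg_mi2: "deg (mi2 i) = 2"
  and deg_add: "deg (\<lambda>k. \<alpha> k + \<beta> k) = deg \<alpha> + deg \<beta>"
  by (simp_all add: deg_def mi1_def mi2_def sum.distrib)

lemma deg_le_1_cases:
  assumes "deg \<alpha> \<le> 1"
  obtains "\<alpha> = (\<lambda>_. 0)" | j where "\<alpha> = mi1 j"
proof (cases "\<alpha> = (\<lambda>_. 0)")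
  case False
  then obtain j where j: "\<alpha> j \<noteq> 0" by auto
  have "deg \<alpha> = \<alpha> j + (\<Sum>i\<in>UNIV - {j}. \<alpha> i)"
    by (simp add: deg_def sum.remove)
  with assms j have *: "\<alpha> j = 1" "(\<Sum>i\<in>UNIV - {j}. \<alpha> i) = 0" by linarith+
  from *(2) have "\<alpha> k = 0" if "k \<noteq> j" for k using that by (simp add: sum_eq_0_iff)
  with *(1) have "\<alpha> k = mi1 j k" for k by (cases "k = j") (auto simp: mi1_def)
  then have "\<alpha> = mi1 j" by blast
  with that show thesis by blast
qed (use that in blast)

section \<open>Test functions\<close>

lemma test_functionE:
  assumes "test_function \<Omega> \<phi>"
  obtains K where "compact K" "K \<subseteq> \<Omega>" "\<And>x. x \<notin> K \<Longrightarrow> \<phi> x = 0" "smooth \<phi>"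
  using assms unfolding test_function_def by blast

lemma test_function_partial:
  assumes "test_function \<Omega> \<phi>"
  shows "test_function \<Omega> (partial i \<phi>)"
proof -
  obtain K where K: "compact K" "K \<subseteq> \<Omega>" "\<And>x. x \<notin> K \<Longrightarrow> \<phi> x = 0" "smooth \<phi>"
    using test_functionE[OF assms] by blast
  have "partial i \<phi> x = 0" if "x \<notin> K" for x
  proof -
    have "open (- K)" using K(1) by (simp add: compact_imp_closed open_Compl)
    then have "(\<phi> has_derivative (\<lambda>_. 0)) (at x)"
      using that K(3)
      by (intro has_derivative_transform_within_open[OF has_derivative_const[of 0], of "- K"]) auto
    then show ?thesis by (simp add: partial_eqI)
  qed
  with K show ?thesis
    unfolding test_function_def using smooth_partial by blast
qed

lemma test_function_mpartial: "test_function \<Omega> \<phi> \<Longrightarrow> test_function \<Omega> (mpartial \<alpha> \<phi>)"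
proof -
  have "test_function \<Omega> \<phi> \<Longrightarrow> test_function \<Omega> ((partial i ^^ n) \<phi>)" for i n \<phi>
    by (induction n) (auto intro: test_function_partial)
  then show "test_function \<Omega> \<phi> \<Longrightarrow> test_function \<Omega> (mpartial \<alpha> \<phi>)"
    unfolding mpartial_def by blast
qed

lemma test_function_bounded:
  assumes "test_function \<Omega> \<phi>"
  obtains B where "\<And>x. \<bar>\<phi> x\<bar> \<le> B"
proof -
  obtain K where K: "compact K" "K \<subseteq> \<Omega>" "\<And>x. x \<notin> K \<Longrightarrow> \<phi> x = 0" "smooth \<phi>"
    using test_functionE[OF assms] by blast
  have "compact (\<phi> ` K)"
    using K smooth_imp_continuous_on compact_continuous_image by blast
  then obtain B where "\<And>y. y \<in> \<phi> ` K \<Longrightarrow> norm y \<le> B"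
    using compact_imp_bounded bounded_iff by metis
  then have "\<bar>\<phi> x\<bar> \<le> max B 0" for x
    using K(3)[of x] by (cases "x \<in> K") (auto simp: le_max_iff_disj)
  then show thesis using that by blast
qed

lemma test_function_measurable:
  assumes "test_function \<Omega> \<phi>"
  shows "\<phi> \<in> borel_measurable (lebesgue_on S)"
proof -
  have "\<phi> \<in> borel_measurable borel"
  proof (rule borel_measurable_continuous_onI)
    show "continuous_on UNIV \<phi>"
      using assms unfolding test_function_def by (blast intro: smooth_imp_continuous_on)
  qed
  then show ?thesis
    by (intro measurable_restrict_space1 measurable_completion) simp
qed

text \<open>The powers of \<open>t\<close> are there because the linear span of these functions is then closed under
  differentiation, which makes the smoothness of \<open>flat c 0\<close> a single induction.\<close>

definition flat :: "real \<Rightarrow> nat \<Rightarrow> real \<Rightarrow> real" where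
  "flat c k t = (if 0 < t then exp (- c / t) / t ^ k else 0)"

text \<open>This is the difference quotient at \<open>0\<close>; it vanishes because the exponential beats every power
  of \<open>1 / t\<close>.\<close>

lemma flat_div_tendsto_0:
  assumes "0 < c"
  shows "((\<lambda>t. flat c k t / t) \<longlongrightarrow> 0) (at 0)"
proof -
  have "((\<lambda>u. 1 / c ^ Suc k * ((c * u) ^ Suc k / exp (c * u))) \<longlongrightarrow> 1 / c ^ Suc k * 0) at_top"
    by (intro tendsto_mult tendsto_const filterlim_compose[OF tendsto_power_div_exp_0]
        filterlim_tendsto_pos_mult_at_top[OF tendsto_const assms] filterlim_ident)
  moreover have "1 / c ^ Suc k * ((c * u) ^ Suc k / exp (c * u)) = u ^ Suc k * exp (- c * u)" for u
    using assms by (simp add: power_mult_distrib exp_minus divide_simps)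
  ultimately have "((\<lambda>u. u ^ Suc k * exp (- c * u)) \<longlongrightarrow> 0) at_top" by simp
  then have "((\<lambda>t. (inverse t) ^ Suc k * exp (- c * inverse t)) \<longlongrightarrow> 0) (at_right 0)"
    by (rule filterlim_compose[OF _ filterlim_inverse_at_top_right])
  moreover have "\<forall>\<^sub>F t in at_right 0. (inverse t) ^ Suc k * exp (- c * inverse t) = flat c k t / t"
    unfolding eventually_at_filter
    by (rule always_eventually) (simp add: flat_def divide_inverse power_inverse)
  ultimately have "((\<lambda>t. flat c k t / t) \<longlongrightarrow> 0) (at_right 0)"
    by (rule Lim_transform_eventually)
  moreover have "\<forall>\<^sub>F t in at_left 0. 0 = flat c k t / t"
    unfolding eventually_at_filter by (rule always_eventually) (auto simp: flat_def)
  then have "((\<lambda>t. flat c k t / t) \<longlongrightarrow> 0) (at_left 0)"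
    by (rule Lim_transform_eventually[OF tendsto_const])
  ultimately show ?thesis
    by (intro filterlim_split_at)
qed

lemma DERIV_flat:
  assumes "0 < c"
  shows "(flat c k has_real_derivative c * flat c (k + 2) t - real k * flat c (k + 1) t) (at t)"
proof -
  consider "t < 0" | "t = 0" | "t > 0" by linarith
  then show ?thesis
  proof cases
    case 1
    then have "((\<lambda>_. 0) has_real_derivative 0) (at t)" by simp
    then have "(flat c k has_real_derivative 0) (at t)"
      by (rule has_field_derivative_transform_within_open[where S = "{..<0}"]) (use 1 in \<open>auto simp: flat_def\<close>)
    then show ?thesis using 1 by (simp add: flat_def)
  next
    case 2
    have "(flat c k has_real_derivative 0) (at 0)"
      using flat_div_tendsto_0[OF assms, of k] unfolding has_field_derivative_iff
      by (simp add: flat_def)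
    then show ?thesis using 2 by (simp add: flat_def)
  next
    case 3
    have "((\<lambda>t. exp (- c / t) / t ^ k) has_real_derivative c * flat c (k + 2) t - real k * flat c (k + 1) t) (at t)"
    proof (cases k)
      case 0
      show ?thesis
        using 3 unfolding 0
        by (auto intro!: derivative_eq_intros simp: flat_def field_simps power2_eq_square)
    next
      case (Suc m)
      have "t ^ m * real m = real m * (t * t ^ (m - 1))" by (cases m) auto
      then show ?thesis
        using 3 unfolding Suc
        by (auto intro!: derivative_eq_intros simp: flat_def field_simps power2_eq_square)
    qed
    then show ?thesis
      by (rule has_field_derivative_transform_within_open[where S = "{0<..}"]) (use 3 in \<open>auto simp: flat_def\<close>)
  qed
qed

lemma smooth_flat:
  assumes "0 < c"
  shows "smooth (\<lambda>x. flat c k (s * x $ i + a))"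
proof -
  have "Ck n (\<lambda>x. flat c k (s * x $ i + a))" for n
  proof (induction n arbitrary: k)
    case 0
    have "continuous_on UNIV (flat c k)"
      using DERIV_flat[OF assms] DERIV_isCont continuous_at_imp_continuous_on by blast
    then show ?case
      by (auto intro!: continuous_intros continuous_on_compose2[of UNIV "flat c k"])
  next
    case (Suc n)
    let ?d = "\<lambda>y. c * flat c (k + 2) y + (- real k) * flat c (k + 1) y"
    have der: "((\<lambda>x. flat c k (s * x $ i + a)) has_derivative
        (\<lambda>h. ?d (s * x $ i + a) * (s * h $ i))) (at x)" for x :: "real^3"
    proof -
      have "(flat c k has_derivative (\<lambda>h. ?d (s * x $ i + a) * h)) (at (s * x $ i + a))"
        using DERIV_flat[OF assms, of k "s * x $ i + a"] by (simp add: has_field_derivative_def)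
      moreover have "((\<lambda>x. s * x $ i + a) has_derivative (\<lambda>h. s * h $ i)) (at x)"
        by (intro has_derivative_add_const has_derivative_mult_right bounded_linear_imp_has_derivative
            bounded_linear_vec_nth)
      ultimately show ?thesis by (rule has_derivative_compose[rotated])
    qed
    have "partial j (\<lambda>x. flat c k (s * x $ i + a))
        = (\<lambda>x. (s * axis j 1 $ i) * (c * flat c (k + 2) (s * x $ i + a)
            + (- real k) * flat c (k + 1) (s * x $ i + a)))" for j
      by (rule ext, subst partial_eqI[OF der]) simp
    moreover have "Ck n (\<lambda>x. (s * axis j 1 $ i) * (c * flat c (k + 2) (s * x $ i + a)
            + (- real k) * flat c (k + 1) (s * x $ i + a)))" for j
      by (intro Ck_mult Ck_add Ck_const Suc.IH)
    moreover have "(\<lambda>x. flat c k (s * x $ i + a)) differentiable at x" for x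
      using der differentiable_def by blast
    ultimately show ?case by simp
  qed
  then show ?thesis by (simp add: smooth_def)
qed

text \<open>The small constant \<open>1 / Suc n\<close> in the exponent makes these functions increase to the indicator function of
  the box.\<close>

definition bump :: "real^3 \<Rightarrow> real^3 \<Rightarrow> nat \<Rightarrow> real^3 \<Rightarrow> real" where
  "bump a b n x = (\<Prod>i\<in>UNIV. flat (1 / real (Suc n)) 0 (x $ i - a $ i)
                     * flat (1 / real (Suc n)) 0 (b $ i - x $ i))"

lemma flat_0_bounds: "0 < c \<Longrightarrow> 0 \<le> flat c 0 t \<and> flat c 0 t \<le> 1"
  by (simp add: flat_def)

lemma bump_bounds: "0 \<le> bump a b n x" "bump a b n x \<le> 1"
  unfolding bump_def by (intro prod_nonneg prod_le_1 ballI conjI mult_nonneg_nonneg mult_le_one; simp add: flat_0_bounds)+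

lemma bump_eq_0: "x \<notin> box a b \<Longrightarrow> bump a b n x = 0"
  by (auto simp: bump_def flat_def mem_box_cart)

lemma test_function_bump:
  assumes "cbox a b \<subseteq> \<Omega>"
  shows "test_function \<Omega> (bump a b n)"
proof -
  let ?c = "1 / real (Suc n)"
  have "smooth (\<lambda>x. flat ?c 0 (x $ i - a $ i))" for i
    using smooth_flat[of ?c 0 1 i "- a $ i"] by simp
  moreover have "smooth (\<lambda>x. flat ?c 0 (b $ i - x $ i))" for i
    using smooth_flat[of ?c 0 "-1" i "b $ i"] by simp
  ultimately have "smooth (bump a b n)"
    unfolding bump_def by (intro smooth_prod smooth_mult) auto
  moreover have "bump a b n x = 0" if "x \<notin> cbox a b" for x
    using that box_subset_cbox bump_eq_0 by blast
  ultimately show ?thesis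
    unfolding test_function_def using assms compact_cbox by blast
qed

lemma bump_tendsto: "(\<lambda>n. bump a b n x) \<longlonglongrightarrow> indicator (box a b) x"
proof (cases "x \<in> box a b")
  case True
  have z: "(\<lambda>n. 1 / real (Suc n)) \<longlonglongrightarrow> 0"
    using LIMSEQ_inverse_real_of_nat by (simp add: inverse_eq_divide)
  have "(\<lambda>n. flat (1 / real (Suc n)) 0 t) \<longlonglongrightarrow> 1" if "0 < t" for t
  proof -
    have "(\<lambda>n. exp (- (1 / real (Suc n)) / t)) \<longlonglongrightarrow> exp (- 0 / t)"
      using that z by (intro tendsto_intros) auto
    then show ?thesis using that by (simp add: flat_def)
  qed
  then have "(\<lambda>n. bump a b n x) \<longlonglongrightarrow> (\<Prod>i::3\<in>UNIV. 1 * 1)"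
    using True unfolding bump_def by (intro tendsto_intros) (auto simp: mem_box_cart)
  then show ?thesis using True by simp
qed (simp add: bump_eq_0)

section \<open>Square-integrable functions\<close>

lemma L2_measurable: "f \<in> L2 M \<Longrightarrow> f \<in> borel_measurable M"
  and L2_integrable_sq: "f \<in> L2 M \<Longrightarrow> integrable M (\<lambda>x. (f x)\<^sup>2)"
  by (auto simp: L2_def)

lemma L2_zero: "(\<lambda>x. 0) \<in> L2 M"
  by (simp add: L2_def)

lemma L2_mult_integrable:
  assumes "f \<in> L2 M" "g \<in> L2 M"
  shows "integrable M (\<lambda>x. f x * g x)"
proof (rule Bochner_Integration.integrable_bound)
  show "integrable M (\<lambda>x. (f x)\<^sup>2 + (g x)\<^sup>2)"
    using assms by (intro Bochner_Integration.integrable_add L2_integrable_sq)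
  show "(\<lambda>x. f x * g x) \<in> borel_measurable M"
    using assms by (intro borel_measurable_times L2_measurable)
  have "norm (f x * g x) \<le> norm ((f x)\<^sup>2 + (g x)\<^sup>2)" for x
  proof -
    have "2 * (\<bar>f x\<bar> * \<bar>g x\<bar>) \<le> \<bar>f x\<bar>\<^sup>2 + \<bar>g x\<bar>\<^sup>2"
      using sum_squares_bound[of "\<bar>f x\<bar>" "\<bar>g x\<bar>"] by simp
    then have "2 * (\<bar>f x\<bar> * \<bar>g x\<bar>) \<le> (f x)\<^sup>2 + (g x)\<^sup>2" by simp
    moreover have "0 \<le> \<bar>f x\<bar> * \<bar>g x\<bar>" by simp
    ultimately have "\<bar>f x\<bar> * \<bar>g x\<bar> \<le> (f x)\<^sup>2 + (g x)\<^sup>2" by linarith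
    then show ?thesis by (simp add: abs_mult)
  qed
  then show "AE x in M. norm (f x * g x) \<le> norm ((f x)\<^sup>2 + (g x)\<^sup>2)" by simp
qed

lemma L2_add:
  assumes "f \<in> L2 M" "g \<in> L2 M"
  shows "(\<lambda>x. f x + g x) \<in> L2 M"
  using assms L2_mult_integrable[OF assms] L2_integrable_sq
  by (auto simp: L2_def power2_sum mult.assoc)

lemma L2_bounded_mult:
  assumes "f \<in> L2 M" "a \<in> borel_measurable M" "\<And>x. x \<in> space M \<Longrightarrow> \<bar>a x\<bar> \<le> B"
  shows "(\<lambda>x. a x * f x) \<in> L2 M"
proof -
  have "integrable M (\<lambda>x. (a x * f x)\<^sup>2)"
  proof (rule Bochner_Integration.integrable_bound)
    show "integrable M (\<lambda>x. B\<^sup>2 * (f x)\<^sup>2)" using assms L2_integrable_sq by auto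
    show "(\<lambda>x. (a x * f x)\<^sup>2) \<in> borel_measurable M"
      using assms(2) L2_measurable[OF assms(1)] by simp
    show "AE x in M. norm ((a x * f x)\<^sup>2) \<le> norm (B\<^sup>2 * (f x)\<^sup>2)"
    proof (rule AE_I2)
      fix x assume "x \<in> space M"
      then have "\<bar>a x\<bar>\<^sup>2 \<le> B\<^sup>2" using assms(3) by (intro power_mono) auto
      then show "norm ((a x * f x)\<^sup>2) \<le> norm (B\<^sup>2 * (f x)\<^sup>2)"
        by (simp add: power_mult_distrib mult_right_mono)
    qed
  qed
  then show ?thesis using assms(1,2) by (auto simp: L2_def)
qed

lemma L2_cmult: "f \<in> L2 M \<Longrightarrow> (\<lambda>x. c * f x) \<in> L2 M"
  by (rule L2_bounded_mult[where B = "\<bar>c\<bar>"]) auto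

lemma L2_diff: "f \<in> L2 M \<Longrightarrow> g \<in> L2 M \<Longrightarrow> (\<lambda>x. f x - g x) \<in> L2 M"
  using L2_add[of f M "\<lambda>x. - 1 * g x"] L2_cmult[of g M "- 1"] by simp

lemma L2_sum: "finite I \<Longrightarrow> (\<And>i. i \<in> I \<Longrightarrow> f i \<in> L2 M) \<Longrightarrow> (\<lambda>x. \<Sum>i\<in>I. f i x) \<in> L2 M"
  by (induction I rule: finite_induct) (auto simp: L2_zero intro: L2_add)

lemma L2_cong_AE:
  assumes "f \<in> L2 M" "g \<in> borel_measurable M" "AE x in M. g x = f x"
  shows "g \<in> L2 M"
proof -
  have "integrable M (\<lambda>x. (f x)\<^sup>2) = integrable M (\<lambda>x. (g x)\<^sup>2)"
    using assms by (intro integrable_cong_AE) (auto simp: L2_def)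
  then show ?thesis using assms by (auto simp: L2_def)
qed

lemma L2_norm_nonneg: "0 \<le> L2_norm M f"
  by (simp add: L2_norm_def)

lemma L2_norm_sq: "(L2_norm M f)\<^sup>2 = (LINT x|M. (f x)\<^sup>2)"
  by (simp add: L2_norm_def)

lemma L2_norm_zero: "L2_norm M (\<lambda>x. 0) = 0"
  by (simp add: L2_norm_def)

lemma L2_norm_cong_AE:
  assumes "f \<in> borel_measurable M" "g \<in> borel_measurable M" "AE x in M. f x = g x"
  shows "L2_norm M f = L2_norm M g"
  unfolding L2_norm_def
  by (rule arg_cong[where f = sqrt], rule integral_cong_AE) (use assms in auto)

lemma L2_norm_cmult: "L2_norm M (\<lambda>x. c * f x) = \<bar>c\<bar> * L2_norm M f"
  by (simp add: L2_norm_def power_mult_distrib real_sqrt_mult)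

lemma L2_norm_minus_commute: "L2_norm M (\<lambda>x. f x - g x) = L2_norm M (\<lambda>x. g x - f x)"
  by (simp add: L2_norm_def power2_commute)

lemma L2_norm_eq_0_imp_AE:
  assumes "f \<in> L2 M" "L2_norm M f = 0"
  shows "AE x in M. f x = 0"
proof -
  have "(LINT x|M. (f x)\<^sup>2) = 0" using assms(2) by (simp add: L2_norm_def)
  then have "AE x in M. (f x)\<^sup>2 = 0"
    using integral_nonneg_eq_0_iff_AE[OF L2_integrable_sq[OF assms(1)]] by simp
  then show ?thesis by simp
qed

text \<open>The quadratic polynomial \<open>t \<mapsto> \<parallel>t f + g\<parallel>\<^sup>2\<close> is nonnegative, so its discriminant is not positive.\<close>

lemma L2_Cauchy_Schwarz:
  assumes "f \<in> L2 M" "g \<in> L2 M"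
  shows "\<bar>LINT x|M. f x * g x\<bar> \<le> L2_norm M f * L2_norm M g"
proof -
  define a b c where "a = (LINT x|M. (f x)\<^sup>2)" and "b = (LINT x|M. f x * g x)"
    and "c = (LINT x|M. (g x)\<^sup>2)"
  have nonneg: "0 \<le> t\<^sup>2 * a + 2 * t * b + c" for t
  proof -
    have "0 \<le> (LINT x|M. (t * f x + g x)\<^sup>2)" by simp
    also have "\<dots> = (LINT x|M. t\<^sup>2 * (f x)\<^sup>2 + 2 * t * (f x * g x) + (g x)\<^sup>2)"
      by (intro Bochner_Integration.integral_cong) (auto simp: power2_eq_square algebra_simps)
    also have "\<dots> = t\<^sup>2 * a + 2 * t * b + c"
      using L2_integrable_sq[OF assms(1)] L2_integrable_sq[OF assms(2)] L2_mult_integrable[OF assms]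
      by (simp add: a_def b_def c_def)
    finally show ?thesis .
  qed
  have "b\<^sup>2 \<le> a * c"
  proof (cases "a = 0")
    case True
    have "b = 0"
    proof (rule ccontr)
      assume "b \<noteq> 0"
      \<comment> \<open>here the polynomial is affine with nonzero slope, and it takes the value \<open>- 1\<close>\<close>
      then have "2 * (- (c + 1) / (2 * b)) * b = - (c + 1)" by simp
      then show False using nonneg[of "- (c + 1) / (2 * b)"] True by simp
    qed
    then show ?thesis using True by simp
  next
    case False
    then have "0 < a" by (simp add: a_def order_less_le)
    then have "0 \<le> c - b\<^sup>2 / a" using nonneg[of "- b / a"] by (simp add: power2_eq_square field_simps)
    then show ?thesis using \<open>0 < a\<close> by (simp add: field_simps)
  qed
  then have "sqrt (b\<^sup>2) \<le> sqrt (a * c)" by (rule real_sqrt_le_mono)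
  then show ?thesis by (simp add: a_def b_def c_def L2_norm_def real_sqrt_mult)
qed

lemma L2_norm_triangle:
  assumes "f \<in> L2 M" "g \<in> L2 M"
  shows "L2_norm M (\<lambda>x. f x + g x) \<le> L2_norm M f + L2_norm M g"
proof (rule power2_le_imp_le)
  have "(L2_norm M (\<lambda>x. f x + g x))\<^sup>2 = (LINT x|M. (f x)\<^sup>2 + 2 * (f x * g x) + (g x)\<^sup>2)"
    unfolding L2_norm_sq by (intro Bochner_Integration.integral_cong) (auto simp: power2_sum)
  also have "\<dots> = (L2_norm M f)\<^sup>2 + 2 * (LINT x|M. f x * g x) + (L2_norm M g)\<^sup>2"
    using L2_integrable_sq[OF assms(1)] L2_integrable_sq[OF assms(2)] L2_mult_integrable[OF assms]
    by (simp add: L2_norm_sq)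
  also have "\<dots> \<le> (L2_norm M f)\<^sup>2 + 2 * (L2_norm M f * L2_norm M g) + (L2_norm M g)\<^sup>2"
    using L2_Cauchy_Schwarz[OF assms] by linarith
  also have "\<dots> = (L2_norm M f + L2_norm M g)\<^sup>2" by (simp add: power2_sum)
  finally show "(L2_norm M (\<lambda>x. f x + g x))\<^sup>2 \<le> (L2_norm M f + L2_norm M g)\<^sup>2" .
qed (simp add: L2_norm_nonneg)

lemma L2_norm_diff_le:
  assumes "f \<in> L2 M" "g \<in> L2 M"
  shows "\<bar>L2_norm M f - L2_norm M g\<bar> \<le> L2_norm M (\<lambda>x. f x - g x)"
  using L2_norm_triangle[OF L2_diff[OF assms] assms(2)]
    L2_norm_triangle[OF L2_diff[OF assms(2,1)] assms(1)] L2_norm_minus_commute[of M f g] by simp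

lemma L2_norm_midpoint:
  assumes "f \<in> L2 M" "g \<in> L2 M"
  shows "(L2_norm M (\<lambda>x. 1/2 * f x + 1/2 * g x))\<^sup>2
    = ((L2_norm M f)\<^sup>2 + (L2_norm M g)\<^sup>2) / 2 - (L2_norm M (\<lambda>x. f x - g x))\<^sup>2 / 4"
proof -
  have "(L2_norm M (\<lambda>x. 1/2 * f x + 1/2 * g x))\<^sup>2
      = (LINT x|M. (f x)\<^sup>2 / 2 + (g x)\<^sup>2 / 2 - (f x - g x)\<^sup>2 / 4)"
    unfolding L2_norm_sq
    by (intro Bochner_Integration.integral_cong) (auto simp: power2_eq_square field_simps)
  also have "\<dots> = ((L2_norm M f)\<^sup>2 + (L2_norm M g)\<^sup>2) / 2 - (L2_norm M (\<lambda>x. f x - g x))\<^sup>2 / 4"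
    using L2_integrable_sq[OF assms(1)] L2_integrable_sq[OF assms(2)] L2_integrable_sq[OF L2_diff[OF assms]]
    by (simp add: L2_norm_sq add_divide_distrib)
  finally show ?thesis .
qed

lemma L2_norm_sum_le:
  "finite I \<Longrightarrow> (\<And>i. i \<in> I \<Longrightarrow> f i \<in> L2 M) \<Longrightarrow>
    L2_norm M (\<lambda>x. \<Sum>i\<in>I. f i x) \<le> (\<Sum>i\<in>I. L2_norm M (f i))"
proof (induction I rule: finite_induct)
  case (insert i I)
  then have "L2_norm M (\<lambda>x. f i x + (\<Sum>i\<in>I. f i x)) \<le> L2_norm M (f i) + L2_norm M (\<lambda>x. \<Sum>i\<in>I. f i x)"
    by (intro L2_norm_triangle L2_sum) auto
  with insert show ?case by fastforce
qed (simp add: L2_norm_zero)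

lemma L2_norm_bounded_mult_le:
  assumes "f \<in> L2 M" "a \<in> borel_measurable M" "\<And>x. x \<in> space M \<Longrightarrow> \<bar>a x\<bar> \<le> B" "0 \<le> B"
  shows "L2_norm M (\<lambda>x. a x * f x) \<le> B * L2_norm M f"
proof -
  have "(LINT x|M. (a x * f x)\<^sup>2) \<le> (LINT x|M. (B * f x)\<^sup>2)"
  proof (rule integral_mono)
    show "integrable M (\<lambda>x. (a x * f x)\<^sup>2)"
      using L2_bounded_mult[OF assms(1-3)] by (simp add: L2_integrable_sq)
    show "integrable M (\<lambda>x. (B * f x)\<^sup>2)"
      using L2_cmult[OF assms(1)] by (simp add: L2_integrable_sq)
    fix x assume "x \<in> space M"
    then have "\<bar>a x\<bar>\<^sup>2 \<le> B\<^sup>2" using assms(3) by (intro power_mono) auto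
    then show "(a x * f x)\<^sup>2 \<le> (B * f x)\<^sup>2"
      by (simp add: power_mult_distrib mult_right_mono)
  qed
  then have "L2_norm M (\<lambda>x. a x * f x) \<le> L2_norm M (\<lambda>x. B * f x)"
    unfolding L2_norm_def by (rule real_sqrt_le_mono)
  then show ?thesis using assms(4) by (simp add: L2_norm_cmult)
qed

lemma L2_integrable_if_finite:
  assumes "finite_measure M" "f \<in> L2 M"
  shows "integrable M f"
    and "(LINT x|M. \<bar>f x\<bar>) \<le> sqrt (measure M (space M)) * L2_norm M f"
proof -
  interpret finite_measure M by fact
  have one: "(\<lambda>x. 1) \<in> L2 M" by (simp add: L2_def)
  show "integrable M f" using L2_mult_integrable[OF one assms(2)] by simp
  have "(\<lambda>x. \<bar>f x\<bar>) \<in> L2 M" using assms(2) by (auto simp: L2_def)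
  from L2_Cauchy_Schwarz[OF one this]
  show "(LINT x|M. \<bar>f x\<bar>) \<le> sqrt (measure M (space M)) * L2_norm M f"
    by (simp add: L2_norm_def)
qed

text \<open>Riesz-Fischer on a finite measure space. A rapidly converging subsequence converges almost
  everywhere because the sum of its increments has finite \<open>L\<^sub>1\<close> norm, and Fatou's lemma turns the
  Cauchy property into convergence to the pointwise limit.\<close>

lemma L2_complete:
  assumes fin: "finite_measure M" and f: "\<And>n. f n \<in> L2 M"
    and Cauchy: "\<And>e. 0 < e \<Longrightarrow> \<exists>N. \<forall>m\<ge>N. \<forall>n\<ge>N. L2_norm M (\<lambda>x. f m x - f n x) < e"
  obtains g where "g \<in> L2 M" "(\<lambda>n. L2_norm M (\<lambda>x. f n x - g x)) \<longlonglongrightarrow> 0"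
proof -
  have [measurable]: "f n \<in> borel_measurable M" for n using f L2_measurable by blast
  have "\<exists>N. \<forall>m\<ge>N. \<forall>n\<ge>N. L2_norm M (\<lambda>x. f m x - f n x) < (1/2) ^ k" for k :: nat
    by (rule Cauchy) simp
  then obtain N where N: "\<And>k m n. m \<ge> N k \<Longrightarrow> n \<ge> N k \<Longrightarrow> L2_norm M (\<lambda>x. f m x - f n x) < (1/2) ^ k"
    by metis
  define r where "r k = (\<Sum>i\<le>k. N i) + k" for k
  have r_ge: "N k \<le> r k" "k \<le> r k" for k
    unfolding r_def using member_le_sum[of k "{..k}" N] by auto
  have r_mono: "r k \<le> r (Suc k)" for k by (simp add: r_def)
  define d where "d k x = f (r (Suc k)) x - f (r k) x" for k x
  have [measurable]: "d k \<in> borel_measurable M" for k by (simp add: d_def[abs_def])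
  have d_L2: "d k \<in> L2 M" for k unfolding d_def[abs_def] by (intro L2_diff f)
  have d_norm: "L2_norm M (d k) \<le> (1/2) ^ k" for k
    unfolding d_def[abs_def] using N[of k "r (Suc k)" "r k"] r_ge[of k] r_mono[of k] by fastforce
  define c where "c = sqrt (measure M (space M))"
  have c: "0 \<le> c" by (simp add: c_def)
  have d1: "(\<integral>\<^sup>+x. ennreal \<bar>d k x\<bar> \<partial>M) \<le> ennreal (c * (1/2) ^ k)" for k
  proof -
    have "(\<integral>\<^sup>+x. ennreal \<bar>d k x\<bar> \<partial>M) = ennreal (LINT x|M. \<bar>d k x\<bar>)"
      using L2_integrable_if_finite(1)[OF fin d_L2] by (intro nn_integral_eq_integral) auto
    also have "(LINT x|M. \<bar>d k x\<bar>) \<le> c * L2_norm M (d k)"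
      using L2_integrable_if_finite(2)[OF fin d_L2] by (simp add: c_def)
    also have "\<dots> \<le> c * (1/2) ^ k" using d_norm c by (rule mult_left_mono)
    finally show ?thesis by (simp add: ennreal_leI)
  qed
  have "(\<integral>\<^sup>+x. (\<Sum>k. ennreal \<bar>d k x\<bar>) \<partial>M) = (\<Sum>k. \<integral>\<^sup>+x. ennreal \<bar>d k x\<bar> \<partial>M)"
    by (rule nn_integral_suminf) simp
  also have "\<dots> \<le> (\<Sum>k. ennreal (c * (1/2) ^ k))"
    by (intro suminf_le d1) auto
  also have "\<dots> = ennreal (\<Sum>k. c * (1/2) ^ k)"
    using c by (intro suminf_ennreal2 summable_mult summable_geometric) auto
  finally have "(\<integral>\<^sup>+x. (\<Sum>k. ennreal \<bar>d k x\<bar>) \<partial>M) \<noteq> \<infinity>"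
    by (auto simp: top_unique)
  then have "AE x in M. (\<Sum>k. ennreal \<bar>d k x\<bar>) \<noteq> \<infinity>"
    by (intro nn_integral_PInf_AE) auto
  then have conv: "AE x in M. convergent (\<lambda>k. f (r k) x)"
  proof eventually_elim
    case (elim x)
    then have "summable (\<lambda>k. \<bar>d k x\<bar>)" by (intro summable_suminf_not_top) auto
    then have "summable (\<lambda>k. d k x)" by (rule summable_rabs_cancel)
    then have "convergent (\<lambda>n. \<Sum>k<n. d k x)" by (simp add: summable_iff_convergent)
    moreover have "(\<Sum>k<n. d k x) = f (r n) x - f (r 0) x" for n
      by (simp add: d_def sum_lessThan_telescope[of "\<lambda>k. f (r k) x"])
    ultimately have "convergent (\<lambda>n. f (r n) x - f (r 0) x)" by simp
    then show ?case by (simp add: convergent_diff_const_right_iff)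
  qed
  define g where "g x = lim (\<lambda>k. f (r k) x)" for x
  have g_meas[measurable]: "g \<in> borel_measurable M"
    unfolding g_def[abs_def] by (intro borel_measurable_lim_metric) simp
  have lim: "AE x in M. (\<lambda>k. f (r k) x) \<longlonglongrightarrow> g x"
    using conv by eventually_elim (simp add: g_def convergent_LIMSEQ_iff)
  have fatou: "(\<integral>\<^sup>+x. ennreal ((f n x - g x)\<^sup>2) \<partial>M) \<le> ennreal (e\<^sup>2)"
    if e: "\<And>k. K \<le> k \<Longrightarrow> L2_norm M (\<lambda>x. f n x - f (r k) x) \<le> e" for n K e
  proof -
    have "(\<integral>\<^sup>+x. ennreal ((f n x - g x)\<^sup>2) \<partial>M)
        = (\<integral>\<^sup>+x. liminf (\<lambda>k. ennreal ((f n x - f (r k) x)\<^sup>2)) \<partial>M)"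
    proof (rule nn_integral_cong_AE)
      show "AE x in M. ennreal ((f n x - g x)\<^sup>2) = liminf (\<lambda>k. ennreal ((f n x - f (r k) x)\<^sup>2))"
        using lim
      proof eventually_elim
        case (elim x)
        then have "(\<lambda>k. ennreal ((f n x - f (r k) x)\<^sup>2)) \<longlonglongrightarrow> ennreal ((f n x - g x)\<^sup>2)"
          by (intro tendsto_intros)
        then show ?case by (intro lim_imp_Liminf[symmetric]) auto
      qed
    qed
    also have "\<dots> \<le> liminf (\<lambda>k. \<integral>\<^sup>+x. ennreal ((f n x - f (r k) x)\<^sup>2) \<partial>M)"
      by (intro nn_integral_liminf) simp
    also have "\<dots> \<le> ennreal (e\<^sup>2)"
    proof (rule Liminf_le)
      have "(\<integral>\<^sup>+x. ennreal ((f n x - f (r k) x)\<^sup>2) \<partial>M) \<le> ennreal (e\<^sup>2)" if "K \<le> k" for k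
      proof -
        have "(\<integral>\<^sup>+x. ennreal ((f n x - f (r k) x)\<^sup>2) \<partial>M) = ennreal ((L2_norm M (\<lambda>x. f n x - f (r k) x))\<^sup>2)"
          unfolding L2_norm_sq using L2_integrable_sq[OF L2_diff[OF f f]]
          by (intro nn_integral_eq_integral) auto
        also have "\<dots> \<le> ennreal (e\<^sup>2)"
          using e[OF that] by (intro ennreal_leI power_mono L2_norm_nonneg)
        finally show ?thesis .
      qed
      then show "\<forall>\<^sub>F k in sequentially. (\<integral>\<^sup>+x. ennreal ((f n x - f (r k) x)\<^sup>2) \<partial>M) \<le> ennreal (e\<^sup>2)"
        using eventually_sequentially by blast
    qed simp
    finally show ?thesis .
  qed
  have fg: "(\<lambda>x. f n x - g x) \<in> L2 M \<and> L2_norm M (\<lambda>x. f n x - g x) \<le> e"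
    if e: "\<And>k. K \<le> k \<Longrightarrow> L2_norm M (\<lambda>x. f n x - f (r k) x) \<le> e" and "0 \<le> e" for n K e
  proof -
    have "(\<integral>\<^sup>+x. ennreal (norm ((f n x - g x)\<^sup>2)) \<partial>M) < \<infinity>"
      using fatou[OF e] by (auto simp: less_top[symmetric] top_unique)
    then have int: "integrable M (\<lambda>x. (f n x - g x)\<^sup>2)"
      by (intro integrableI_bounded) auto
    then have "ennreal (LINT x|M. (f n x - g x)\<^sup>2) \<le> ennreal (e\<^sup>2)"
      using fatou[OF e] by (subst nn_integral_eq_integral[symmetric]) auto
    then have "(LINT x|M. (f n x - g x)\<^sup>2) \<le> e\<^sup>2" by simp
    then show ?thesis
      using int \<open>0 \<le> e\<close> by (auto simp: L2_def L2_norm_def real_le_lsqrt)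
  qed
  have close: "\<exists>N. \<forall>n\<ge>N. (\<lambda>x. f n x - g x) \<in> L2 M \<and> L2_norm M (\<lambda>x. f n x - g x) \<le> e" if e: "0 < e" for e
  proof -
    obtain K where K: "\<And>m n. m \<ge> K \<Longrightarrow> n \<ge> K \<Longrightarrow> L2_norm M (\<lambda>x. f m x - f n x) < e"
      using Cauchy[OF e] by blast
    have "(\<lambda>x. f n x - g x) \<in> L2 M \<and> L2_norm M (\<lambda>x. f n x - g x) \<le> e" if "K \<le> n" for n
    proof (rule fg[of K])
      show "L2_norm M (\<lambda>x. f n x - f (r k) x) \<le> e" if "K \<le> k" for k
        using K[OF \<open>K \<le> n\<close>, of "r k"] r_ge(2)[of k] that by simp
    qed (use e in simp)
    then show ?thesis by blast
  qed
  obtain n where n: "(\<lambda>x. f n x - g x) \<in> L2 M" using close[of 1] by auto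
  have "g \<in> L2 M" using L2_diff[OF f[of n] n] by simp
  moreover have "(\<lambda>n. L2_norm M (\<lambda>x. f n x - g x)) \<longlonglongrightarrow> 0"
  proof (rule LIMSEQ_I)
    fix e :: real assume "0 < e"
    then obtain N where N: "\<forall>n\<ge>N. L2_norm M (\<lambda>x. f n x - g x) \<le> e / 2"
      using close[of "e / 2"] by auto
    show "\<exists>N. \<forall>n\<ge>N. norm (L2_norm M (\<lambda>x. f n x - g x) - 0) < e"
    proof (intro exI allI impI)
      fix n assume "N \<le> n"
      then have "L2_norm M (\<lambda>x. f n x - g x) \<le> e / 2" using N by blast
      then show "norm (L2_norm M (\<lambda>x. f n x - g x) - 0) < e"
        using \<open>0 < e\<close> L2_norm_nonneg[of M "\<lambda>x. f n x - g x"] by simp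
    qed
  qed
  ultimately show thesis using that by blast
qed

lemma L2_integral_tendsto:
  assumes f: "\<And>n. f n \<in> L2 M" and g: "g \<in> L2 M" and h: "h \<in> L2 M"
    and lim: "(\<lambda>n. L2_norm M (\<lambda>x. f n x - g x)) \<longlonglongrightarrow> 0"
  shows "(\<lambda>n. LINT x|M. f n x * h x) \<longlonglongrightarrow> (LINT x|M. g x * h x)"
proof -
  have bound: "norm ((LINT x|M. f n x * h x) - (LINT x|M. g x * h x)) \<le> L2_norm M (\<lambda>x. f n x - g x) * L2_norm M h" for n
  proof -
    have "(LINT x|M. f n x * h x) - (LINT x|M. g x * h x) = (LINT x|M. (f n x - g x) * h x)"
      using L2_mult_integrable[OF f h] L2_mult_integrable[OF g h]
      by (simp add: left_diff_distrib)
    then show ?thesis using L2_Cauchy_Schwarz[OF L2_diff[OF f g] h] by simp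
  qed
  have "(\<lambda>n. (LINT x|M. f n x * h x) - (LINT x|M. g x * h x)) \<longlonglongrightarrow> 0"
    by (rule Lim_null_comparison[OF always_eventually[OF allI[OF bound]] tendsto_mult_left_zero[OF lim]])
  then show ?thesis by (rule LIM_zero_cancel)
qed

section \<open>The fundamental lemma of the calculus of variations\<close>

text \<open>The boxes form an intersection-stable generator of the Borel sets, so the integrals over
  all Borel sets vanish, in particular those over the sets where the function is positive or negative.\<close>

lemma AE_zero_if_box_integrals_zero:
  fixes f :: "'a::euclidean_space \<Rightarrow> real"
  assumes f: "integrable lebesgue f"
    and zero: "\<And>a b. (LINT x|lebesgue. indicator (box a b) x * f x) = 0"
  shows "AE x in lebesgue. f x = 0"
proof -
  obtain g where g[measurable]: "g \<in> borel_measurable borel" and fg: "AE x in lborel. f x = g x"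
    using completion_ex_borel_measurable_real[of f lborel] f by auto
  have fg': "AE x in lebesgue. f x = g x" using fg by (rule AE_completion)
  have "integrable lebesgue g"
    using f fg' by (intro integrable_cong_AE_imp[of lebesgue f g]) (auto simp: measurable_completion)
  then have int: "integrable lborel g" by (simp add: integrable_completion)
  have set_int: "set_integrable lborel A g" if "A \<in> sets borel" for A
    using int that unfolding set_integrable_def by (intro integrable_mult_indicator) simp_all
  have box: "(LINT x:box a b|lborel. g x) = 0" for a b
  proof -
    have "(LINT x:box a b|lborel. g x) = (LINT x|lebesgue. indicator (box a b) x * g x)"
      by (simp add: set_lebesgue_integral_def integral_completion)
    also have "\<dots> = (LINT x|lebesgue. indicator (box a b) x * f x)"
    proof (rule integral_cong_AE)
      show "AE x in lebesgue. indicator (box a b) x * g x = indicator (box a b) x * f x"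
        using fg' by eventually_elim simp
      show "(\<lambda>x. indicator (box a b) x * f x) \<in> borel_measurable lebesgue"
        using f by (intro borel_measurable_times borel_measurable_indicator) auto
    qed (auto intro: measurable_completion)
    finally show ?thesis using zero by simp
  qed
  have UNIV: "(LINT x:UNIV|lborel. g x) = 0"
  proof -
    let ?B = "\<lambda>n::nat. box (- real n *\<^sub>R One) (real n *\<^sub>R One) :: 'a set"
    have U: "(\<Union>n. ?B n) = UNIV"
    proof -
      have "\<exists>n. x \<in> ?B n" for x :: 'a
      proof -
        obtain n where n: "norm x < real n" using reals_Archimedean2 by blast
        have "\<bar>x \<bullet> i\<bar> < real n" if "i \<in> Basis" for i
          using Basis_le_norm[OF that, of x] n by linarith
        then have "x \<in> ?B n" by (fastforce simp: mem_box abs_less_iff)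
        then show ?thesis by blast
      qed
      then show ?thesis by blast
    qed
    have "(\<lambda>n. LINT x:?B n|lborel. g x) \<longlonglongrightarrow> (LINT x:(\<Union>n. ?B n)|lborel. g x)"
    proof (rule set_integral_cont_up)
      show "incseq ?B"
        by (intro incseq_SucI subset_box_imp) (auto simp: inner_left_distrib inner_diff_left)
    qed (auto intro: set_int)
    then show ?thesis unfolding box U by (simp add: LIMSEQ_const_iff)
  qed
  have all: "(LINT x:A|lborel. g x) = 0" if "A \<in> sets borel" for A
  proof -
    have "Int_stable (range (\<lambda>(a, b). box a b :: 'a set))"
      by (auto simp: Int_stable_def box_Int_box)
    moreover have "range (\<lambda>(a, b). box a b :: 'a set) \<subseteq> Pow UNIV" by simp
    moreover have "A \<in> sigma_sets UNIV (range (\<lambda>(a, b). box a b))"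
      using that unfolding borel_eq_box by simp
    ultimately show ?thesis
    proof (induction rule: sigma_sets_induct_disjoint)
      case (basic A)
      then show ?case using box by auto
    next
      case empty
      then show ?case by (simp add: set_lebesgue_integral_def)
    next
      case (compl A)
      then have "A \<in> sets borel" by (simp add: borel_eq_box)
      then have "(LINT x:UNIV|lborel. g x) = (LINT x:A|lborel. g x) + (LINT x:UNIV - A|lborel. g x)"
        using set_integral_Un[of A "UNIV - A" lborel g] by (simp add: set_int)
      then show ?case using UNIV compl by simp
    next
      case (union A)
      then have A: "A i \<in> sets borel" for i by (auto simp: borel_eq_box)
      have "(LINT x:(\<Union>i. A i)|lborel. g x) = (\<Sum>i. LINT x:A i|lborel. g x)"
      proof (rule lebesgue_integral_countable_add)
        show "A i \<inter> A j = {}" if "i \<noteq> j" for i j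
          using union that by (auto simp: disjoint_family_on_def)
      qed (auto intro!: set_int simp: A)
      then show ?case using union by simp
    qed
  qed
  \<comment> \<open>applied below to the function and to its negative\<close>
  have half: "AE x in lborel. h x \<le> 0"
    if h: "integrable lborel h" "h \<in> borel_measurable borel" "\<And>A. A \<in> sets borel \<Longrightarrow> (LINT x:A|lborel. h x) = 0"
    for h :: "'a \<Rightarrow> real"
  proof -
    note [measurable] = h(2)
    define A where "A = {x. 0 < h x}"
    have A[measurable]: "A \<in> sets borel" unfolding A_def by simp
    have "AE x in lborel. indicator A x * h x = 0"
    proof (rule integral_nonneg_eq_0_iff_AE[THEN iffD1])
      show "integrable lborel (\<lambda>x. indicator A x * h x)"
        using integrable_real_mult_indicator[of A lborel h] h(1) A by (simp add: mult.commute)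
      show "(LINT x|lborel. indicator A x * h x) = 0"
        using h(3)[OF A] by (simp add: set_lebesgue_integral_def)
    qed (auto simp: A_def indicator_def)
    then show ?thesis by eventually_elim (auto simp: A_def indicator_def split: if_splits)
  qed
  have "AE x in lborel. g x \<le> 0" using half[OF int g all] by blast
  moreover have "AE x in lborel. - g x \<le> 0"
    using all int g by (intro half) (auto simp: set_lebesgue_integral_def)
  ultimately have "AE x in lborel. g x = 0" by eventually_elim simp
  then have "AE x in lebesgue. g x = 0" by (rule AE_completion)
  with fg' show ?thesis by eventually_elim simp
qed

lemma locally_integrable_test_mult:
  assumes "open \<Omega>" "locally_integrable \<Omega> f" "test_function \<Omega> \<phi>"
  shows "integrable (lebesgue_on \<Omega>) (\<lambda>x. f x * \<phi> x)"
proof -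
  obtain K where K: "compact K" "K \<subseteq> \<Omega>" "\<And>x. x \<notin> K \<Longrightarrow> \<phi> x = 0" "smooth \<phi>"
    using test_functionE[OF assms(3)] by blast
  obtain B where B: "\<And>x. \<bar>\<phi> x\<bar> \<le> B" using test_function_bounded[OF assms(3)] by blast
  have "integrable (lebesgue_on K) f"
    using assms(2) K by (simp add: locally_integrable_def)
  then have "integrable (lebesgue_on K) (\<lambda>x. f x * \<phi> x)"
  proof (intro Bochner_Integration.integrable_bound[where f = "\<lambda>x. B * f x" and g = "\<lambda>x. f x * \<phi> x"])
    show "AE x in lebesgue_on K. norm (f x * \<phi> x) \<le> norm (B * f x)"
      using B order_trans[OF B abs_ge_self] by (auto simp: abs_mult mult.commute intro!: mult_right_mono)
  qed (auto intro!: borel_measurable_times test_function_measurable[OF assms(3)])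
  then have "integrable lebesgue (\<lambda>x. if x \<in> K then f x * \<phi> x else 0)"
    using K(1) Lebesgue_Measure.integrable_restrict_UNIV[of K "\<lambda>x. f x * \<phi> x"]
    by (simp add: lmeasurable_compact fmeasurableD)
  moreover have "(\<lambda>x. if x \<in> K then f x * \<phi> x else 0) = (\<lambda>x. if x \<in> \<Omega> then f x * \<phi> x else 0)"
    using K(2,3) by (intro ext) auto
  ultimately show ?thesis
    using assms(1) Lebesgue_Measure.integrable_restrict_UNIV[of \<Omega> "\<lambda>x. f x * \<phi> x"]
    by (simp add: borel_open)
qed


text \<open>Testing with the bump functions of a box gives, in the limit, the integral over the box.
  Only boxes whose closure lies in the open set are available; countably many of them cover it.\<close>

lemma AE_zero_if_test_integrals_zero:
  assumes \<Omega>: "open \<Omega>" and f: "locally_integrable \<Omega> f"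
    and zero: "\<And>\<phi>. test_function \<Omega> \<phi> \<Longrightarrow> (LINT x|lebesgue_on \<Omega>. f x * \<phi> x) = 0"
  shows "AE x in lebesgue_on \<Omega>. f x = 0"
proof -
  have \<Omega>_sets: "\<Omega> \<in> sets lebesgue" using \<Omega> by (simp add: borel_open)
  have int_cbox: "integrable lebesgue (\<lambda>x. if x \<in> cbox a b then f x else 0)" if "cbox a b \<subseteq> \<Omega>" for a b
    using f that Lebesgue_Measure.integrable_restrict_UNIV[of "cbox a b" f] compact_cbox[of a b]
    by (simp add: locally_integrable_def)
  have box: "(LINT x|lebesgue. indicator (box a b) x * f x) = 0" if sub: "cbox a b \<subseteq> \<Omega>" for a b
  proof -
    let ?F = "\<lambda>x. if x \<in> cbox a b then f x else 0"
    have F: "?F x * bump a b n x = (if x \<in> \<Omega> then f x * bump a b n x else 0)" for n x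
      using bump_eq_0[of x a b n] box_subset_cbox[of a b] sub by auto
    have "(LINT x|lebesgue. ?F x * bump a b n x) = 0" for n
      unfolding F using zero[OF test_function_bump[OF sub]]
        Lebesgue_Measure.integral_restrict_UNIV[OF \<Omega>_sets, of "\<lambda>x. f x * bump a b n x"] by simp
    moreover have "(\<lambda>n. LINT x|lebesgue. ?F x * bump a b n x) \<longlonglongrightarrow> (LINT x|lebesgue. ?F x * indicator (box a b) x)"
    proof (rule integral_dominated_convergence)
      show "integrable lebesgue (\<lambda>x. \<bar>?F x\<bar>)" using int_cbox[OF sub] by simp
      show "(\<lambda>x. ?F x * indicator (box a b) x) \<in> borel_measurable lebesgue"
        using int_cbox[OF sub] by (intro borel_measurable_times borel_measurable_indicator) auto
      show "(\<lambda>x. ?F x * bump a b n x) \<in> borel_measurable lebesgue" for n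
        using int_cbox[OF sub] test_function_measurable[OF test_function_bump[OF sub], of n UNIV]
        by (intro borel_measurable_times) (auto simp: lebesgue_on_UNIV_eq)
      show "AE x in lebesgue. (\<lambda>n. ?F x * bump a b n x) \<longlonglongrightarrow> ?F x * indicator (box a b) x"
        by (intro AE_I2 tendsto_mult tendsto_const bump_tendsto)
      show "AE x in lebesgue. norm (?F x * bump a b n x) \<le> \<bar>?F x\<bar>" for n
        using bump_bounds by (intro AE_I2) (auto simp: abs_mult mult_left_le)
    qed
    ultimately have "(LINT x|lebesgue. ?F x * indicator (box a b) x) = 0"
      by (simp add: LIMSEQ_const_iff)
    moreover have "?F x * indicator (box a b) x = indicator (box a b) x * f x" for x
      using box_subset_cbox[of a b] by (auto simp: indicator_def)
    ultimately show ?thesis by (simp only:)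
  qed
  have local: "AE x in lebesgue. x \<in> cbox a b \<longrightarrow> f x = 0" if sub: "cbox a b \<subseteq> \<Omega>" for a b
  proof -
    have "AE x in lebesgue. indicator (box a b) x * f x = 0"
    proof (rule AE_zero_if_box_integrals_zero)
      have "integrable lebesgue (\<lambda>x. indicator (box a b) x *\<^sub>R (if x \<in> cbox a b then f x else 0))"
        by (intro integrable_mult_indicator int_cbox sub) simp
      moreover have "indicator (box a b) x *\<^sub>R (if x \<in> cbox a b then f x else 0) = indicator (box a b) x * f x" for x
        using box_subset_cbox[of a b] by (auto simp: indicator_def)
      ultimately show "integrable lebesgue (\<lambda>x. indicator (box a b) x * f x)" by (simp only:)
    next
      fix c d
      obtain u v where uv: "box c d \<inter> box a b = box u v" using box_Int_box by blast
      have ind: "indicator (box c d) x * (indicator (box a b) x * f x) = indicator (box u v) x * f x" for x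
        unfolding uv[symmetric] by (auto simp: indicator_def)
      show "(LINT x|lebesgue. indicator (box c d) x * (indicator (box a b) x * f x)) = 0"
        unfolding ind
      proof (cases "box u v = {}")
        case False
        then have "cbox u v = closure (box u v)" by (simp add: closure_box)
        also have "\<dots> \<subseteq> cbox a b"
          using uv box_subset_cbox[of a b] by (intro closure_minimal) auto
        finally show "(LINT x|lebesgue. indicator (box u v) x * f x) = 0"
          using sub by (intro box) auto
      qed simp
    qed
    moreover have "AE x in lebesgue. x \<notin> cbox a b - box a b"
      using negligible_frontier_interval[of a b] by (intro AE_not_in) (simp add: negligible_iff_null_sets)
    ultimately show ?thesis by eventually_elim (auto simp: indicator_def)
  qed
  obtain \<D> where \<D>: "countable \<D>" "\<D> \<subseteq> Pow \<Omega>" "\<And>X. X \<in> \<D> \<Longrightarrow> \<exists>a b. X = cbox a b" "\<Union>\<D> = \<Omega>"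
    using open_countable_Union_open_cbox[OF \<Omega>] by blast
  have "AE x in lebesgue. \<forall>X\<in>\<D>. x \<in> X \<longrightarrow> f x = 0"
  proof (intro AE_ball_countable[OF \<D>(1), THEN iffD2] ballI)
    fix X assume X: "X \<in> \<D>"
    then obtain a b where ab: "X = cbox a b" using \<D>(3) by blast
    with X \<D>(2) have "cbox a b \<subseteq> \<Omega>" by blast
    then show "AE x in lebesgue. x \<in> X \<longrightarrow> f x = 0" using local ab by blast
  qed
  then have "AE x in lebesgue. x \<in> \<Omega> \<longrightarrow> f x = 0"
    by eventually_elim (use \<D>(4) in blast)
  then show ?thesis using \<Omega>_sets by (simp add: AE_restrict_space_iff)
qed

section \<open>Sobolev spaces on a bounded open set\<close>

locale bounded_open_set =
  fixes \<Omega> :: "(real^3) set"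
  assumes open_\<Omega>: "open \<Omega>" and bounded_\<Omega>: "bounded \<Omega>"
begin

lemma sets_\<Omega>: "\<Omega> \<in> sets lebesgue"
  using open_\<Omega> by (simp add: borel_open)

lemma finite_measure_\<Omega>: "finite_measure (lebesgue_on \<Omega>)"
  by (intro finite_measure_lebesgue_on lmeasurable_open bounded_\<Omega> open_\<Omega>)

lemma L2_locally_integrable:
  assumes "u \<in> L2 (lebesgue_on \<Omega>)"
  shows "locally_integrable \<Omega> u"
  unfolding locally_integrable_def
proof (intro allI impI)
  fix K assume K: "compact K \<and> K \<subseteq> \<Omega>"
  then have K_sets: "K \<in> sets lebesgue" by (simp add: lmeasurable_compact fmeasurableD)
  have "integrable lebesgue (\<lambda>x. if x \<in> \<Omega> then u x else 0)"
    using L2_integrable_if_finite(1)[OF finite_measure_\<Omega> assms]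
      Lebesgue_Measure.integrable_restrict_UNIV[OF sets_\<Omega>, of u] by simp
  then have "integrable lebesgue (\<lambda>x. indicator K x *\<^sub>R (if x \<in> \<Omega> then u x else 0))"
    by (rule integrable_mult_indicator[OF K_sets])
  moreover have "indicator K x *\<^sub>R (if x \<in> \<Omega> then u x else 0) = (if x \<in> K then u x else 0)" for x
    using K by (auto simp: indicator_def)
  ultimately have "integrable lebesgue (\<lambda>x. if x \<in> K then u x else 0)" by (simp only:)
  then show "integrable (lebesgue_on K) u"
    using Lebesgue_Measure.integrable_restrict_UNIV[OF K_sets, of u] by simp
qed

text \<open>Local integrability gives measurability on compact boxes, and countably many of them cover
  the open set.\<close>

lemma locally_integrable_measurable:
  assumes "locally_integrable \<Omega> u"
  shows "u \<in> borel_measurable (lebesgue_on \<Omega>)"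
proof -
  obtain \<D> where \<D>: "countable \<D>" "\<D> \<subseteq> Pow \<Omega>" "\<And>X. X \<in> \<D> \<Longrightarrow> \<exists>a b. X = cbox a b" "\<Union>\<D> = \<Omega>"
    using open_countable_Union_open_cbox[OF open_\<Omega>] by blast
  show ?thesis
  proof (rule measurable_piecewise_restrict[OF \<D>(1)])
    fix X assume X: "X \<in> \<D>"
    then have sub: "X \<subseteq> \<Omega>" using \<D>(2) by blast
    have "compact X" using \<D>(3)[OF X] compact_cbox by blast
    then have "integrable (lebesgue_on X) u" "X \<in> sets lebesgue"
      using assms sub by (auto simp: locally_integrable_def lmeasurable_compact fmeasurableD)
    then show "u \<in> borel_measurable (restrict_space (lebesgue_on \<Omega>) X)"
      "X \<inter> space (lebesgue_on \<Omega>) \<in> sets (lebesgue_on \<Omega>)"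
      using sub sets_\<Omega> by (auto simp: restrict_restrict_space Int_absorb1 sets_restrict_space_iff)
  qed (use \<D>(4) in auto)
qed

lemma test_function_L2:
  assumes "test_function \<Omega> \<phi>"
  shows "\<phi> \<in> L2 (lebesgue_on \<Omega>)"
proof -
  obtain B where B: "\<And>x. \<bar>\<phi> x\<bar> \<le> B" using test_function_bounded[OF assms] by blast
  have "(\<lambda>x. 1) \<in> L2 (lebesgue_on \<Omega>)"
    using finite_measure.integrable_const[OF finite_measure_\<Omega>] by (simp add: L2_def)
  from L2_bounded_mult[OF this test_function_measurable[OF assms] B] show ?thesis by simp
qed

lemma has_weak_deriv_L2_iff:
  assumes "u \<in> L2 (lebesgue_on \<Omega>)" "g \<in> L2 (lebesgue_on \<Omega>)"
  shows "has_weak_deriv \<Omega> \<alpha> u g \<longleftrightarrow> (\<forall>\<phi>. test_function \<Omega> \<phi> \<longrightarrow>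
        (LINT x|lebesgue_on \<Omega>. u x * mpartial \<alpha> \<phi> x)
          = (-1) ^ deg \<alpha> * (LINT x|lebesgue_on \<Omega>. g x * \<phi> x))"
  using assms by (simp add: has_weak_deriv_def L2_locally_integrable)

lemma has_weak_deriv_measurable:
  assumes "has_weak_deriv \<Omega> \<alpha> u g"
  shows "u \<in> borel_measurable (lebesgue_on \<Omega>)" "g \<in> borel_measurable (lebesgue_on \<Omega>)"
  using assms locally_integrable_measurable by (auto simp: has_weak_deriv_def)

lemma has_weak_deriv_unique:
  assumes g: "has_weak_deriv \<Omega> \<alpha> u g" and h: "has_weak_deriv \<Omega> \<alpha> v h"
    and uv: "AE x in lebesgue_on \<Omega>. u x = v x"
  shows "AE x in lebesgue_on \<Omega>. g x = h x"
proof -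
  have lg: "locally_integrable \<Omega> g" and lh: "locally_integrable \<Omega> h"
    using g h by (auto simp: has_weak_deriv_def)
  have "AE x in lebesgue_on \<Omega>. g x - h x = 0"
  proof (rule AE_zero_if_test_integrals_zero[OF open_\<Omega>])
    show "locally_integrable \<Omega> (\<lambda>x. g x - h x)"
      using lg lh by (auto simp: locally_integrable_def)
    fix \<phi> assume \<phi>: "test_function \<Omega> \<phi>"
    have "(LINT x|lebesgue_on \<Omega>. u x * mpartial \<alpha> \<phi> x) = (LINT x|lebesgue_on \<Omega>. v x * mpartial \<alpha> \<phi> x)"
    proof (rule integral_cong_AE)
      show "AE x in lebesgue_on \<Omega>. u x * mpartial \<alpha> \<phi> x = v x * mpartial \<alpha> \<phi> x"
        using uv by eventually_elim simp
    qed (intro borel_measurable_times has_weak_deriv_measurable(1)[OF g] has_weak_deriv_measurable(1)[OF h]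
        test_function_measurable[OF test_function_mpartial[OF \<phi>]])+
    then have "(LINT x|lebesgue_on \<Omega>. g x * \<phi> x) = (LINT x|lebesgue_on \<Omega>. h x * \<phi> x)"
      using g h \<phi> by (simp add: has_weak_deriv_def)
    then show "(LINT x|lebesgue_on \<Omega>. (g x - h x) * \<phi> x) = 0"
      using locally_integrable_test_mult[OF open_\<Omega> lg \<phi>] locally_integrable_test_mult[OF open_\<Omega> lh \<phi>]
      by (simp add: left_diff_distrib)
  qed
  then show ?thesis by eventually_elim simp
qed

lemma Hm_imp_L2: "u \<in> Hm m \<Omega> \<Longrightarrow> u \<in> L2 (lebesgue_on \<Omega>)"
  by (simp add: Hm_def)

lemma Hm_mono: "u \<in> Hm m \<Omega> \<Longrightarrow> k \<le> m \<Longrightarrow> u \<in> Hm k \<Omega>"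
  by (auto simp: Hm_def)

lemma HmI:
  assumes "u \<in> L2 (lebesgue_on \<Omega>)"
    and "\<And>\<alpha>. deg \<alpha> \<le> m \<Longrightarrow> g \<alpha> \<in> L2 (lebesgue_on \<Omega>)" "\<And>\<alpha>. deg \<alpha> \<le> m \<Longrightarrow> has_weak_deriv \<Omega> \<alpha> u (g \<alpha>)"
  shows "u \<in> Hm m \<Omega>"
  using assms unfolding Hm_def by blast

text \<open>The chosen weak derivative is only known to be locally integrable; it is square
  integrable because it agrees almost everywhere with a square-integrable weak derivative.\<close>

lemma weak_deriv_works:
  assumes "u \<in> Hm m \<Omega>" "deg \<alpha> \<le> m"
  shows "has_weak_deriv \<Omega> \<alpha> u (weak_deriv \<Omega> \<alpha> u)"
    and "weak_deriv \<Omega> \<alpha> u \<in> L2 (lebesgue_on \<Omega>)"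
proof -
  obtain g where g: "g \<in> L2 (lebesgue_on \<Omega>)" "has_weak_deriv \<Omega> \<alpha> u g"
    using assms by (auto simp: Hm_def)
  show *: "has_weak_deriv \<Omega> \<alpha> u (weak_deriv \<Omega> \<alpha> u)"
    unfolding weak_deriv_def using someI[of "has_weak_deriv \<Omega> \<alpha> u", OF g(2)] .
  show "weak_deriv \<Omega> \<alpha> u \<in> L2 (lebesgue_on \<Omega>)"
    using g(1) has_weak_deriv_measurable(2)[OF *]
    by (rule L2_cong_AE) (rule has_weak_deriv_unique[OF * g(2)], simp)
qed

lemma weak_deriv_AE_eq:
  assumes "has_weak_deriv \<Omega> \<alpha> v g" "AE x in lebesgue_on \<Omega>. u x = v x" "u \<in> Hm m \<Omega>" "deg \<alpha> \<le> m"
  shows "AE x in lebesgue_on \<Omega>. weak_deriv \<Omega> \<alpha> u x = g x"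
  using has_weak_deriv_unique[OF weak_deriv_works(1)[OF assms(3,4)] assms(1,2)] .

lemma has_weak_deriv_0:
  assumes "u \<in> L2 (lebesgue_on \<Omega>)"
  shows "has_weak_deriv \<Omega> (\<lambda>_. 0) u u"
  using assms by (simp add: has_weak_deriv_L2_iff mpartial_0 deg_0)

lemma weak_deriv_0:
  assumes "u \<in> Hm m \<Omega>"
  shows "AE x in lebesgue_on \<Omega>. weak_deriv \<Omega> (\<lambda>_. 0) u x = u x"
  by (rule weak_deriv_AE_eq[OF has_weak_deriv_0 _ assms]) (auto simp: Hm_imp_L2[OF assms] deg_0)

lemma has_weak_deriv_lincomb:
  assumes L2: "u \<in> L2 (lebesgue_on \<Omega>)" "g \<in> L2 (lebesgue_on \<Omega>)" "v \<in> L2 (lebesgue_on \<Omega>)" "h \<in> L2 (lebesgue_on \<Omega>)"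
    and "has_weak_deriv \<Omega> \<alpha> u g" "has_weak_deriv \<Omega> \<alpha> v h"
  shows "has_weak_deriv \<Omega> \<alpha> (\<lambda>x. a * u x + b * v x) (\<lambda>x. a * g x + b * h x)"
proof -
  have "(LINT x|lebesgue_on \<Omega>. (a * f1 x + b * f2 x) * \<phi> x)
      = a * (LINT x|lebesgue_on \<Omega>. f1 x * \<phi> x) + b * (LINT x|lebesgue_on \<Omega>. f2 x * \<phi> x)"
    if "f1 \<in> L2 (lebesgue_on \<Omega>)" "f2 \<in> L2 (lebesgue_on \<Omega>)" "test_function \<Omega> \<phi>" for f1 f2 \<phi>
    using L2_mult_integrable[OF that(1) test_function_L2[OF that(3)]]
      L2_mult_integrable[OF that(2) test_function_L2[OF that(3)]]
    by (simp add: distrib_right mult.assoc)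
  note split = this
  show ?thesis
    unfolding has_weak_deriv_L2_iff[OF L2_add[OF L2_cmult[OF L2(1)] L2_cmult[OF L2(3)]]
        L2_add[OF L2_cmult[OF L2(2)] L2_cmult[OF L2(4)]]]
  proof (intro allI impI)
    fix \<phi> assume \<phi>: "test_function \<Omega> \<phi>"
    show "(LINT x|lebesgue_on \<Omega>. (a * u x + b * v x) * mpartial \<alpha> \<phi> x)
        = (-1) ^ deg \<alpha> * (LINT x|lebesgue_on \<Omega>. (a * g x + b * h x) * \<phi> x)"
      unfolding split[OF L2(1,3) test_function_mpartial[OF \<phi>]] split[OF L2(2,4) \<phi>]
      using assms(5,6) \<phi> by (simp add: has_weak_deriv_def distrib_left)
  qed
qed

lemma Hm_lincomb:
  assumes "u \<in> Hm m \<Omega>" "v \<in> Hm m \<Omega>"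
  shows "(\<lambda>x. a * u x + b * v x) \<in> Hm m \<Omega>"
proof (rule HmI[where g = "\<lambda>\<alpha> x. a * weak_deriv \<Omega> \<alpha> u x + b * weak_deriv \<Omega> \<alpha> v x"])
  fix \<alpha> assume \<alpha>: "deg \<alpha> \<le> m"
  note works = weak_deriv_works[OF assms(1) \<alpha>] weak_deriv_works[OF assms(2) \<alpha>]
  show "(\<lambda>x. a * weak_deriv \<Omega> \<alpha> u x + b * weak_deriv \<Omega> \<alpha> v x) \<in> L2 (lebesgue_on \<Omega>)"
    by (intro L2_add L2_cmult works)
  show "has_weak_deriv \<Omega> \<alpha> (\<lambda>x. a * u x + b * v x) (\<lambda>x. a * weak_deriv \<Omega> \<alpha> u x + b * weak_deriv \<Omega> \<alpha> v x)"
    by (intro has_weak_deriv_lincomb Hm_imp_L2[OF assms(1)] Hm_imp_L2[OF assms(2)] works)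
qed (intro L2_add L2_cmult Hm_imp_L2[OF assms(1)] Hm_imp_L2[OF assms(2)])

lemma weak_deriv_lincomb:
  assumes "u \<in> Hm m \<Omega>" "v \<in> Hm m \<Omega>" "deg \<alpha> \<le> m"
  shows "AE x in lebesgue_on \<Omega>. weak_deriv \<Omega> \<alpha> (\<lambda>x. a * u x + b * v x) x
      = a * weak_deriv \<Omega> \<alpha> u x + b * weak_deriv \<Omega> \<alpha> v x"
proof -
  have "has_weak_deriv \<Omega> \<alpha> (\<lambda>x. a * u x + b * v x) (\<lambda>x. a * weak_deriv \<Omega> \<alpha> u x + b * weak_deriv \<Omega> \<alpha> v x)"
    by (intro has_weak_deriv_lincomb Hm_imp_L2[OF assms(1)] Hm_imp_L2[OF assms(2)]
        weak_deriv_works[OF assms(1,3)] weak_deriv_works[OF assms(2,3)])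
  from weak_deriv_AE_eq[OF this _ Hm_lincomb[OF assms(1,2)] assms(3)] show ?thesis by simp
qed

lemma Hm_add: "u \<in> Hm m \<Omega> \<Longrightarrow> v \<in> Hm m \<Omega> \<Longrightarrow> (\<lambda>x. u x + v x) \<in> Hm m \<Omega>"
  and Hm_diff: "u \<in> Hm m \<Omega> \<Longrightarrow> v \<in> Hm m \<Omega> \<Longrightarrow> (\<lambda>x. u x - v x) \<in> Hm m \<Omega>"
  and Hm_cmult: "u \<in> Hm m \<Omega> \<Longrightarrow> (\<lambda>x. a * u x) \<in> Hm m \<Omega>"
  using Hm_lincomb[of u m v 1 1] Hm_lincomb[of u m v 1 "-1"] Hm_lincomb[of u m u a 0] by auto

lemma Hm_norm_L2_set: "Hm_norm m \<Omega> u = L2_set (\<lambda>\<alpha>. L2_norm (lebesgue_on \<Omega>) (weak_deriv \<Omega> \<alpha> u)) {\<alpha>. deg \<alpha> \<le> m}"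
  by (simp add: Hm_norm_def L2_set_def)

lemma Hm_norm_nonneg: "0 \<le> Hm_norm m \<Omega> u"
  by (simp add: Hm_norm_L2_set)

lemma Hm_norm_sq: "(Hm_norm m \<Omega> u)\<^sup>2 = (\<Sum>\<alpha> | deg \<alpha> \<le> m. (L2_norm (lebesgue_on \<Omega>) (weak_deriv \<Omega> \<alpha> u))\<^sup>2)"
  by (simp add: Hm_norm_def sum_nonneg)

lemma L2_norm_weak_deriv_le: "deg \<alpha> \<le> m \<Longrightarrow> L2_norm (lebesgue_on \<Omega>) (weak_deriv \<Omega> \<alpha> u) \<le> Hm_norm m \<Omega> u"
  unfolding Hm_norm_L2_set
  by (rule member_le_L2_set[where f = "\<lambda>\<alpha>. L2_norm (lebesgue_on \<Omega>) (weak_deriv \<Omega> \<alpha> u)"]) (auto simp: finite_deg_le)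

lemma Hm_norm_le_sum: "Hm_norm m \<Omega> u \<le> (\<Sum>\<alpha> | deg \<alpha> \<le> m. L2_norm (lebesgue_on \<Omega>) (weak_deriv \<Omega> \<alpha> u))"
  unfolding Hm_norm_L2_set by (rule L2_set_le_sum) (simp add: L2_norm_nonneg)

lemma Hm_norm_cong_AE:
  assumes u: "u \<in> Hm m \<Omega>" and v: "v \<in> Hm m \<Omega>" and uv: "AE x in lebesgue_on \<Omega>. u x = v x"
  shows "Hm_norm m \<Omega> u = Hm_norm m \<Omega> v"
proof -
  have "L2_norm (lebesgue_on \<Omega>) (weak_deriv \<Omega> \<alpha> u) = L2_norm (lebesgue_on \<Omega>) (weak_deriv \<Omega> \<alpha> v)"
    if "deg \<alpha> \<le> m" for \<alpha>
    using weak_deriv_works(2)[OF u that] weak_deriv_works(2)[OF v that]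
    by (intro L2_norm_cong_AE L2_measurable weak_deriv_AE_eq[OF weak_deriv_works(1)[OF v that] uv u that])
  then show ?thesis by (simp add: Hm_norm_def)
qed

lemma L2_norm_weak_deriv_lincomb:
  assumes "u \<in> Hm m \<Omega>" "v \<in> Hm m \<Omega>" "deg \<alpha> \<le> m"
  shows "L2_norm (lebesgue_on \<Omega>) (weak_deriv \<Omega> \<alpha> (\<lambda>x. a * u x + b * v x))
      = L2_norm (lebesgue_on \<Omega>) (\<lambda>x. a * weak_deriv \<Omega> \<alpha> u x + b * weak_deriv \<Omega> \<alpha> v x)"
  by (intro L2_norm_cong_AE L2_measurable weak_deriv_lincomb[OF assms] L2_add L2_cmult
      weak_deriv_works(2)[OF assms(1,3)] weak_deriv_works(2)[OF assms(2,3)]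
      weak_deriv_works(2)[OF Hm_lincomb[OF assms(1,2)] assms(3)])

lemma Hm_norm_lincomb_le:
  assumes u: "u \<in> Hm m \<Omega>" and v: "v \<in> Hm m \<Omega>"
  shows "Hm_norm m \<Omega> (\<lambda>x. a * u x + b * v x) \<le> \<bar>a\<bar> * Hm_norm m \<Omega> u + \<bar>b\<bar> * Hm_norm m \<Omega> v"
proof -
  let ?n = "\<lambda>u \<alpha>. L2_norm (lebesgue_on \<Omega>) (weak_deriv \<Omega> \<alpha> u)"
  have "Hm_norm m \<Omega> (\<lambda>x. a * u x + b * v x) \<le> L2_set (\<lambda>\<alpha>. \<bar>a\<bar> * ?n u \<alpha> + \<bar>b\<bar> * ?n v \<alpha>) {\<alpha>. deg \<alpha> \<le> m}"
    unfolding Hm_norm_L2_set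
  proof (rule L2_set_mono)
    fix \<alpha> assume "\<alpha> \<in> {\<alpha>. deg \<alpha> \<le> m}"
    then have \<alpha>: "deg \<alpha> \<le> m" by simp
    show "?n (\<lambda>x. a * u x + b * v x) \<alpha> \<le> \<bar>a\<bar> * ?n u \<alpha> + \<bar>b\<bar> * ?n v \<alpha>"
      unfolding L2_norm_weak_deriv_lincomb[OF u v \<alpha>] L2_norm_cmult[symmetric]
      by (intro L2_norm_triangle L2_cmult weak_deriv_works(2)[OF u \<alpha>] weak_deriv_works(2)[OF v \<alpha>])
  qed (simp add: L2_norm_nonneg)
  also have "\<dots> \<le> L2_set (\<lambda>\<alpha>. \<bar>a\<bar> * ?n u \<alpha>) {\<alpha>. deg \<alpha> \<le> m} + L2_set (\<lambda>\<alpha>. \<bar>b\<bar> * ?n v \<alpha>) {\<alpha>. deg \<alpha> \<le> m}"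
    by (rule L2_set_triangle_ineq)
  also have "\<dots> = \<bar>a\<bar> * Hm_norm m \<Omega> u + \<bar>b\<bar> * Hm_norm m \<Omega> v"
    by (simp add: Hm_norm_L2_set L2_set_right_distrib)
  finally show ?thesis .
qed

lemma Hm_norm_diff_triangle:
  assumes "u \<in> Hm m \<Omega>" "v \<in> Hm m \<Omega>" "w \<in> Hm m \<Omega>"
  shows "Hm_norm m \<Omega> (\<lambda>x. u x - w x) \<le> Hm_norm m \<Omega> (\<lambda>x. u x - v x) + Hm_norm m \<Omega> (\<lambda>x. v x - w x)"
  using Hm_norm_lincomb_le[OF Hm_diff[OF assms(1,2)] Hm_diff[OF assms(2,3)], of 1 1] by simp

lemma Hm_norm_diff_tendsto_iff:
  assumes u: "\<And>n. u n \<in> Hm m \<Omega>" and v: "v \<in> Hm m \<Omega>"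
  shows "(\<lambda>n. Hm_norm m \<Omega> (\<lambda>x. u n x - v x)) \<longlonglongrightarrow> 0 \<longleftrightarrow>
    (\<forall>\<alpha>. deg \<alpha> \<le> m \<longrightarrow> (\<lambda>n. L2_norm (lebesgue_on \<Omega>) (\<lambda>x. weak_deriv \<Omega> \<alpha> (u n) x - weak_deriv \<Omega> \<alpha> v x)) \<longlonglongrightarrow> 0)"
    (is "?lhs \<longleftrightarrow> ?rhs")
proof -
  have eq: "L2_norm (lebesgue_on \<Omega>) (weak_deriv \<Omega> \<alpha> (\<lambda>x. u n x - v x))
      = L2_norm (lebesgue_on \<Omega>) (\<lambda>x. weak_deriv \<Omega> \<alpha> (u n) x - weak_deriv \<Omega> \<alpha> v x)" if "deg \<alpha> \<le> m" for \<alpha> n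
    using L2_norm_weak_deriv_lincomb[OF u v that, of 1 n "-1"] by simp
  show ?thesis
  proof
    assume l: ?lhs
    show ?rhs
    proof (intro allI impI)
      fix \<alpha> assume \<alpha>: "deg \<alpha> \<le> m"
      show "(\<lambda>n. L2_norm (lebesgue_on \<Omega>) (\<lambda>x. weak_deriv \<Omega> \<alpha> (u n) x - weak_deriv \<Omega> \<alpha> v x)) \<longlonglongrightarrow> 0"
        unfolding eq[OF \<alpha>, symmetric]
        by (rule tendsto_sandwich[OF _ _ tendsto_const l])
          (auto intro!: always_eventually L2_norm_nonneg L2_norm_weak_deriv_le \<alpha>)
    qed
  next
    assume r: ?rhs
    have "(\<lambda>n. \<Sum>\<alpha> | deg \<alpha> \<le> m. L2_norm (lebesgue_on \<Omega>) (weak_deriv \<Omega> \<alpha> (\<lambda>x. u n x - v x)))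
        \<longlonglongrightarrow> (\<Sum>\<alpha> | deg \<alpha> \<le> m. 0)"
      by (intro tendsto_sum) (use r eq in simp)
    then have "(\<lambda>n. \<Sum>\<alpha> | deg \<alpha> \<le> m. L2_norm (lebesgue_on \<Omega>) (weak_deriv \<Omega> \<alpha> (\<lambda>x. u n x - v x))) \<longlonglongrightarrow> 0"
      by simp
    then show ?lhs
      by (rule tendsto_sandwich[OF _ _ tendsto_const, rotated 2])
        (auto intro!: always_eventually Hm_norm_nonneg Hm_norm_le_sum)
  qed
qed

lemma Hm_norm_diff_tendsto_mono:
  assumes "\<And>n. u n \<in> Hm m \<Omega>" "v \<in> Hm m \<Omega>" "k \<le> m" "(\<lambda>n. Hm_norm m \<Omega> (\<lambda>x. u n x - v x)) \<longlonglongrightarrow> 0"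
  shows "(\<lambda>n. Hm_norm k \<Omega> (\<lambda>x. u n x - v x)) \<longlonglongrightarrow> 0"
  using assms(3,4)
  unfolding Hm_norm_diff_tendsto_iff[OF assms(1,2)]
    Hm_norm_diff_tendsto_iff[OF Hm_mono[OF assms(1,3)] Hm_mono[OF assms(2,3)]] by auto

text \<open>On each \<open>L\<^sub>2\<close> component this is the parallelogram law.\<close>

lemma Hm_norm_midpoint:
  assumes u: "u \<in> Hm m \<Omega>" and v: "v \<in> Hm m \<Omega>"
  shows "(Hm_norm m \<Omega> (\<lambda>x. 1/2 * u x + 1/2 * v x))\<^sup>2
    = ((Hm_norm m \<Omega> u)\<^sup>2 + (Hm_norm m \<Omega> v)\<^sup>2) / 2 - (Hm_norm m \<Omega> (\<lambda>x. u x - v x))\<^sup>2 / 4"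
proof -
  let ?n = "\<lambda>u \<alpha>. L2_norm (lebesgue_on \<Omega>) (weak_deriv \<Omega> \<alpha> u)"
  have "(?n (\<lambda>x. 1/2 * u x + 1/2 * v x) \<alpha>)\<^sup>2 = ((?n u \<alpha>)\<^sup>2 + (?n v \<alpha>)\<^sup>2) / 2 - (?n (\<lambda>x. u x - v x) \<alpha>)\<^sup>2 / 4"
    if \<alpha>: "deg \<alpha> \<le> m" for \<alpha>
    using L2_norm_weak_deriv_lincomb[OF u v \<alpha>, of "1/2" "1/2"] L2_norm_weak_deriv_lincomb[OF u v \<alpha>, of 1 "-1"]
      L2_norm_midpoint[OF weak_deriv_works(2)[OF u \<alpha>] weak_deriv_works(2)[OF v \<alpha>]] by simp
  then show ?thesis
    by (simp add: Hm_norm_sq sum_subtractf sum.distrib flip: sum_divide_distrib)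
qed

text \<open>Completeness: the derivatives converge separately in \<open>L\<^sub>2\<close>, and the defining identity of the weak
  derivative survives the limit because test functions are square integrable.\<close>

lemma Hm_complete:
  assumes u: "\<And>n. u n \<in> Hm m \<Omega>"
    and Cauchy: "\<And>e. 0 < e \<Longrightarrow> \<exists>N. \<forall>k\<ge>N. \<forall>n\<ge>N. Hm_norm m \<Omega> (\<lambda>x. u k x - u n x) < e"
  obtains v where "v \<in> Hm m \<Omega>" "(\<lambda>n. Hm_norm m \<Omega> (\<lambda>x. u n x - v x)) \<longlonglongrightarrow> 0"
proof -
  let ?M = "lebesgue_on \<Omega>"
  let ?D = "\<lambda>\<alpha> n. weak_deriv \<Omega> \<alpha> (u n)"
  let ?lim = "\<lambda>\<alpha> g. g \<in> L2 ?M \<and> (\<lambda>n. L2_norm ?M (\<lambda>x. ?D \<alpha> n x - g x)) \<longlonglongrightarrow> 0"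
  have lim: "\<exists>g. ?lim \<alpha> g" if \<alpha>: "deg \<alpha> \<le> m" for \<alpha>
  proof -
    have "\<exists>N. \<forall>k\<ge>N. \<forall>n\<ge>N. L2_norm ?M (\<lambda>x. ?D \<alpha> k x - ?D \<alpha> n x) < e" if "0 < e" for e
    proof -
      have "L2_norm ?M (\<lambda>x. ?D \<alpha> k x - ?D \<alpha> n x) \<le> Hm_norm m \<Omega> (\<lambda>x. u k x - u n x)" for k n
        using L2_norm_weak_deriv_lincomb[OF u u \<alpha>, of 1 k "-1" n]
          L2_norm_weak_deriv_le[OF \<alpha>, of "\<lambda>x. u k x - u n x"] by simp
      then show ?thesis using Cauchy[OF that] by (meson le_less_trans)
    qed
    then show ?thesis
      by (rule L2_complete[OF finite_measure_\<Omega>, of "?D \<alpha>", OF weak_deriv_works(2)[OF u \<alpha>]]) blast+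
  qed
  define g where "g \<alpha> = (SOME h. ?lim \<alpha> h)" for \<alpha>
  have g: "g \<alpha> \<in> L2 ?M" "(\<lambda>n. L2_norm ?M (\<lambda>x. ?D \<alpha> n x - g \<alpha> x)) \<longlonglongrightarrow> 0" if "deg \<alpha> \<le> m" for \<alpha>
    using someI_ex[OF lim[OF that]] unfolding g_def by blast+
  define v where "v = g (\<lambda>_. 0)"
  have v: "v \<in> L2 ?M" unfolding v_def by (rule g) (simp add: deg_0)
  have D0: "?D (\<lambda>_. 0) n \<in> L2 ?M" for n
    by (rule weak_deriv_works(2)[OF u]) (simp add: deg_0)
  have "L2_norm ?M (\<lambda>x. u n x - v x) = L2_norm ?M (\<lambda>x. ?D (\<lambda>_. 0) n x - v x)" for n
  proof (rule L2_norm_cong_AE)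
    show "AE x in ?M. u n x - v x = ?D (\<lambda>_. 0) n x - v x"
      using weak_deriv_0[OF u[of n]] by eventually_elim simp
  qed (intro L2_measurable L2_diff v D0 Hm_imp_L2[OF u])+
  then have lim0: "(\<lambda>n. L2_norm ?M (\<lambda>x. u n x - v x)) \<longlonglongrightarrow> 0"
    using g(2)[of "\<lambda>_. 0"] by (simp add: v_def deg_0)
  have der: "has_weak_deriv \<Omega> \<alpha> v (g \<alpha>)" if \<alpha>: "deg \<alpha> \<le> m" for \<alpha>
    unfolding has_weak_deriv_L2_iff[OF v g(1)[OF \<alpha>]]
  proof (intro allI impI)
    fix \<phi> assume \<phi>: "test_function \<Omega> \<phi>"
    have lim1: "(\<lambda>n. LINT x|?M. u n x * mpartial \<alpha> \<phi> x) \<longlonglongrightarrow> (LINT x|?M. v x * mpartial \<alpha> \<phi> x)"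
      by (intro L2_integral_tendsto lim0 v Hm_imp_L2[OF u] test_function_L2 test_function_mpartial \<phi>)
    have lim2: "(\<lambda>n. (-1) ^ deg \<alpha> * (LINT x|?M. ?D \<alpha> n x * \<phi> x)) \<longlonglongrightarrow> (-1) ^ deg \<alpha> * (LINT x|?M. g \<alpha> x * \<phi> x)"
      by (intro tendsto_mult tendsto_const L2_integral_tendsto g \<alpha> weak_deriv_works(2)[OF u \<alpha>] test_function_L2 \<phi>)
    have "(LINT x|?M. u n x * mpartial \<alpha> \<phi> x) = (-1) ^ deg \<alpha> * (LINT x|?M. ?D \<alpha> n x * \<phi> x)" for n
      using weak_deriv_works(1)[OF u \<alpha>] \<phi> by (simp add: has_weak_deriv_def)
    then show "(LINT x|?M. v x * mpartial \<alpha> \<phi> x) = (-1) ^ deg \<alpha> * (LINT x|?M. g \<alpha> x * \<phi> x)"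
      using LIMSEQ_unique[OF lim1] lim2 by simp
  qed
  have v_Hm: "v \<in> Hm m \<Omega>" using v g(1) der by (rule HmI)
  have "L2_norm ?M (\<lambda>x. ?D \<alpha> n x - weak_deriv \<Omega> \<alpha> v x) = L2_norm ?M (\<lambda>x. ?D \<alpha> n x - g \<alpha> x)"
    if \<alpha>: "deg \<alpha> \<le> m" for \<alpha> n
  proof (rule L2_norm_cong_AE)
    show "AE x in ?M. ?D \<alpha> n x - weak_deriv \<Omega> \<alpha> v x = ?D \<alpha> n x - g \<alpha> x"
      using weak_deriv_AE_eq[OF der[OF \<alpha>] AE_I2[OF refl] v_Hm \<alpha>] by eventually_elim simp
  qed (intro L2_measurable L2_diff g \<alpha> weak_deriv_works(2)[OF u \<alpha>] weak_deriv_works(2)[OF v_Hm \<alpha>])+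
  then have "(\<lambda>n. Hm_norm m \<Omega> (\<lambda>x. u n x - v x)) \<longlonglongrightarrow> 0"
    using g(2) by (simp add: Hm_norm_diff_tendsto_iff[OF u v_Hm])
  with v_Hm that show thesis by blast
qed

lemma Hm_norm_diff_eq_0:
  assumes "u \<in> Hm m \<Omega>" "v \<in> Hm m \<Omega>" "Hm_norm m \<Omega> (\<lambda>x. u x - v x) = 0"
  shows "AE x in lebesgue_on \<Omega>. u x = v x"
proof -
  have d: "(\<lambda>x. u x - v x) \<in> Hm m \<Omega>" using assms by (intro Hm_diff)
  have "L2_norm (lebesgue_on \<Omega>) (weak_deriv \<Omega> (\<lambda>_. 0) (\<lambda>x. u x - v x)) = 0"
    using L2_norm_weak_deriv_le[of "\<lambda>_. 0" m "\<lambda>x. u x - v x"] assms(3)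
      L2_norm_nonneg[of "lebesgue_on \<Omega>" "weak_deriv \<Omega> (\<lambda>_. 0) (\<lambda>x. u x - v x)"] by (simp add: deg_0)
  then have "AE x in lebesgue_on \<Omega>. weak_deriv \<Omega> (\<lambda>_. 0) (\<lambda>x. u x - v x) x = 0"
    by (intro L2_norm_eq_0_imp_AE weak_deriv_works(2)[OF d]) (auto simp: deg_0)
  with weak_deriv_0[OF d] show ?thesis by eventually_elim simp
qed

text \<open>Shifting \<open>\<beta>\<close> onto the test function first, then the first-order derivative, produces the test
  function \<open>mpartial (\<beta> + mi1 i) \<phi>\<close>.\<close>

lemma has_weak_deriv_weak_deriv:
  assumes g: "has_weak_deriv \<Omega> (mi1 i) u g" and h: "has_weak_deriv \<Omega> (\<lambda>k. \<beta> k + mi1 i k) u h"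
  shows "has_weak_deriv \<Omega> \<beta> g h"
  unfolding has_weak_deriv_def
proof (intro conjI allI impI)
  fix \<phi> assume \<phi>: "test_function \<Omega> \<phi>"
  then have sm: "smooth \<phi>" by (simp add: test_function_def)
  have "- (LINT x|lebesgue_on \<Omega>. g x * mpartial \<beta> \<phi> x) = (LINT x|lebesgue_on \<Omega>. u x * mpartial (mi1 i) (mpartial \<beta> \<phi>) x)"
    using g test_function_mpartial[OF \<phi>, of \<beta>] by (simp add: has_weak_deriv_def deg_mi1)
  also have "\<dots> = - ((-1) ^ deg \<beta> * (LINT x|lebesgue_on \<Omega>. h x * \<phi> x))"
    using h \<phi> by (simp add: has_weak_deriv_def mpartial_mi1 partial_mpartial[OF sm] deg_add deg_mi1)
  finally show "(LINT x|lebesgue_on \<Omega>. g x * mpartial \<beta> \<phi> x) = (-1) ^ deg \<beta> * (LINT x|lebesgue_on \<Omega>. h x * \<phi> x)"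
    by simp
qed (use g h in \<open>auto simp: has_weak_deriv_def\<close>)

lemma weak_deriv_mi1_Hm:
  assumes u: "u \<in> Hm (Suc m) \<Omega>"
  shows "weak_deriv \<Omega> (mi1 i) u \<in> Hm m \<Omega>"
    and "deg \<beta> \<le> m \<Longrightarrow> AE x in lebesgue_on \<Omega>.
      weak_deriv \<Omega> \<beta> (weak_deriv \<Omega> (mi1 i) u) x = weak_deriv \<Omega> (\<lambda>k. \<beta> k + mi1 i k) u x"
proof -
  have der: "has_weak_deriv \<Omega> \<beta> (weak_deriv \<Omega> (mi1 i) u) (weak_deriv \<Omega> (\<lambda>k. \<beta> k + mi1 i k) u)"
    if "deg \<beta> \<le> m" for \<beta>
    by (rule has_weak_deriv_weak_deriv; rule weak_deriv_works(1)[OF u])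
      (use that in \<open>simp_all add: deg_add deg_mi1\<close>)
  show *: "weak_deriv \<Omega> (mi1 i) u \<in> Hm m \<Omega>"
    by (rule HmI[where g = "\<lambda>\<beta>. weak_deriv \<Omega> (\<lambda>k. \<beta> k + mi1 i k) u"])
      (auto intro!: der weak_deriv_works(2)[OF u] simp: deg_add deg_mi1)
  show "AE x in lebesgue_on \<Omega>.
      weak_deriv \<Omega> \<beta> (weak_deriv \<Omega> (mi1 i) u) x = weak_deriv \<Omega> (\<lambda>k. \<beta> k + mi1 i k) u x" if "deg \<beta> \<le> m"
    using that by (intro weak_deriv_AE_eq[OF der _ *]) auto
qed

lemma Hm_norm_weak_deriv_tendsto:
  assumes u: "\<And>n. u n \<in> Hm (Suc m) \<Omega>" and v: "v \<in> Hm (Suc m) \<Omega>"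
    and lim: "(\<lambda>n. Hm_norm (Suc m) \<Omega> (\<lambda>x. u n x - v x)) \<longlonglongrightarrow> 0"
  shows "(\<lambda>n. Hm_norm m \<Omega> (\<lambda>x. weak_deriv \<Omega> (mi1 i) (u n) x - weak_deriv \<Omega> (mi1 i) v x)) \<longlonglongrightarrow> 0"
proof -
  let ?M = "lebesgue_on \<Omega>"
  have "L2_norm ?M (\<lambda>x. weak_deriv \<Omega> \<beta> (weak_deriv \<Omega> (mi1 i) (u n)) x - weak_deriv \<Omega> \<beta> (weak_deriv \<Omega> (mi1 i) v) x)
      = L2_norm ?M (\<lambda>x. weak_deriv \<Omega> (\<lambda>k. \<beta> k + mi1 i k) (u n) x - weak_deriv \<Omega> (\<lambda>k. \<beta> k + mi1 i k) v x)"
    if \<beta>: "deg \<beta> \<le> m" for \<beta> n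
  proof (rule L2_norm_cong_AE)
    show "AE x in ?M. weak_deriv \<Omega> \<beta> (weak_deriv \<Omega> (mi1 i) (u n)) x - weak_deriv \<Omega> \<beta> (weak_deriv \<Omega> (mi1 i) v) x
       = weak_deriv \<Omega> (\<lambda>k. \<beta> k + mi1 i k) (u n) x - weak_deriv \<Omega> (\<lambda>k. \<beta> k + mi1 i k) v x"
      using weak_deriv_mi1_Hm(2)[OF u[of n] \<beta>, of i] weak_deriv_mi1_Hm(2)[OF v \<beta>, of i]
      by eventually_elim simp
    have "deg (\<lambda>k. \<beta> k + mi1 i k) \<le> Suc m" using \<beta> by (simp add: deg_add deg_mi1)
    then show "(\<lambda>x. weak_deriv \<Omega> (\<lambda>k. \<beta> k + mi1 i k) (u n) x - weak_deriv \<Omega> (\<lambda>k. \<beta> k + mi1 i k) v x) \<in> borel_measurable ?M"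
      by (intro L2_measurable L2_diff weak_deriv_works(2)[OF u] weak_deriv_works(2)[OF v])
  qed (intro L2_measurable L2_diff weak_deriv_works(2)[OF weak_deriv_mi1_Hm(1)[OF u] \<beta>]
        weak_deriv_works(2)[OF weak_deriv_mi1_Hm(1)[OF v] \<beta>])
  moreover have "(\<lambda>n. L2_norm ?M (\<lambda>x. weak_deriv \<Omega> (\<lambda>k. \<beta> k + mi1 i k) (u n) x - weak_deriv \<Omega> (\<lambda>k. \<beta> k + mi1 i k) v x)) \<longlonglongrightarrow> 0"
    if "deg \<beta> \<le> m" for \<beta>
    using lim that unfolding Hm_norm_diff_tendsto_iff[OF u v] by (simp add: deg_add deg_mi1)
  ultimately show ?thesis
    by (simp add: Hm_norm_diff_tendsto_iff[OF weak_deriv_mi1_Hm(1)[OF u] weak_deriv_mi1_Hm(1)[OF v]])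
qed

text \<open>The integral of a difference quotient of \<open>\<psi>\<close> vanishes by translation invariance of
  Lebesgue measure; the mean value theorem dominates the quotients.\<close>

lemma integral_partial_test_function:
  assumes \<psi>: "test_function \<Omega> \<psi>"
  shows "(LINT x|lebesgue_on \<Omega>. partial j \<psi> x) = 0"
proof -
  obtain K where K: "compact K" "K \<subseteq> \<Omega>" "\<And>x. x \<notin> K \<Longrightarrow> \<psi> x = 0" "smooth \<psi>"
    using test_functionE[OF \<psi>] by blast
  have d\<psi>: "test_function \<Omega> (partial j \<psi>)" using \<psi> by (rule test_function_partial)
  obtain K' where K': "K' \<subseteq> \<Omega>" "\<And>x. x \<notin> K' \<Longrightarrow> partial j \<psi> x = 0"
    using test_functionE[OF d\<psi>] by metis
  obtain B where B: "\<And>x. \<bar>partial j \<psi> x\<bar> \<le> B" using test_function_bounded[OF d\<psi>] by blast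
  obtain r where r: "\<And>x. x \<in> K \<Longrightarrow> norm x \<le> r" using compact_imp_bounded[OF K(1)] bounded_iff by metis
  let ?h = "\<lambda>n::nat. inverse (real (Suc n))"
  let ?q = "\<lambda>n x. (\<psi> (x + ?h n *\<^sub>R axis j 1) - \<psi> x) / ?h n"
  have cont: "continuous_on UNIV \<psi>" "continuous_on UNIV (partial j \<psi>)"
    using K(4) smooth_partial smooth_imp_continuous_on by blast+
  note [measurable] = borel_measurable_continuous_onI[OF cont(1)] borel_measurable_continuous_onI[OF cont(2)]
  have int: "integrable lborel \<psi>"
  proof -
    have "integrable lborel (\<lambda>x. indicator K x *\<^sub>R \<psi> x)"
      using K(1) cont(1) continuous_on_subset by (intro borel_integrable_compact) auto
    moreover have "indicator K x *\<^sub>R \<psi> x = \<psi> x" for x using K(3)[of x] by (auto simp: indicator_def)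
    ultimately show ?thesis by (simp only:)
  qed
  have shift: "integrable lborel (\<lambda>x. \<psi> (x + c))" "(LINT x|lborel. \<psi> (x + c)) = (LINT x|lborel. \<psi> x)" for c
    using integrable_distr_eq[of "(+) c" lborel borel \<psi>] integral_distr[of "(+) c" lborel borel \<psi>] int
    by (auto simp: lborel_distr_plus add.commute)
  have q0: "(LINT x|lborel. ?q n x) = 0" for n
    using shift int by simp
  have mvt: "\<exists>t. 0 < t \<and> t < ?h n \<and> ?q n x = partial j \<psi> (x + t *\<^sub>R axis j 1)" for n x
  proof -
    have "\<exists>t. 0 < t \<and> t < ?h n \<and> \<psi> (x + ?h n *\<^sub>R axis j 1) - \<psi> (x + 0 *\<^sub>R axis j 1)
        = (?h n - 0) * partial j \<psi> (x + t *\<^sub>R axis j 1)"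
      by (intro MVT2) (auto intro: DERIV_along_axis smooth_imp_differentiable[OF K(4)])
    then show ?thesis by (auto simp: field_simps)
  qed
  have "(\<lambda>n. LINT x|lborel. ?q n x) \<longlonglongrightarrow> (LINT x|lborel. partial j \<psi> x)"
  proof (rule integral_dominated_convergence[where w = "\<lambda>x. B * indicator (cball 0 (r + 1)) x"])
    have "emeasure lborel (cball (0::real^3) (r + 1)) < \<infinity>"
      by (intro emeasure_lborel_cball_finite)
    then show "integrable lborel (\<lambda>x::real^3. B * indicator (cball 0 (r + 1)) x)"
      by (intro integrable_mult_right integrable_real_indicator) auto
    show "AE x in lborel. (\<lambda>n. ?q n x) \<longlonglongrightarrow> partial j \<psi> x"
    proof (rule AE_I2)
      fix x
      have "((\<lambda>t. \<psi> (x + t *\<^sub>R axis j 1)) has_real_derivative partial j \<psi> (x + 0 *\<^sub>R axis j 1)) (at 0)"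
        by (intro DERIV_along_axis smooth_imp_differentiable K)
      then have "((\<lambda>h. (\<psi> (x + h *\<^sub>R axis j 1) - \<psi> x) / h) \<longlongrightarrow> partial j \<psi> x) (at 0)"
        by (simp add: DERIV_def)
      moreover have "filterlim ?h (at 0) sequentially"
        using LIMSEQ_inverse_real_of_nat by (auto simp: filterlim_at)
      ultimately show "(\<lambda>n. ?q n x) \<longlonglongrightarrow> partial j \<psi> x"
        by (rule filterlim_compose)
    qed
    show "AE x in lborel. norm (?q n x) \<le> B * indicator (cball 0 (r + 1)) x" for n
    proof (rule AE_I2)
      fix x :: "real^3"
      show "norm (?q n x) \<le> B * indicator (cball 0 (r + 1)) x"
      proof (cases "norm x \<le> r + 1")
        case True
        obtain t where "?q n x = partial j \<psi> (x + t *\<^sub>R axis j 1)" using mvt by blast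
        then have "norm (?q n x) \<le> B" using B by (simp only: real_norm_def)
        then show ?thesis using True by simp
      next
        case False
        have "x \<notin> K" using r[of x] False by linarith
        moreover have "x + ?h n *\<^sub>R axis j 1 \<notin> K"
        proof
          assume "x + ?h n *\<^sub>R axis j 1 \<in> K"
          then have "norm (x + ?h n *\<^sub>R axis j 1) \<le> r" by (rule r)
          moreover have "norm x \<le> norm (x + ?h n *\<^sub>R axis j 1) + norm (?h n *\<^sub>R axis j (1::real))"
            using norm_triangle_ineq4[of "x + ?h n *\<^sub>R axis j 1" "?h n *\<^sub>R axis j 1"] by simp
          moreover have "norm (?h n *\<^sub>R axis j (1::real)) \<le> 1"
            by (simp add: field_simps)
          ultimately show False using False by linarith
        qed
        ultimately show ?thesis using K(3) False by simp
      qed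
    qed
  qed simp_all
  then have "(LINT x|lborel. partial j \<psi> x) = 0"
    unfolding q0 by (simp add: LIMSEQ_const_iff)
  then have "(LINT x|lebesgue. partial j \<psi> x) = 0" by (simp add: integral_completion)
  moreover have "partial j \<psi> x = (if x \<in> \<Omega> then partial j \<psi> x else 0)" for x
    using K' by auto
  ultimately have "(LINT x|lebesgue. (if x \<in> \<Omega> then partial j \<psi> x else 0)) = 0" by (simp only:)
  then show ?thesis using Lebesgue_Measure.integral_restrict_UNIV[OF sets_\<Omega>, of "partial j \<psi>"] by simp
qed

lemma smooth_L2:
  assumes "smooth w"
  shows "w \<in> L2 (lebesgue_on \<Omega>)"
proof -
  have meas: "w \<in> borel_measurable (lebesgue_on \<Omega>)"
    using borel_measurable_continuous_onI[OF smooth_imp_continuous_on[OF assms]]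
    by (intro measurable_restrict_space1 measurable_completion) simp
  have "compact (w ` closure \<Omega>)"
    using bounded_\<Omega> by (intro compact_continuous_image smooth_imp_continuous_on assms) simp
  then obtain B where B: "\<And>y. y \<in> w ` closure \<Omega> \<Longrightarrow> norm y \<le> B"
    using compact_imp_bounded bounded_iff by metis
  then have B: "\<bar>w x\<bar> \<le> B" if "x \<in> space (lebesgue_on \<Omega>)" for x
    using that closure_subset[of \<Omega>] by auto
  have "(\<lambda>x. 1) \<in> L2 (lebesgue_on \<Omega>)"
    using finite_measure.integrable_const[OF finite_measure_\<Omega>] by (simp add: L2_def)
  from L2_bounded_mult[OF this meas B] show ?thesis by simp
qed

text \<open>The functions that approximate in the definition of a trace are merely smooth on the whole space. Without
  membership in \<open>H\<^sup>1\<close> the norms of their differences would carry no information, because the weak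
  derivatives would be arbitrary functions.\<close>

lemma smooth_Hm_1:
  assumes "smooth w"
  shows "w \<in> Hm 1 \<Omega>"
proof (rule HmI[where g = "\<lambda>\<alpha>. mpartial \<alpha> w"])
  fix \<alpha> :: mindex assume "deg \<alpha> \<le> 1"
  then show "has_weak_deriv \<Omega> \<alpha> w (mpartial \<alpha> w)"
  proof (cases rule: deg_le_1_cases)
    case 1
    then show ?thesis by (simp add: mpartial_0 has_weak_deriv_0 smooth_L2 assms)
  next
    case (2 j)
    have "(LINT x|lebesgue_on \<Omega>. w x * partial j \<phi> x) = - (LINT x|lebesgue_on \<Omega>. partial j w x * \<phi> x)"
      if \<phi>: "test_function \<Omega> \<phi>" for \<phi>
    proof -
      have sm: "smooth \<phi>" using \<phi> by (simp add: test_function_def)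
      have "test_function \<Omega> (\<lambda>x. w x * \<phi> x)"
        using \<phi> assms unfolding test_function_def by (auto intro: smooth_mult)
      then have "0 = (LINT x|lebesgue_on \<Omega>. partial j (\<lambda>x. w x * \<phi> x) x)"
        by (simp add: integral_partial_test_function)
      also have "\<dots> = (LINT x|lebesgue_on \<Omega>. w x * partial j \<phi> x + partial j w x * \<phi> x)"
        by (simp add: partial_mult smooth_imp_differentiable assms sm)
      also have "\<dots> = (LINT x|lebesgue_on \<Omega>. w x * partial j \<phi> x) + (LINT x|lebesgue_on \<Omega>. partial j w x * \<phi> x)"
        by (intro Bochner_Integration.integral_add L2_mult_integrable smooth_L2 smooth_partial assms sm)
      finally show ?thesis by simp
    qed
    then show ?thesis
      unfolding 2 by (simp add: has_weak_deriv_L2_iff smooth_L2 smooth_partial assms mpartial_mi1 deg_mi1)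
  qed
qed (simp_all add: smooth_L2 smooth_mpartial assms)

end

section \<open>Traces on the faces of the cube\<close>

lemma cube_eq_box: "cube A = box (\<chi> i. - A) (\<chi> i. A)"
  by (auto simp: cube_def mem_box_cart)

interpretation cube: bounded_open_set "cube A" for A
  by unfold_locales (simp_all add: cube_eq_box open_box bounded_box)

lemma smooth_face_L2:
  assumes "smooth w"
  shows "(\<lambda>p. w (face_pt A F p)) \<in> L2 (lebesgue_on (square A))"
proof -
  have cont: "continuous_on UNIV (\<lambda>p. w (face_pt A F p))"
  proof (rule continuous_on_compose2[OF smooth_imp_continuous_on[OF assms, of UNIV]])
    have "continuous_on UNIV (\<lambda>p. if i = fst F then snd F * A else if i = fst F + 1 then fst p else snd p)" for i
      by (cases "i = fst F"; cases "i = fst F + 1") (auto intro!: continuous_intros)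
    then show "continuous_on UNIV (face_pt A F)"
      unfolding face_pt_def[abs_def] by (intro continuous_on_vec_lambda)
  qed simp
  have sq: "square A = box (- A, - A) (A, A)"
    by (auto simp: square_def mem_box Basis_prod_def)
  then have "square A \<in> lmeasurable" by simp
  then interpret finite_measure "lebesgue_on (square A)" by (rule finite_measure_lebesgue_on)
  have meas: "(\<lambda>p. w (face_pt A F p)) \<in> borel_measurable (lebesgue_on (square A))"
    using borel_measurable_continuous_onI[OF cont]
    by (intro measurable_restrict_space1 measurable_completion) simp
  have "compact ((\<lambda>p. w (face_pt A F p)) ` cbox (- A, - A) (A, A))"
    by (intro compact_continuous_image continuous_on_subset[OF cont]) auto
  then obtain B where B: "\<And>y. y \<in> (\<lambda>p. w (face_pt A F p)) ` cbox (- A, - A) (A, A) \<Longrightarrow> norm y \<le> B"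
    using compact_imp_bounded bounded_iff by metis
  have B': "\<bar>w (face_pt A F p)\<bar> \<le> B" if "p \<in> space (lebesgue_on (square A))" for p
    using that box_subset_cbox[of "(- A, - A)" "(A, A)"] B[OF imageI, of p] by (auto simp: sq)
  have "(\<lambda>x. 1) \<in> L2 (lebesgue_on (square A))" by (simp add: L2_def)
  from L2_bounded_mult[OF this meas B'] show ?thesis by simp
qed

lemma has_trace_0_iff:
  "has_trace A F u (\<lambda>_. 0) \<longleftrightarrow> u \<in> Hm 1 (cube A) \<and>
     (\<exists>w. (\<forall>k::nat. smooth (w k)) \<and> (\<lambda>k. Hm_norm 1 (cube A) (\<lambda>x. w k x - u x)) \<longlonglongrightarrow> 0 \<and>
          (\<lambda>k. L2_norm (lebesgue_on (square A)) (\<lambda>p. w k (face_pt A F p))) \<longlonglongrightarrow> 0)"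
  by (simp add: has_trace_def L2_zero)

lemma has_trace_0_lincomb:
  assumes u: "has_trace A F u (\<lambda>_. 0)" and v: "has_trace A F v (\<lambda>_. 0)"
  shows "has_trace A F (\<lambda>x. a * u x + b * v x) (\<lambda>_. 0)"
proof -
  let ?S = "lebesgue_on (square A)"
  have uH: "u \<in> Hm 1 (cube A)" and vH: "v \<in> Hm 1 (cube A)" using u v by (simp_all add: has_trace_def)
  obtain w where w: "\<And>k. smooth (w k)" "(\<lambda>k. Hm_norm 1 (cube A) (\<lambda>x. w k x - u x)) \<longlonglongrightarrow> 0"
    "(\<lambda>k. L2_norm ?S (\<lambda>p. w k (face_pt A F p))) \<longlonglongrightarrow> 0"
    using u unfolding has_trace_0_iff by blast
  obtain z where z: "\<And>k. smooth (z k)" "(\<lambda>k. Hm_norm 1 (cube A) (\<lambda>x. z k x - v x)) \<longlonglongrightarrow> 0"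
    "(\<lambda>k. L2_norm ?S (\<lambda>p. z k (face_pt A F p))) \<longlonglongrightarrow> 0"
    using v unfolding has_trace_0_iff by blast
  have lim: "(\<lambda>k. \<bar>a\<bar> * f k + \<bar>b\<bar> * g k) \<longlonglongrightarrow> 0" if "f \<longlonglongrightarrow> 0" "g \<longlonglongrightarrow> 0" for f g :: "nat \<Rightarrow> real"
    using tendsto_add[OF tendsto_mult_right_zero[OF that(1)] tendsto_mult_right_zero[OF that(2)]] by simp
  have 1: "Hm_norm 1 (cube A) (\<lambda>x. (a * w k x + b * z k x) - (a * u x + b * v x))
     \<le> \<bar>a\<bar> * Hm_norm 1 (cube A) (\<lambda>x. w k x - u x) + \<bar>b\<bar> * Hm_norm 1 (cube A) (\<lambda>x. z k x - v x)" for k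
    using cube.Hm_norm_lincomb_le[OF cube.Hm_diff[OF cube.smooth_Hm_1[OF w(1)] uH]
        cube.Hm_diff[OF cube.smooth_Hm_1[OF z(1)] vH], of a k b k] by (simp add: algebra_simps)
  have 2: "L2_norm ?S (\<lambda>p. a * w k (face_pt A F p) + b * z k (face_pt A F p))
     \<le> \<bar>a\<bar> * L2_norm ?S (\<lambda>p. w k (face_pt A F p)) + \<bar>b\<bar> * L2_norm ?S (\<lambda>p. z k (face_pt A F p))" for k
    unfolding L2_norm_cmult[symmetric]
    by (intro L2_norm_triangle L2_cmult smooth_face_L2 w z)
  show ?thesis
    unfolding has_trace_0_iff
  proof (intro conjI exI[of _ "\<lambda>k x. a * w k x + b * z k x"] allI)
    show "smooth (\<lambda>x. a * w k x + b * z k x)" for k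
      by (intro smooth_add smooth_mult smooth_const w z)
    show "(\<lambda>k. Hm_norm 1 (cube A) (\<lambda>x. (a * w k x + b * z k x) - (a * u x + b * v x))) \<longlonglongrightarrow> 0"
      by (rule tendsto_sandwich[OF _ _ tendsto_const lim[OF w(2) z(2)]])
        (intro always_eventually allI cube.Hm_norm_nonneg 1)+
    show "(\<lambda>k. L2_norm ?S (\<lambda>p. a * w k (face_pt A F p) + b * z k (face_pt A F p))) \<longlonglongrightarrow> 0"
      by (rule tendsto_sandwich[OF _ _ tendsto_const lim[OF w(3) z(3)]])
        (intro always_eventually allI L2_norm_nonneg 2)+
  qed (rule cube.Hm_lincomb[OF uH vH])
qed

text \<open>A diagonal choice: each \<open>u n\<close> contributes one smooth function that is close to it in \<open>H\<^sup>1\<close> and small on the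
  face.\<close>

lemma has_trace_0_closed:
  assumes u: "\<And>n. has_trace A F (u n) (\<lambda>_. 0)" and v: "v \<in> Hm 1 (cube A)"
    and lim: "(\<lambda>n. Hm_norm 1 (cube A) (\<lambda>x. u n x - v x)) \<longlonglongrightarrow> 0"
  shows "has_trace A F v (\<lambda>_. 0)"
proof -
  let ?S = "lebesgue_on (square A)"
  let ?e = "\<lambda>n. inverse (real (Suc n))"
  have uH: "u n \<in> Hm 1 (cube A)" for n using u by (simp add: has_trace_def)
  have "\<exists>w. smooth w \<and> Hm_norm 1 (cube A) (\<lambda>x. w x - u n x) < ?e n \<and> L2_norm ?S (\<lambda>p. w (face_pt A F p)) < ?e n" for n
  proof -
    obtain w where w: "\<And>k. smooth (w k)" "(\<lambda>k. Hm_norm 1 (cube A) (\<lambda>x. w k x - u n x)) \<longlonglongrightarrow> 0"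
      "(\<lambda>k. L2_norm ?S (\<lambda>p. w k (face_pt A F p))) \<longlonglongrightarrow> 0"
      using u[of n] unfolding has_trace_0_iff by blast
    have "\<forall>\<^sub>F k in sequentially. Hm_norm 1 (cube A) (\<lambda>x. w k x - u n x) < ?e n \<and> L2_norm ?S (\<lambda>p. w k (face_pt A F p)) < ?e n"
      by (intro eventually_conj order_tendstoD(2)[OF w(2)] order_tendstoD(2)[OF w(3)]) simp_all
    then obtain k where "Hm_norm 1 (cube A) (\<lambda>x. w k x - u n x) < ?e n \<and> L2_norm ?S (\<lambda>p. w k (face_pt A F p)) < ?e n"
      using eventually_happens sequentially_bot by blast
    with w(1) show ?thesis by blast
  qed
  then obtain w where w: "\<And>n. smooth (w n)" "\<And>n. Hm_norm 1 (cube A) (\<lambda>x. w n x - u n x) < ?e n"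
    "\<And>n. L2_norm ?S (\<lambda>p. w n (face_pt A F p)) < ?e n" by metis
  have z: "?e \<longlonglongrightarrow> 0" by (rule LIMSEQ_inverse_real_of_nat)
  have le: "Hm_norm 1 (cube A) (\<lambda>x. w n x - v x) \<le> ?e n + Hm_norm 1 (cube A) (\<lambda>x. u n x - v x)" for n
    using cube.Hm_norm_diff_triangle[OF cube.smooth_Hm_1[OF w(1)] uH v, of n n] w(2)[of n] by linarith
  have "(\<lambda>n. ?e n + Hm_norm 1 (cube A) (\<lambda>x. u n x - v x)) \<longlonglongrightarrow> 0"
    using tendsto_add[OF z lim] by simp
  then have "(\<lambda>n. Hm_norm 1 (cube A) (\<lambda>x. w n x - v x)) \<longlonglongrightarrow> 0"
    by (rule tendsto_sandwich[OF _ _ tendsto_const, rotated 2])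
      (intro always_eventually allI cube.Hm_norm_nonneg le)+
  moreover have "(\<lambda>n. L2_norm ?S (\<lambda>p. w n (face_pt A F p))) \<longlonglongrightarrow> 0"
    by (rule tendsto_sandwich[OF _ _ tendsto_const z])
      (intro always_eventually allI L2_norm_nonneg less_imp_le w(3))+
  ultimately show ?thesis
    unfolding has_trace_0_iff using v w(1) by blast
qed

lemma Hm_norm_zero_fun: "Hm_norm m (cube A) (\<lambda>x. u x - u x) = 0" if "u \<in> Hm m (cube A)"
  using cube.Hm_norm_lincomb_le[OF that that, of 0 0] cube.Hm_norm_nonneg[of m A "\<lambda>x. 0"] by simp

lemma has_trace_0_cong_AE:
  assumes u: "has_trace A F u (\<lambda>_. 0)" and v: "v \<in> Hm 1 (cube A)" and uv: "AE x in lebesgue_on (cube A). u x = v x"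
  shows "has_trace A F v (\<lambda>_. 0)"
proof (rule has_trace_0_closed[of A F "\<lambda>_. u", OF u v])
  have uH: "u \<in> Hm 1 (cube A)" using u by (simp add: has_trace_def)
  have "Hm_norm 1 (cube A) (\<lambda>x. u x - v x) = Hm_norm 1 (cube A) (\<lambda>x. u x - u x)"
    by (intro cube.Hm_norm_cong_AE cube.Hm_diff uH v) (use uv in \<open>eventually_elim, simp\<close>)
  also have "\<dots> = 0" by (rule Hm_norm_zero_fun[OF uH])
  finally show "(\<lambda>n::nat. Hm_norm 1 (cube A) (\<lambda>x. u x - v x)) \<longlonglongrightarrow> 0" by simp
qed

text \<open>The normals are coordinate vectors up to sign, so only one first-order derivative is
  left.\<close>

lemma has_normal_deriv_iff:
  "has_normal_deriv A F u g \<longleftrightarrow> has_trace A F (\<lambda>x. snd F * weak_deriv (cube A) (mi1 (fst F)) u x) g"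
proof -
  have "(\<Sum>i\<in>UNIV. face_normal F $ i * weak_deriv (cube A) (mi1 i) u x)
      = (\<Sum>i\<in>UNIV. if i = fst F then snd F * weak_deriv (cube A) (mi1 i) u x else 0)" for x
    by (intro sum.cong) (auto simp: face_normal_def axis_def)
  then show ?thesis by (simp add: has_normal_deriv_def)
qed

lemma H3_0_bsc_subset: "u \<in> H3_0_bsc A \<Longrightarrow> u \<in> Hm 3 (cube A)"
  by (simp add: H3_0_bsc_def)

lemma H3_weak_deriv_Hm_1: "u \<in> Hm 3 (cube A) \<Longrightarrow> weak_deriv (cube A) (mi1 i) u \<in> Hm 1 (cube A)"
proof -
  assume "u \<in> Hm 3 (cube A)"
  then have "u \<in> Hm (Suc 1) (cube A)" by (rule cube.Hm_mono) simp
  then show "weak_deriv (cube A) (mi1 i) u \<in> Hm 1 (cube A)" by (rule cube.weak_deriv_mi1_Hm(1))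
qed

lemma H3_0_bsc_lincomb:
  assumes "u \<in> H3_0_bsc A" "v \<in> H3_0_bsc A"
  shows "(\<lambda>x. a * u x + b * v x) \<in> H3_0_bsc A"
proof -
  have uH: "u \<in> Hm 3 (cube A)" and vH: "v \<in> Hm 3 (cube A)"
    using assms H3_0_bsc_subset by blast+
  have "has_normal_deriv A F (\<lambda>x. a * u x + b * v x) (\<lambda>_. 0)" if F: "F \<in> partial1_faces" for F
    unfolding has_normal_deriv_iff
  proof (rule has_trace_0_cong_AE)
    show "has_trace A F (\<lambda>x. a * (snd F * weak_deriv (cube A) (mi1 (fst F)) u x)
       + b * (snd F * weak_deriv (cube A) (mi1 (fst F)) v x)) (\<lambda>_. 0)"
      using assms F by (intro has_trace_0_lincomb) (auto simp: H3_0_bsc_def has_normal_deriv_iff)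
    show "(\<lambda>x. snd F * weak_deriv (cube A) (mi1 (fst F)) (\<lambda>x. a * u x + b * v x) x) \<in> Hm 1 (cube A)"
      by (intro cube.Hm_cmult H3_weak_deriv_Hm_1 cube.Hm_lincomb uH vH)
    show "AE x in lebesgue_on (cube A). a * (snd F * weak_deriv (cube A) (mi1 (fst F)) u x)
       + b * (snd F * weak_deriv (cube A) (mi1 (fst F)) v x)
       = snd F * weak_deriv (cube A) (mi1 (fst F)) (\<lambda>x. a * u x + b * v x) x"
      using cube.weak_deriv_lincomb[OF uH vH, of "mi1 (fst F)" a b, unfolded deg_mi1, OF one_le_numeral]
      by eventually_elim (simp add: algebra_simps)
  qed
  then show ?thesis
    using assms by (auto simp: H3_0_bsc_def intro!: has_trace_0_lincomb cube.Hm_lincomb)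
qed

text \<open>Convergence in \<open>H\<^sup>3\<close> implies convergence of the first-order derivatives in \<open>H\<^sup>1\<close>, where the
  kernels of the traces are closed.\<close>

lemma H3_0_bsc_closed:
  assumes u: "\<And>n. u n \<in> H3_0_bsc A" and v: "v \<in> Hm 3 (cube A)"
    and lim: "(\<lambda>n. Hm_norm 3 (cube A) (\<lambda>x. u n x - v x)) \<longlonglongrightarrow> 0"
  shows "v \<in> H3_0_bsc A"
proof -
  have uH: "u n \<in> Hm 3 (cube A)" for n using u H3_0_bsc_subset by blast
  have u2: "u n \<in> Hm (Suc 1) (cube A)" for n using uH by (rule cube.Hm_mono) simp
  have v2: "v \<in> Hm (Suc 1) (cube A)" using v by (rule cube.Hm_mono) simp
  have lim1: "(\<lambda>n. Hm_norm 1 (cube A) (\<lambda>x. u n x - v x)) \<longlonglongrightarrow> 0"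
    by (rule cube.Hm_norm_diff_tendsto_mono[OF uH v _ lim]) simp
  have lim2: "(\<lambda>n. Hm_norm (Suc 1) (cube A) (\<lambda>x. u n x - v x)) \<longlonglongrightarrow> 0"
    by (rule cube.Hm_norm_diff_tendsto_mono[OF uH v _ lim]) simp
  have "has_normal_deriv A F v (\<lambda>_. 0)" if F: "F \<in> partial1_faces" for F
    unfolding has_normal_deriv_iff
  proof (rule has_trace_0_closed)
    let ?D = "weak_deriv (cube A) (mi1 (fst F))"
    show "has_trace A F (\<lambda>x. snd F * ?D (u n) x) (\<lambda>_. 0)" for n
      using u[of n] F by (simp add: H3_0_bsc_def has_normal_deriv_iff)
    show "(\<lambda>x. snd F * ?D v x) \<in> Hm 1 (cube A)"
      by (intro cube.Hm_cmult H3_weak_deriv_Hm_1 v)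
    have le: "Hm_norm 1 (cube A) (\<lambda>x. snd F * ?D (u n) x - snd F * ?D v x) \<le> \<bar>snd F\<bar> * Hm_norm 1 (cube A) (\<lambda>x. ?D (u n) x - ?D v x)" for n
      using cube.Hm_norm_lincomb_le[OF cube.Hm_diff[OF H3_weak_deriv_Hm_1[OF uH] H3_weak_deriv_Hm_1[OF v]]
          cube.Hm_diff[OF H3_weak_deriv_Hm_1[OF uH] H3_weak_deriv_Hm_1[OF v]], of "snd F" "fst F" n "fst F" 0]
      by (simp add: algebra_simps)
    have "(\<lambda>n. \<bar>snd F\<bar> * Hm_norm 1 (cube A) (\<lambda>x. ?D (u n) x - ?D v x)) \<longlonglongrightarrow> 0"
      by (intro tendsto_mult_right_zero cube.Hm_norm_weak_deriv_tendsto[OF u2 v2 lim2])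
    then show "(\<lambda>n. Hm_norm 1 (cube A) (\<lambda>x. snd F * ?D (u n) x - snd F * ?D v x)) \<longlonglongrightarrow> 0"
      by (rule tendsto_sandwich[OF _ _ tendsto_const, rotated 2])
        (intro always_eventually allI cube.Hm_norm_nonneg le)+
  qed
  moreover have "has_trace A S_bsc v (\<lambda>_. 0)"
    using u by (intro has_trace_0_closed[OF _ _ lim1]) (auto simp: H3_0_bsc_def cube.Hm_mono[OF v])
  ultimately show ?thesis using v by (simp add: H3_0_bsc_def)
qed

lemma H3_0_bsc_zero: "(\<lambda>x. 0) \<in> H3_0_bsc A"
proof -
  have H: "(\<lambda>x. 0) \<in> Hm 3 (cube A)"
    by (rule cube.HmI[where g = "\<lambda>_ _. 0"])
      (auto simp: L2_zero cube.has_weak_deriv_L2_iff)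
  have H1: "(\<lambda>x. 0) \<in> Hm 1 (cube A)" using H by (rule cube.Hm_mono) simp
  have t: "has_trace A F (\<lambda>x. 0) (\<lambda>_. 0)" for F
    unfolding has_trace_0_iff
    using H1 Hm_norm_zero_fun[OF H1] by (intro conjI exI[of _ "\<lambda>_ _. 0"]) (auto simp: smooth_const L2_norm_zero)
  have "has_normal_deriv A F (\<lambda>x. 0) (\<lambda>_. 0)" for F
    unfolding has_normal_deriv_iff
  proof (rule has_trace_0_cong_AE[OF t])
    show "(\<lambda>x. snd F * weak_deriv (cube A) (mi1 (fst F)) (\<lambda>x. 0) x) \<in> Hm 1 (cube A)"
      by (intro cube.Hm_cmult H3_weak_deriv_Hm_1 H)
    show "AE x in lebesgue_on (cube A). 0 = snd F * weak_deriv (cube A) (mi1 (fst F)) (\<lambda>x. 0) x"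
      using cube.weak_deriv_lincomb[OF H H, of "mi1 (fst F)" 0 0, unfolded deg_mi1, OF one_le_numeral]
      by eventually_elim simp
  qed
  with H t show ?thesis by (simp add: H3_0_bsc_def)
qed


section \<open>Vector functions\<close>

lemma HmN_norm_L2_set: "HmN_norm m \<Omega> U = L2_set (\<lambda>k. Hm_norm m \<Omega> (\<lambda>x. U x $ k)) UNIV"
  by (simp add: HmN_norm_def L2_set_def)

lemma HmN_norm_nonneg: "0 \<le> HmN_norm m \<Omega> U"
  by (simp add: HmN_norm_L2_set)

lemma HmN_norm_sq: "(HmN_norm m \<Omega> U)\<^sup>2 = (\<Sum>k\<in>UNIV. (Hm_norm m \<Omega> (\<lambda>x. U x $ k))\<^sup>2)"
  by (simp add: HmN_norm_def sum_nonneg)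

lemma Hm_norm_component_le:
  "Hm_norm m \<Omega> (\<lambda>x. U x $ k) \<le> HmN_norm m \<Omega> U"
  unfolding HmN_norm_L2_set by (rule member_le_L2_set[where f = "\<lambda>k. Hm_norm m \<Omega> (\<lambda>x. U x $ k)"]) auto

lemma HmN_norm_le_sum:
  "HmN_norm m (cube A) U \<le> (\<Sum>k\<in>UNIV. Hm_norm m (cube A) (\<lambda>x. U x $ k))"
  unfolding HmN_norm_L2_set by (rule L2_set_le_sum) (simp add: cube.Hm_norm_nonneg)

lemma HmN_lincomb:
  "U \<in> HmN m (cube A) \<Longrightarrow> V \<in> HmN m (cube A) \<Longrightarrow> (\<lambda>x. a *\<^sub>R U x + b *\<^sub>R V x) \<in> HmN m (cube A)"
  by (simp add: HmN_def cube.Hm_lincomb)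

lemma HmN_diff: "U \<in> HmN m (cube A) \<Longrightarrow> V \<in> HmN m (cube A) \<Longrightarrow> (\<lambda>x. U x - V x) \<in> HmN m (cube A)"
  and HmN_add: "U \<in> HmN m (cube A) \<Longrightarrow> V \<in> HmN m (cube A) \<Longrightarrow> (\<lambda>x. U x + V x) \<in> HmN m (cube A)"
  by (simp_all add: HmN_def cube.Hm_diff cube.Hm_add)

lemma HmN_norm_midpoint:
  assumes "U \<in> HmN m (cube A)" "V \<in> HmN m (cube A)"
  shows "(HmN_norm m (cube A) (\<lambda>x. (1/2) *\<^sub>R U x + (1/2) *\<^sub>R V x))\<^sup>2
    = ((HmN_norm m (cube A) U)\<^sup>2 + (HmN_norm m (cube A) V)\<^sup>2) / 2 - (HmN_norm m (cube A) (\<lambda>x. U x - V x))\<^sup>2 / 4"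
proof -
  have "(Hm_norm m (cube A) (\<lambda>x. ((1/2) *\<^sub>R U x + (1/2) *\<^sub>R V x) $ k))\<^sup>2
    = ((Hm_norm m (cube A) (\<lambda>x. U x $ k))\<^sup>2 + (Hm_norm m (cube A) (\<lambda>x. V x $ k))\<^sup>2) / 2
      - (Hm_norm m (cube A) (\<lambda>x. (U x - V x) $ k))\<^sup>2 / 4" for k
    using assms cube.Hm_norm_midpoint[of "\<lambda>x. U x $ k" m A "\<lambda>x. V x $ k"] by (simp add: HmN_def)
  then show ?thesis
    by (simp add: HmN_norm_sq sum_subtractf sum.distrib flip: sum_divide_distrib)
qed

lemma HmN_norm_diff_le:
  assumes "U \<in> HmN m (cube A)" "V \<in> HmN m (cube A)"
  shows "\<bar>HmN_norm m (cube A) U - HmN_norm m (cube A) V\<bar> \<le> HmN_norm m (cube A) (\<lambda>x. U x - V x)"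
proof -
  have tri: "HmN_norm m (cube A) U \<le> HmN_norm m (cube A) (\<lambda>x. U x - V x) + HmN_norm m (cube A) V"
    if "U \<in> HmN m (cube A)" "V \<in> HmN m (cube A)" for U V :: "real^3 \<Rightarrow> real^'n"
  proof -
    have le: "Hm_norm m (cube A) (\<lambda>x. U x $ k) \<le> Hm_norm m (cube A) (\<lambda>x. (U x - V x) $ k) + Hm_norm m (cube A) (\<lambda>x. V x $ k)" for k
      using that cube.Hm_norm_lincomb_le[OF cube.Hm_diff, of "\<lambda>x. U x $ k" m A "\<lambda>x. V x $ k" "\<lambda>x. V x $ k" 1 1]
      by (simp add: HmN_def)
    have "HmN_norm m (cube A) U \<le> L2_set (\<lambda>k. Hm_norm m (cube A) (\<lambda>x. (U x - V x) $ k) + Hm_norm m (cube A) (\<lambda>x. V x $ k)) UNIV"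
      unfolding HmN_norm_L2_set by (rule L2_set_mono) (simp_all only: le cube.Hm_norm_nonneg)
    also have "\<dots> \<le> HmN_norm m (cube A) (\<lambda>x. U x - V x) + HmN_norm m (cube A) V"
      unfolding HmN_norm_L2_set by (rule L2_set_triangle_ineq)
    finally show ?thesis .
  qed
  have "Hm_norm m (cube A) (\<lambda>x. (V x - U x) $ k) = Hm_norm m (cube A) (\<lambda>x. (U x - V x) $ k)" for k
  proof -
    have H: "(\<lambda>x. U x $ k) \<in> Hm m (cube A)" "(\<lambda>x. V x $ k) \<in> Hm m (cube A)" using assms by (auto simp: HmN_def)
    show ?thesis
      using cube.Hm_norm_lincomb_le[OF cube.Hm_diff[OF H] cube.Hm_diff[OF H], of "- 1" 0]
        cube.Hm_norm_lincomb_le[OF cube.Hm_diff[OF H(2,1)] cube.Hm_diff[OF H(2,1)], of "- 1" 0] by simp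
  qed
  then have "HmN_norm m (cube A) (\<lambda>x. V x - U x) = HmN_norm m (cube A) (\<lambda>x. U x - V x)"
    by (simp add: HmN_norm_def)
  then show ?thesis using tri[OF assms] tri[OF assms(2,1)] by linarith
qed

lemma HmN_norm_diff_eq_0:
  assumes "U \<in> HmN m (cube A)" "V \<in> HmN m (cube A)" "HmN_norm m (cube A) (\<lambda>x. U x - V x) = 0"
  shows "AE x in lebesgue_on (cube A). U x = V x"
proof -
  have "AE x in lebesgue_on (cube A). U x $ k = V x $ k" for k
  proof (rule cube.Hm_norm_diff_eq_0)
    show "Hm_norm m (cube A) (\<lambda>x. U x $ k - V x $ k) = 0"
      using Hm_norm_component_le[of m "cube A" "\<lambda>x. U x - V x" k] assms(3)
        cube.Hm_norm_nonneg[of m A "\<lambda>x. U x $ k - V x $ k"] by simp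
  qed (use assms in \<open>simp_all add: HmN_def\<close>)
  then have "AE x in lebesgue_on (cube A). \<forall>k\<in>UNIV. U x $ k = V x $ k"
    by (intro AE_finite_allI) auto
  then show ?thesis by eventually_elim (simp add: vec_eq_iff)
qed

lemma HmN_complete:
  assumes U: "\<And>n. U n \<in> HmN m (cube A)"
    and Cauchy: "\<And>e. 0 < e \<Longrightarrow> \<exists>N. \<forall>i\<ge>N. \<forall>j\<ge>N. HmN_norm m (cube A) (\<lambda>x. U i x - U j x) < e"
  obtains V where "V \<in> HmN m (cube A)" "(\<lambda>n. HmN_norm m (cube A) (\<lambda>x. U n x - V x)) \<longlonglongrightarrow> 0"
proof -
  let ?lim = "\<lambda>k v. v \<in> Hm m (cube A) \<and> (\<lambda>n. Hm_norm m (cube A) (\<lambda>x. U n x $ k - v x)) \<longlonglongrightarrow> 0"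
  have ex: "\<exists>v. ?lim k v" for k
  proof (rule cube.Hm_complete[of "\<lambda>n x. U n x $ k" m A])
    show "(\<lambda>x. U n x $ k) \<in> Hm m (cube A)" for n using U by (simp add: HmN_def)
    fix e :: real assume "0 < e"
    then obtain N where N: "\<And>i j. N \<le> i \<Longrightarrow> N \<le> j \<Longrightarrow> HmN_norm m (cube A) (\<lambda>x. U i x - U j x) < e"
      using Cauchy by metis
    have "Hm_norm m (cube A) (\<lambda>x. U i x $ k - U j x $ k) \<le> HmN_norm m (cube A) (\<lambda>x. U i x - U j x)" for i j
      using Hm_norm_component_le[of m "cube A" "\<lambda>x. U i x - U j x" k] by (simp add: cube.Hm_norm_nonneg)
    then show "\<exists>N. \<forall>i\<ge>N. \<forall>j\<ge>N. Hm_norm m (cube A) (\<lambda>x. U i x $ k - U j x $ k) < e"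
      using N le_less_trans by blast
  qed blast
  define v where "v k = (SOME v. ?lim k v)" for k
  have v: "v k \<in> Hm m (cube A)" "(\<lambda>n. Hm_norm m (cube A) (\<lambda>x. U n x $ k - v k x)) \<longlonglongrightarrow> 0" for k
    using someI_ex[OF ex[of k]] unfolding v_def by blast+
  let ?V = "\<lambda>x. \<chi> k. v k x"
  have lim: "(\<lambda>n. \<Sum>k\<in>UNIV. Hm_norm m (cube A) (\<lambda>x. (U n x - ?V x) $ k)) \<longlonglongrightarrow> 0"
    by (intro tendsto_null_sum) (simp add: v)
  show thesis
  proof
    show "?V \<in> HmN m (cube A)" using v(1) by (simp add: HmN_def)
    show "(\<lambda>n. HmN_norm m (cube A) (\<lambda>x. U n x - ?V x)) \<longlonglongrightarrow> 0"
      by (rule tendsto_sandwich[OF _ _ tendsto_const lim])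
        (intro always_eventually allI HmN_norm_nonneg HmN_norm_le_sum)+
  qed
qed

lemma H3_0_bscN_subset: "U \<in> H3_0_bscN A \<Longrightarrow> U \<in> HmN 3 (cube A)"
  by (auto simp: H3_0_bscN_def HmN_def H3_0_bsc_subset)

lemma H3_0_bscN_zero: "(\<lambda>x. 0) \<in> H3_0_bscN A"
  by (simp add: H3_0_bscN_def H3_0_bsc_zero)

lemma H3_0_bscN_lincomb:
  "U \<in> H3_0_bscN A \<Longrightarrow> V \<in> H3_0_bscN A \<Longrightarrow> (\<lambda>x. a *\<^sub>R U x + b *\<^sub>R V x) \<in> H3_0_bscN A"
  by (simp add: H3_0_bscN_def H3_0_bsc_lincomb)

lemma H3_0_bscN_closed:
  assumes "\<And>n. U n \<in> H3_0_bscN A" "V \<in> HmN 3 (cube A)"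
    and lim: "(\<lambda>n. HmN_norm 3 (cube A) (\<lambda>x. U n x - V x)) \<longlonglongrightarrow> 0"
  shows "V \<in> H3_0_bscN A"
  unfolding H3_0_bscN_def
proof (intro CollectI allI, rule H3_0_bsc_closed)
  fix k
  have le: "Hm_norm 3 (cube A) (\<lambda>x. U n x $ k - V x $ k) \<le> HmN_norm 3 (cube A) (\<lambda>x. U n x - V x)" for n
    using Hm_norm_component_le[of 3 "cube A" "\<lambda>x. U n x - V x" k] by (simp add: cube.Hm_norm_nonneg)
  show "(\<lambda>n. Hm_norm 3 (cube A) (\<lambda>x. U n x $ k - V x $ k)) \<longlonglongrightarrow> 0"
    by (rule tendsto_sandwich[OF _ _ tendsto_const lim])
      (intro always_eventually allI cube.Hm_norm_nonneg le)+
  show "(\<lambda>x. U n x $ k) \<in> H3_0_bsc A" for n using assms(1) by (simp add: H3_0_bscN_def)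
  show "(\<lambda>x. V x $ k) \<in> Hm 3 (cube A)" using assms(2) by (simp add: HmN_def)
qed

section \<open>The coefficients of the operator\<close>

text \<open>The Gram-Schmidt functions are linear combinations of \<open>t ^ k * exp t\<close>. The
  normalization is a division by a constant and preserves differentiability even if the constant is \<open>0\<close>,
  where division returns \<open>0\<close>.\<close>

lemma gs_C1: "\<exists>g'. (\<forall>t. (gs d k has_real_derivative g' t) (at t)) \<and> continuous_on UNIV g'"
proof (induction k rule: less_induct)
  case (less k)
  then obtain g' where g': "\<And>l t. l < k \<Longrightarrow> (gs d l has_real_derivative g' l t) (at t)"
    "\<And>l. l < k \<Longrightarrow> continuous_on UNIV (g' l)" by metis
  define c where "c l = ip d (\<lambda>t. t ^ k * exp t) (gs d l)" for l
  define v where "v t = t ^ k * exp t - (\<Sum>l<k. c l * gs d l t)" for t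
  define v' where "v' t = (real k * t ^ (k - 1)) * exp t + t ^ k * exp t - (\<Sum>l<k. c l * g' l t)" for t
  have gs: "gs d k = (\<lambda>t. v t / sqrt (ip d v v))"
    by (subst gs.simps) (simp add: Let_def c_def v_def[abs_def])
  have "(v has_real_derivative v' t) (at t)" for t
    unfolding v_def[abs_def] v'_def
    by (auto intro!: derivative_eq_intros g' simp: algebra_simps)
  then have "(gs d k has_real_derivative v' t / sqrt (ip d v v)) (at t)" for t
    unfolding gs by (intro DERIV_cdivide)
  moreover have "continuous_on UNIV (\<lambda>t. v' t / sqrt (ip d v v))"
    unfolding v'_def divide_inverse
    by (intro continuous_intros g') auto
  ultimately show ?case by (intro exI conjI allI)
qed

lemma Psi_C1: "\<exists>\<Psi>'. (\<forall>t. (Psi d n has_real_derivative \<Psi>' t) (at t)) \<and> continuous_on UNIV \<Psi>'"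
  unfolding Psi_def by (rule gs_C1)

lemma rvec_components:
  "rvec A b x t $ 1 = x $ 1 - t" "rvec A b x t $ 2 = x $ 2" "rvec A b x t $ 3 = x $ 3 + A + b"
  by (simp_all add: rvec_def)

lemma norm_rvec_sq: "(norm (rvec A b x t))\<^sup>2 = (x $ 1 - t)\<^sup>2 + (x $ 2)\<^sup>2 + (x $ 3 + A + b)\<^sup>2"
  unfolding power2_norm_eq_inner inner_vec_def
  by (simp add: sum_3 rvec_components power2_eq_square)

definition closed_cube :: "real \<Rightarrow> (real^3) set" where
  "closed_cube A = {x. \<forall>i. - A \<le> x $ i \<and> x $ i \<le> A}"

lemma compact_closed_cube: "compact (closed_cube A)"
proof -
  have "closed_cube A = cbox (\<chi> i. - A) (\<chi> i. A)"
    by (auto simp: closed_cube_def mem_box_cart)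
  then show ?thesis by simp
qed

lemma cube_subset_closed_cube: "cube A \<subseteq> closed_cube A"
  by (auto simp: cube_def closed_cube_def less_imp_le)

text \<open>The third component of \<open>rvec A b x t\<close> is at least \<open>b\<close> on the closed cube.\<close>

lemma norm_rvec_pos: "0 < b \<Longrightarrow> x \<in> closed_cube A \<Longrightarrow> 0 < (norm (rvec A b x t))\<^sup>2"
proof -
  assume "0 < b" "x \<in> closed_cube A"
  then have "0 < x $ 3 + A + b" by (simp add: closed_cube_def add_nonneg_pos) (smt (verit))
  then show ?thesis unfolding norm_rvec_sq by (intro add_nonneg_pos add_nonneg_nonneg) auto
qed

text \<open>The common form of the entries of \<open>D_mat\<close> and \<open>D0_mat\<close>. The denominators do not vanish on the
  closed cube, so the integrand is jointly continuous there, and an integral over a compact interval depends continuously on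
  the parameter.\<close>

lemma continuous_on_integral_deriv_kernel:
  fixes p :: "real^3 \<Rightarrow> real \<Rightarrow> real"
  assumes b: "0 < b"
    and p: "\<And>x t. (p x has_real_derivative p') (at t)" "continuous_on UNIV (\<lambda>z. p (fst z) (snd z))"
    and \<Psi>: "\<And>t. (\<Psi> has_real_derivative \<Psi>' t) (at t)" "continuous_on UNIV \<Psi>'"
    and \<phi>: "continuous_on UNIV \<phi>"
  shows "continuous_on (closed_cube A)
    (\<lambda>x. LBINT t:{-d<..<d}. deriv (\<lambda>s. p x s * \<Psi> s / (norm (rvec A b x s))\<^sup>2) t * \<phi> t)"
proof -
  let ?K = "closed_cube A"
  define \<rho> where "\<rho> x t = (x $ 1 - t)\<^sup>2 + (x $ 2)\<^sup>2 + (x $ 3 + A + b)\<^sup>2" for x :: "real^3" and t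
  define h where "h x t = ((p' * \<Psi> t + p x t * \<Psi>' t) * \<rho> x t - p x t * \<Psi> t * (- 2 * (x $ 1 - t))) / (\<rho> x t * \<rho> x t) * \<phi> t"
    for x t
  have \<rho>: "\<rho> x t \<noteq> 0" if "x \<in> ?K" for x t
    using norm_rvec_pos[OF b that, of t] unfolding norm_rvec_sq \<rho>_def by simp
  have \<Psi>c: "continuous_on UNIV \<Psi>"
    using \<Psi>(1) DERIV_isCont continuous_at_imp_continuous_on by blast
  have deriv: "deriv (\<lambda>s. p x s * \<Psi> s / (norm (rvec A b x s))\<^sup>2) t * \<phi> t = h x t" if "x \<in> ?K" for x t
  proof -
    have d\<rho>: "(\<rho> x has_real_derivative - 2 * (x $ 1 - t)) (at t)"
      unfolding \<rho>_def[abs_def] by (auto intro!: derivative_eq_intros)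
    have "((\<lambda>s. p x s * \<Psi> s / \<rho> x s) has_real_derivative
        ((p' * \<Psi> t + p x t * \<Psi>' t) * \<rho> x t - p x t * \<Psi> t * (- 2 * (x $ 1 - t))) / (\<rho> x t * \<rho> x t)) (at t)"
      using DERIV_mult[OF p(1) \<Psi>(1), of x t] by (intro DERIV_divide d\<rho> \<rho>[OF that]) (simp add: algebra_simps)
    then show ?thesis
      unfolding norm_rvec_sq \<rho>_def[symmetric] h_def by (simp add: DERIV_imp_deriv)
  qed
  have cont: "continuous_on (?K \<times> cbox (- d) d) (\<lambda>(x, t). h x t)"
  proof -
    have 1: "continuous_on (?K \<times> cbox (- d) d) (\<lambda>z. \<Psi> (snd z))"
      and 2: "continuous_on (?K \<times> cbox (- d) d) (\<lambda>z. \<Psi>' (snd z))"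
      and 3: "continuous_on (?K \<times> cbox (- d) d) (\<lambda>z. \<phi> (snd z))"
      by (rule continuous_on_compose2[OF \<Psi>c] continuous_on_compose2[OF \<Psi>(2)] continuous_on_compose2[OF \<phi>];
          auto intro: continuous_intros)+
    have 4: "continuous_on (?K \<times> cbox (- d) d) (\<lambda>z. p (fst z) (snd z))"
      by (rule continuous_on_subset[OF p(2)]) simp
    have 5: "continuous_on (?K \<times> cbox (- d) d) (\<lambda>z. \<rho> (fst z) (snd z))"
      unfolding \<rho>_def by (intro continuous_intros)
    have 6: "continuous_on (?K \<times> cbox (- d) d) (\<lambda>z. fst z $ 1 - snd z)"
      by (intro continuous_intros)
    show ?thesis
      unfolding h_def split_beta
      by (intro continuous_on_mult continuous_on_divide continuous_on_diff continuous_on_add continuous_on_const 1 2 3 4 5 6)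
        (auto simp: \<rho>)
  qed
  have "(LBINT t:{-d<..<d}. deriv (\<lambda>s. p x s * \<Psi> s / (norm (rvec A b x s))\<^sup>2) t * \<phi> t) = integral (cbox (- d) d) (h x)"
    if x: "x \<in> ?K" for x
  proof -
    have hc: "continuous_on (cbox (- d) d) (h x)"
      using continuous_on_compose2[OF cont, of "cbox (- d) d" "\<lambda>t. (x, t)"] x
      by (auto simp: continuous_on_Pair)
    have "set_integrable lborel (cbox (- d) d) (h x)"
      using borel_integrable_compact[OF compact_cbox hc] by (simp add: set_integrable_def)
    then have "set_integrable lborel {-d<..<d} (h x)"
      by (rule set_integrable_subset) auto
    from set_borel_integral_eq_integral(2)[OF this]
    show ?thesis
      unfolding deriv[OF x] using integral_open_interval_real[of "-d" d "h x"] by simp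
  qed
  moreover have "continuous_on ?K (\<lambda>x. integral (cbox (- d) d) (h x))"
    by (rule integral_continuous_on_param[OF cont])
  ultimately show ?thesis by (simp cong: continuous_on_cong)
qed

lemma continuous_on_D_mat:
  assumes "0 < b"
  shows "continuous_on (closed_cube A) (\<lambda>x. D_mat A b d j x $ m $ n)"
proof -
  obtain \<Psi>' where \<Psi>': "\<And>t. (Psi d n has_real_derivative \<Psi>' t) (at t)" "continuous_on UNIV \<Psi>'"
    using Psi_C1[of d n] by blast
  obtain \<phi>' where \<phi>': "\<And>t. (Psi d m has_real_derivative \<phi>' t) (at t)"
    using Psi_C1[of d m] by blast
  have \<phi>: "continuous_on UNIV (Psi d m)" using \<phi>' DERIV_isCont continuous_at_imp_continuous_on by blast
  have "continuous_on (closed_cube A)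
    (\<lambda>x. LBINT t:{-d<..<d}. deriv (\<lambda>s. (2 * rvec A b x s $ j) * Psi d n s / (norm (rvec A b x s))\<^sup>2) t * Psi d m t)"
  proof (rule continuous_on_integral_deriv_kernel[OF assms _ _ \<Psi>' \<phi>])
    show "((\<lambda>s. 2 * rvec A b x s $ j) has_real_derivative (if j = 1 then - 2 else 0)) (at t)" for x t
      using exhaust_3[of j] by (auto simp: rvec_components intro!: derivative_eq_intros)
    show "continuous_on UNIV (\<lambda>z. 2 * rvec A b (fst z) (snd z) $ j)"
    proof -
      consider "j = 1" | "j = 2" | "j = 3" using exhaust_3[of j] by blast
      then show ?thesis
        by cases (simp_all only: rvec_components, (intro continuous_intros)+)
    qed
  qed
  then show ?thesis by (simp add: D_mat_def continuous_on_minus)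
qed

lemma continuous_on_D0_mat:
  assumes "0 < b"
  shows "continuous_on (closed_cube A) (\<lambda>x. D0_mat A b d x $ m $ n)"
proof -
  obtain \<Psi>' where \<Psi>': "\<And>t. (Psi d n has_real_derivative \<Psi>' t) (at t)" "continuous_on UNIV \<Psi>'"
    using Psi_C1[of d n] by blast
  obtain \<phi>' where \<phi>': "\<And>t. (Psi d m has_real_derivative \<phi>' t) (at t)"
    using Psi_C1[of d m] by blast
  have \<phi>: "continuous_on UNIV (Psi d m)" using \<phi>' DERIV_isCont continuous_at_imp_continuous_on by blast
  have "continuous_on (closed_cube A)
    (\<lambda>x. LBINT t:{-d<..<d}. deriv (\<lambda>s. 4 * Psi d n s / (norm (rvec A b x s))\<^sup>2) t * Psi d m t)"
    by (rule continuous_on_integral_deriv_kernel[OF assms _ _ \<Psi>' \<phi>, where p' = 0]) auto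
  then show ?thesis by (simp add: D0_mat_def)
qed

lemma continuous_on_A_mat:
  "0 < b \<Longrightarrow> continuous_on (closed_cube A) (\<lambda>x. A_mat A b d j x $ m $ n)"
  unfolding A_mat_def matrix_matrix_mult_def
  by (simp, intro continuous_on_sum continuous_on_mult_left continuous_on_D_mat)

lemma continuous_on_A0_mat:
  "0 < b \<Longrightarrow> continuous_on (closed_cube A) (\<lambda>x. A0_mat A b d x $ m $ n)"
  unfolding A0_mat_def matrix_matrix_mult_def
  by (simp, intro continuous_on_sum continuous_on_mult_left continuous_on_D0_mat)

lemma continuous_on_closed_cube_measurable:
  fixes f :: "real^3 \<Rightarrow> real"
  assumes "continuous_on (closed_cube A) f"
  shows "f \<in> borel_measurable (lebesgue_on (cube A))"
    and "\<exists>B. \<forall>x\<in>cube A. \<bar>f x\<bar> \<le> B"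
proof -
  have "open (cube A)" by (simp add: cube_eq_box open_box)
  show "f \<in> borel_measurable (lebesgue_on (cube A))"
    using continuous_on_subset[OF assms cube_subset_closed_cube] \<open>open (cube A)\<close>
    by (intro continuous_imp_measurable_on_sets_lebesgue) (auto simp: borel_open)
  have "compact (f ` closed_cube A)"
    by (intro compact_continuous_image assms compact_closed_cube)
  then obtain B where "\<And>y. y \<in> f ` closed_cube A \<Longrightarrow> norm y \<le> B"
    using compact_imp_bounded bounded_iff by metis
  then show "\<exists>B. \<forall>x\<in>cube A. \<bar>f x\<bar> \<le> B"
    using cube_subset_closed_cube by fastforce
qed


section \<open>Boundedness of the operator\<close>

lemma coefficients_bounded:
  assumes "0 < b"
  obtains B where "0 \<le> B"
    "\<And>x j k l. x \<in> cube A \<Longrightarrow> \<bar>(A_mat A b d j x :: real^'n::{finite,linorder}^'n::{finite,linorder}) $ k $ l\<bar> \<le> B"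
    "\<And>x k l. x \<in> cube A \<Longrightarrow> \<bar>(A0_mat A b d x :: real^'n::{finite,linorder}^'n::{finite,linorder}) $ k $ l\<bar> \<le> B"
proof -
  have "\<exists>B. \<forall>x\<in>cube A. \<bar>(A_mat A b d j x :: real^'n::{finite,linorder}^'n::{finite,linorder}) $ k $ l\<bar> \<le> B" for j k l
    by (rule continuous_on_closed_cube_measurable(2)[OF continuous_on_A_mat[OF assms]])
  then obtain B1 where B1: "\<And>j k l x. x \<in> cube A \<Longrightarrow> \<bar>(A_mat A b d j x :: real^'n::{finite,linorder}^'n::{finite,linorder}) $ k $ l\<bar> \<le> B1 j k l"
    by metis
  have "\<exists>B. \<forall>x\<in>cube A. \<bar>(A0_mat A b d x :: real^'n::{finite,linorder}^'n::{finite,linorder}) $ k $ l\<bar> \<le> B" for k l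
    by (rule continuous_on_closed_cube_measurable(2)[OF continuous_on_A0_mat[OF assms]])
  then obtain B0 where B0: "\<And>k l x. x \<in> cube A \<Longrightarrow> \<bar>(A0_mat A b d x :: real^'n::{finite,linorder}^'n::{finite,linorder}) $ k $ l\<bar> \<le> B0 k l"
    by metis
  define S1 where "S1 = (\<Sum>(j, k, l)\<in>UNIV. \<bar>B1 j k l\<bar>)"
  define S0 where "S0 = (\<Sum>(k, l)\<in>UNIV. \<bar>B0 k l\<bar>)"
  have S: "0 \<le> S1" "0 \<le> S0" unfolding S1_def S0_def by (auto intro!: sum_nonneg)
  have "B1 j k l \<le> S1" for j k l
    using member_le_sum[of "(j, k, l)" UNIV "\<lambda>(j, k, l). \<bar>B1 j k l\<bar>"] unfolding S1_def
    by (auto intro: order_trans[OF abs_ge_self])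
  moreover have "B0 k l \<le> S0" for k l
    using member_le_sum[of "(k, l)" UNIV "\<lambda>(k, l). \<bar>B0 k l\<bar>"] unfolding S0_def
    by (auto intro: order_trans[OF abs_ge_self])
  ultimately show thesis
    using S B1 B0 by (intro that[of "S1 + S0"]) (fastforce intro: order_trans)+
qed

lemma Lop_component:
  "Lop A b d U x $ k = (\<Sum>i\<in>UNIV. weak_deriv (cube A) (mi2 i) (\<lambda>y. U y $ k) x)
     + (\<Sum>j\<in>UNIV. \<Sum>l\<in>UNIV. A_mat A b d j x $ k $ l * weak_deriv (cube A) (mi1 j) (\<lambda>y. U y $ l) x)
     + (\<Sum>l\<in>UNIV. A0_mat A b d x $ k $ l * U x $ l)"
  by (simp add: Lop_def weak_derivN_def matrix_vector_mult_def)

text \<open>Each component of \<open>L U\<close> is a finite sum of bounded measurable coefficients times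
  weak derivatives of order at most two, each of which is bounded in \<open>L\<^sub>2\<close> by the \<open>H\<^sup>3\<close> norm.\<close>

lemma Lop_bounded:
  assumes b: "0 < b"
  shows "\<exists>C>0. \<forall>(U :: real^3 \<Rightarrow> real^'n::{finite,linorder}) k. U \<in> HmN 3 (cube A) \<longrightarrow>
      (\<lambda>x. Lop A b d U x $ k) \<in> L2 (lebesgue_on (cube A)) \<and>
      L2_norm (lebesgue_on (cube A)) (\<lambda>x. Lop A b d U x $ k) \<le> C * HmN_norm 3 (cube A) U"
proof -
  let ?M = "lebesgue_on (cube A)"
  obtain B where B: "0 \<le> B"
    "\<And>x j k l. x \<in> cube A \<Longrightarrow> \<bar>(A_mat A b d j x :: real^'n::{finite,linorder}^'n::{finite,linorder}) $ k $ l\<bar> \<le> B"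
    "\<And>x k l. x \<in> cube A \<Longrightarrow> \<bar>(A0_mat A b d x :: real^'n::{finite,linorder}^'n::{finite,linorder}) $ k $ l\<bar> \<le> B"
    using coefficients_bounded[OF b] by metis
  define N where "N = real (CARD('n))"
  define C where "C = 3 + 3 * (N * B) + N * B"
  have main: "(\<lambda>x. Lop A b d U x $ k) \<in> L2 ?M \<and> L2_norm ?M (\<lambda>x. Lop A b d U x $ k) \<le> C * HmN_norm 3 (cube A) U"
    if U: "U \<in> HmN 3 (cube A)" for U :: "real^3 \<Rightarrow> real^'n::{finite,linorder}" and k
  proof -
    let ?n = "HmN_norm 3 (cube A) U"
    have Ul: "(\<lambda>x. U x $ l) \<in> Hm 3 (cube A)" for l using U by (simp add: HmN_def)
    have le: "L2_norm ?M (weak_deriv (cube A) \<alpha> (\<lambda>x. U x $ l)) \<le> ?n" if "deg \<alpha> \<le> 3" for \<alpha> l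
      using cube.L2_norm_weak_deriv_le[OF that, of A "\<lambda>x. U x $ l"]
        Hm_norm_component_le[of 3 "cube A" U l] cube.Hm_norm_nonneg[of 3 A "\<lambda>x. U x $ l"] by linarith
    have L2: "weak_deriv (cube A) \<alpha> (\<lambda>x. U x $ l) \<in> L2 ?M" if "deg \<alpha> \<le> 3" for \<alpha> l
      using cube.weak_deriv_works(2)[OF Ul that] .
    have U_L2: "(\<lambda>x. U x $ l) \<in> L2 ?M" for l using Ul by (rule cube.Hm_imp_L2)
    have U_le: "L2_norm ?M (\<lambda>x. U x $ l) \<le> ?n" for l
    proof -
      have "L2_norm ?M (\<lambda>x. U x $ l) = L2_norm ?M (weak_deriv (cube A) (\<lambda>_. 0) (\<lambda>x. U x $ l))"
        using cube.weak_deriv_0[OF Ul, of l]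
        by (intro L2_norm_cong_AE L2_measurable U_L2 L2) (auto simp: deg_0 elim: eventually_mono)
      then show ?thesis using le[of "\<lambda>_. 0" l] by (simp add: deg_0)
    qed
    define f1 where "f1 i x = weak_deriv (cube A) (mi2 i) (\<lambda>y. U y $ k) x" for i x
    define f2 where "f2 j l x = A_mat A b d j x $ k $ l * weak_deriv (cube A) (mi1 j) (\<lambda>y. U y $ l) x" for j l x
    define f3 where "f3 l x = A0_mat A b d x $ k $ l * U x $ l" for l x
    have f1: "f1 i \<in> L2 ?M" "L2_norm ?M (f1 i) \<le> ?n" for i
      unfolding f1_def[abs_def] by (auto intro!: L2 le simp: deg_mi2)
    have f2: "f2 j l \<in> L2 ?M" "L2_norm ?M (f2 j l) \<le> B * ?n" for j l
    proof -
      have d: "deg (mi1 j) \<le> 3" by (simp add: deg_mi1)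
      note m = continuous_on_closed_cube_measurable(1)[OF continuous_on_A_mat[OF b]]
      show "f2 j l \<in> L2 ?M"
        unfolding f2_def[abs_def] by (rule L2_bounded_mult[OF L2[OF d] m B(2)]) simp
      have "L2_norm ?M (f2 j l) \<le> B * L2_norm ?M (weak_deriv (cube A) (mi1 j) (\<lambda>y. U y $ l))"
        unfolding f2_def[abs_def] by (rule L2_norm_bounded_mult_le[OF L2[OF d] m B(2) B(1)]) simp
      also have "\<dots> \<le> B * ?n" using le[OF d] B(1) by (rule mult_left_mono)
      finally show "L2_norm ?M (f2 j l) \<le> B * ?n" .
    qed
    have f3: "f3 l \<in> L2 ?M" "L2_norm ?M (f3 l) \<le> B * ?n" for l
    proof -
      note m = continuous_on_closed_cube_measurable(1)[OF continuous_on_A0_mat[OF b]]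
      show "f3 l \<in> L2 ?M"
        unfolding f3_def[abs_def] by (rule L2_bounded_mult[OF U_L2 m B(3)]) simp
      have "L2_norm ?M (f3 l) \<le> B * L2_norm ?M (\<lambda>y. U y $ l)"
        unfolding f3_def[abs_def] by (rule L2_norm_bounded_mult_le[OF U_L2 m B(3) B(1)]) simp
      also have "\<dots> \<le> B * ?n" using U_le B(1) by (rule mult_left_mono)
      finally show "L2_norm ?M (f3 l) \<le> B * ?n" .
    qed
    have s1: "(\<lambda>x. \<Sum>i\<in>UNIV. f1 i x) \<in> L2 ?M" "L2_norm ?M (\<lambda>x. \<Sum>i\<in>UNIV. f1 i x) \<le> 3 * ?n"
      using L2_norm_sum_le[of UNIV f1 ?M] sum_bounded_above[of UNIV "\<lambda>i. L2_norm ?M (f1 i)" ?n] f1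
      by (auto intro!: L2_sum)
    have s2: "(\<lambda>x. \<Sum>l\<in>UNIV. f2 j l x) \<in> L2 ?M" "L2_norm ?M (\<lambda>x. \<Sum>l\<in>UNIV. f2 j l x) \<le> N * (B * ?n)" for j
      using L2_norm_sum_le[of UNIV "f2 j" ?M] sum_bounded_above[of UNIV "\<lambda>l. L2_norm ?M (f2 j l)" "B * ?n"] f2[of j]
      by (auto intro!: L2_sum simp: N_def)
    have s2': "(\<lambda>x. \<Sum>j\<in>UNIV. \<Sum>l\<in>UNIV. f2 j l x) \<in> L2 ?M"
      "L2_norm ?M (\<lambda>x. \<Sum>j\<in>UNIV. \<Sum>l\<in>UNIV. f2 j l x) \<le> 3 * (N * (B * ?n))"
      using L2_norm_sum_le[of UNIV "\<lambda>j x. \<Sum>l\<in>UNIV. f2 j l x" ?M]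
        sum_bounded_above[of UNIV "\<lambda>j. L2_norm ?M (\<lambda>x. \<Sum>l\<in>UNIV. f2 j l x)" "N * (B * ?n)"] s2
        L2_sum[of UNIV "\<lambda>j x. \<Sum>l\<in>UNIV. f2 j l x" ?M]
      by simp_all
    have s3: "(\<lambda>x. \<Sum>l\<in>UNIV. f3 l x) \<in> L2 ?M" "L2_norm ?M (\<lambda>x. \<Sum>l\<in>UNIV. f3 l x) \<le> N * (B * ?n)"
      using L2_norm_sum_le[of UNIV f3 ?M] sum_bounded_above[of UNIV "\<lambda>l. L2_norm ?M (f3 l)" "B * ?n"] f3
      by (auto intro!: L2_sum simp: N_def)
    have eq: "(\<lambda>x. Lop A b d U x $ k)
        = (\<lambda>x. ((\<Sum>i\<in>UNIV. f1 i x) + (\<Sum>j\<in>UNIV. \<Sum>l\<in>UNIV. f2 j l x)) + (\<Sum>l\<in>UNIV. f3 l x))"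
      by (simp add: Lop_component f1_def f2_def f3_def)
    show ?thesis
      unfolding eq
      using L2_add[OF L2_add[OF s1(1) s2'(1)] s3(1)]
        L2_norm_triangle[OF L2_add[OF s1(1) s2'(1)] s3(1)] L2_norm_triangle[OF s1(1) s2'(1)] s1(2) s2'(2) s3(2)
      by (simp add: C_def algebra_simps)
  qed
  have "0 \<le> N * B" using B(1) by (simp add: N_def)
  then have "0 < C" unfolding C_def by linarith
  with main show ?thesis by blast
qed

lemma Lop_lincomb:
  assumes U: "U \<in> HmN 3 (cube A)" and V: "V \<in> HmN 3 (cube A)"
  shows "AE x in lebesgue_on (cube A).
    Lop A b d (\<lambda>y. a *\<^sub>R U y + c *\<^sub>R V y) x = a *\<^sub>R Lop A b d U x + c *\<^sub>R Lop A b d V x"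
proof -
  have H: "(\<lambda>x. U x $ l) \<in> Hm 3 (cube A)" "(\<lambda>x. V x $ l) \<in> Hm 3 (cube A)" for l
    using U V by (simp_all add: HmN_def)
  have D: "AE x in lebesgue_on (cube A). weak_deriv (cube A) \<alpha> (\<lambda>y. a * U y $ l + c * V y $ l) x
      = a * weak_deriv (cube A) \<alpha> (\<lambda>y. U y $ l) x + c * weak_deriv (cube A) \<alpha> (\<lambda>y. V y $ l) x"
    if "deg \<alpha> \<le> 3" for \<alpha> l
    using cube.weak_deriv_lincomb[OF H that] .
  have D1: "AE x in lebesgue_on (cube A). \<forall>i\<in>UNIV. \<forall>l\<in>UNIV. weak_deriv (cube A) (mi1 i) (\<lambda>y. a * U y $ l + c * V y $ l) x
      = a * weak_deriv (cube A) (mi1 i) (\<lambda>y. U y $ l) x + c * weak_deriv (cube A) (mi1 i) (\<lambda>y. V y $ l) x"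
    by (intro AE_finite_allI D) (simp_all add: deg_mi1)
  have D2: "AE x in lebesgue_on (cube A). \<forall>i\<in>UNIV. \<forall>l\<in>UNIV. weak_deriv (cube A) (mi2 i) (\<lambda>y. a * U y $ l + c * V y $ l) x
      = a * weak_deriv (cube A) (mi2 i) (\<lambda>y. U y $ l) x + c * weak_deriv (cube A) (mi2 i) (\<lambda>y. V y $ l) x"
    by (intro AE_finite_allI D) (simp_all add: deg_mi2)
  show ?thesis
    using D1 D2
  proof eventually_elim
    case (elim x)
    then show ?case
      by (simp add: vec_eq_iff Lop_component sum.distrib sum_distrib_left algebra_simps)
  qed
qed


section \<open>Minimization\<close>

text \<open>The abstract principle behind existence and uniqueness: midpoint convexity with a gain
  controlled by \<open>\<delta>\<close> makes every minimizing sequence Cauchy, and any two minimizers have \<open>\<delta>\<close>-distance \<open>0\<close>.\<close>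

lemma uniformly_convex_minimizer:
  fixes J :: "'v \<Rightarrow> real" and \<delta> :: "'v \<Rightarrow> 'v \<Rightarrow> real"
  assumes K: "z \<in> K" and c: "0 < c"
    and J: "\<And>V. V \<in> K \<Longrightarrow> 0 \<le> J V"
    and mid: "\<And>V W. V \<in> K \<Longrightarrow> W \<in> K \<Longrightarrow> mid V W \<in> K"
    and \<delta>: "\<And>V W. 0 \<le> \<delta> V W"
    and conv: "\<And>V W. V \<in> K \<Longrightarrow> W \<in> K \<Longrightarrow> J (mid V W) \<le> (J V + J W) / 2 - c * (\<delta> V W)\<^sup>2"
    and complete: "\<And>X. (\<And>n. X n \<in> K) \<Longrightarrow> (\<And>e. 0 < e \<Longrightarrow> \<exists>N. \<forall>i\<ge>N. \<forall>j\<ge>N. \<delta> (X i) (X j) < e) \<Longrightarrow>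
      \<exists>V\<in>K. (\<lambda>n. J (X n)) \<longlonglongrightarrow> J V"
  obtains V where "V \<in> K" "\<And>W. W \<in> K \<Longrightarrow> J V \<le> J W"
    "\<And>W. W \<in> K \<Longrightarrow> J W \<le> J V \<Longrightarrow> \<delta> W V = 0"
proof -
  \<comment> \<open>the midpoint cannot lie below the infimum, which forces points with small values together\<close>
  define m where "m = Inf (J ` K)"
  have bdd: "bdd_below (J ` K)" using J by (intro bdd_belowI[of _ 0]) auto
  have m: "m \<le> J V" if "V \<in> K" for V unfolding m_def using that bdd by (intro cInf_lower) auto
  have gap: "c * (\<delta> V W)\<^sup>2 \<le> (J V + J W) / 2 - m" if "V \<in> K" "W \<in> K" for V W
    using conv[OF that] m[OF mid[OF that]] by linarith
  have "\<exists>V\<in>K. J V < m + inverse (real (Suc n))" for n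
    using cInf_lessD[of "J ` K" "m + inverse (real (Suc n))"] K by (auto simp: m_def)
  then obtain X where X: "\<And>n. X n \<in> K" "\<And>n. J (X n) < m + inverse (real (Suc n))" by metis
  have JX: "(\<lambda>n. J (X n)) \<longlonglongrightarrow> m"
  proof (rule tendsto_sandwich[OF _ _ tendsto_const])
    show "(\<lambda>n. m + inverse (real (Suc n))) \<longlonglongrightarrow> m"
      using tendsto_add[OF tendsto_const LIMSEQ_inverse_real_of_nat, of m] by simp
  qed (intro always_eventually allI m less_imp_le X)+
  have "\<exists>N. \<forall>i\<ge>N. \<forall>j\<ge>N. \<delta> (X i) (X j) < e" if e: "0 < e" for e
  proof -
    have "\<forall>\<^sub>F n in sequentially. J (X n) < m + c * e\<^sup>2"
      using e c by (intro order_tendstoD(2)[OF JX]) simp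
    then obtain N where N: "\<And>n. N \<le> n \<Longrightarrow> J (X n) < m + c * e\<^sup>2"
      unfolding eventually_sequentially by blast
    have "\<delta> (X i) (X j) < e" if "N \<le> i" "N \<le> j" for i j
    proof -
      have "c * (\<delta> (X i) (X j))\<^sup>2 < c * e\<^sup>2"
        using add_strict_mono[OF N[OF that(1)] N[OF that(2)]]
        by (intro le_less_trans[OF gap[OF X(1) X(1)]]) (simp add: field_simps)
      then have "(\<delta> (X i) (X j))\<^sup>2 < e\<^sup>2" using c by simp
      then show ?thesis using e by (rule power2_less_imp_less[OF _ less_imp_le])
    qed
    then show ?thesis by blast
  qed
  from complete[of X, OF X(1) this] obtain V where V: "V \<in> K" "(\<lambda>n. J (X n)) \<longlonglongrightarrow> J V" by blast
  have JV: "J V = m" using LIMSEQ_unique[OF V(2) JX] .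
  show thesis
  proof
    show "J V \<le> J W" if "W \<in> K" for W using m[OF that] JV by simp
    show "\<delta> W V = 0" if "W \<in> K" "J W \<le> J V" for W
    proof -
      have "c * (\<delta> W V)\<^sup>2 \<le> 0" using gap[OF that(1) V(1)] that(2) JV by simp
      then have "(\<delta> W V)\<^sup>2 \<le> 0" using c by (simp add: mult_le_0_iff)
      then show ?thesis by simp
    qed
  qed (rule V)
qed

text \<open>Writing the integral as a sum of squared \<open>L\<^sub>2\<close> norms of components makes the scalar parallelogram law and
  triangle inequality applicable.\<close>

lemma J_fun_eq:
  fixes U :: "real^3 \<Rightarrow> real^'n::{finite,linorder}"
  assumes b: "0 < b" and F: "F \<in> HmN 3 (cube A)" and U: "U \<in> HmN 3 (cube A)"
  shows "J_fun A b d \<gamma> F U = (\<Sum>k\<in>UNIV. (L2_norm (lebesgue_on (cube A)) (\<lambda>x. Lop A b d (\<lambda>y. U y + F y) x $ k))\<^sup>2)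
    + \<gamma> * (HmN_norm 3 (cube A) U)\<^sup>2"
proof -
  let ?M = "lebesgue_on (cube A)"
  have C: "(\<lambda>x. Lop A b d U x $ k) \<in> L2 ?M" if "U \<in> HmN 3 (cube A)" for U :: "real^3 \<Rightarrow> (real, 'n) vec" and k
    using Lop_bounded[OF b] that by blast
  have "(norm v)\<^sup>2 = (\<Sum>k\<in>UNIV. (v $ k)\<^sup>2)" for v :: "(real, 'n) vec"
    by (simp add: norm_vec_def L2_set_def sum_nonneg)
  then have "(LINT x|?M. (norm (Lop A b d (\<lambda>y. U y + F y) x))\<^sup>2)
      = (\<Sum>k\<in>UNIV. LINT x|?M. (Lop A b d (\<lambda>y. U y + F y) x $ k)\<^sup>2)"
    using C[OF HmN_add[OF U F]] by (simp add: Bochner_Integration.integral_sum L2_integrable_sq)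
  then show ?thesis by (simp add: J_fun_def L2_norm_sq)
qed

theorem theorem7p1:
  fixes b d :: real
  assumes "0 < b" and "0 < d" and "1 < CARD('n::{finite,linorder})"
  shows "\<exists>C :: real \<Rightarrow> real \<Rightarrow> real. \<forall>A R. 0 < A \<and> A < R \<longrightarrow>
    0 < C A R \<and>
    (\<forall>(\<phi>0 :: real^3 \<Rightarrow> real^'n::{finite,linorder}) \<phi>1 F1 \<gamma>.
      F1 \<in> HmN 3 (cube A) \<and>
      has_traceN A S_bsc F1 \<phi>0 \<and>
      has_normal_derivN A S_bsc F1 \<phi>1 \<and>
      (\<forall>F\<in>lateral_faces. has_normal_derivN A F F1 (\<lambda>_. 0)) \<and>
      has_normal_derivN A S_tr F1 (\<lambda>_. 0) \<and>
      0 < \<gamma> \<longrightarrow>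
      (\<exists>Vmin. is_arg_min (J_fun A b d \<gamma> F1) (\<lambda>V. V \<in> H3_0_bscN A) Vmin \<and>
        (\<forall>W. is_arg_min (J_fun A b d \<gamma> F1) (\<lambda>V. V \<in> H3_0_bscN A) W \<longrightarrow>
           (AE x in lebesgue_on (cube A). W x = Vmin x)) \<and>
        HmN_norm 3 (cube A) Vmin \<le> C A R / sqrt \<gamma> * HmN_norm 3 (cube A) F1))"
proof -
  have "\<exists>C. 0 < C \<and> (\<forall>(U :: real^3 \<Rightarrow> (real, 'n) vec) k. U \<in> HmN 3 (cube A) \<longrightarrow>
      (\<lambda>x. Lop A b d U x $ k) \<in> L2 (lebesgue_on (cube A)) \<and>
      L2_norm (lebesgue_on (cube A)) (\<lambda>x. Lop A b d U x $ k) \<le> C * HmN_norm 3 (cube A) U)" for A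
    by (rule Lop_bounded[OF assms(1)])
  then obtain C0 where C0: "\<And>A. 0 < C0 A"
    and Lop: "\<And>A (U :: real^3 \<Rightarrow> (real, 'n) vec) k. U \<in> HmN 3 (cube A) \<Longrightarrow> (\<lambda>x. Lop A b d U x $ k) \<in> L2 (lebesgue_on (cube A))"
    "\<And>A (U :: real^3 \<Rightarrow> (real, 'n) vec) k. U \<in> HmN 3 (cube A) \<Longrightarrow>
      L2_norm (lebesgue_on (cube A)) (\<lambda>x. Lop A b d U x $ k) \<le> C0 A * HmN_norm 3 (cube A) U"
    by metis
  \<comment> \<open>\<open>C0 A\<close> bounds each component of \<open>L\<close>; the squares of all components are added up\<close>
  define C where "C A = sqrt (real (CARD('n))) * C0 A" for A
  have C: "0 < C A" for A using C0 by (simp add: C_def)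
  have main: "\<exists>Vmin. is_arg_min (J_fun A b d \<gamma> F1) (\<lambda>V. V \<in> H3_0_bscN A) Vmin \<and>
        (\<forall>W. is_arg_min (J_fun A b d \<gamma> F1) (\<lambda>V. V \<in> H3_0_bscN A) W \<longrightarrow>
           (AE x in lebesgue_on (cube A). W x = Vmin x)) \<and>
        HmN_norm 3 (cube A) Vmin \<le> C A / sqrt \<gamma> * HmN_norm 3 (cube A) F1"
    if F1: "F1 \<in> HmN 3 (cube A)" and \<gamma>: "0 < \<gamma>" for A \<gamma> and F1 :: "real^3 \<Rightarrow> (real, 'n) vec"
  proof -
    let ?M = "lebesgue_on (cube A)"
    let ?J = "J_fun A b d \<gamma> F1"
    let ?nrm = "HmN_norm 3 (cube A) :: (real^3 \<Rightarrow> (real, 'n) vec) \<Rightarrow> real"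
    let ?T = "\<lambda>V k x. Lop A b d (\<lambda>y. V y + F1 y) x $ k"
    let ?mid = "\<lambda>V W x. (1/2) *\<^sub>R V x + (1/2) *\<^sub>R W x :: (real, 'n) vec"
    note sub = H3_0_bscN_subset
    note J_eq = J_fun_eq[OF assms(1) F1]
    have T_L2: "?T V k \<in> L2 ?M" if "V \<in> HmN 3 (cube A)" for V k
      by (rule Lop(1)[OF HmN_add[OF that F1]])
    have T_mid: "AE x in ?M. ?T (?mid V W) k x = 1/2 * ?T V k x + 1/2 * ?T W k x"
      if "V \<in> HmN 3 (cube A)" "W \<in> HmN 3 (cube A)" for V W k
    proof -
      have "(\<lambda>y. (1/2) *\<^sub>R (V y + F1 y) + (1/2) *\<^sub>R (W y + F1 y)) = (\<lambda>y. ?mid V W y + F1 y)"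
        by (rule ext) (simp add: vec_eq_iff field_simps)
      then show ?thesis
        using Lop_lincomb[OF HmN_add[OF that(1) F1] HmN_add[OF that(2) F1], of b d "1/2" "1/2"]
        by (auto elim: eventually_mono)
    qed
    have T_diff: "AE x in ?M. ?T V k x - ?T W k x = Lop A b d (\<lambda>y. V y - W y) x $ k"
      if "V \<in> HmN 3 (cube A)" "W \<in> HmN 3 (cube A)" for V W k
    proof -
      have "(\<lambda>y. 1 *\<^sub>R (V y + F1 y) + (-1) *\<^sub>R (W y + F1 y)) = (\<lambda>y. V y - W y)"
        by (rule ext) simp
      then show ?thesis
        using Lop_lincomb[OF HmN_add[OF that(1) F1] HmN_add[OF that(2) F1], of b d 1 "-1"]
        by (auto elim: eventually_mono)
    qed
    have conv: "?J (?mid V W) \<le> (?J V + ?J W) / 2 - \<gamma> / 4 * (?nrm (\<lambda>x. V x - W x))\<^sup>2"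
      if "V \<in> H3_0_bscN A" "W \<in> H3_0_bscN A" for V W
    proof -
      have V: "V \<in> HmN 3 (cube A)" and W: "W \<in> HmN 3 (cube A)" using that sub by blast+
      have VW: "?mid V W \<in> HmN 3 (cube A)" by (intro HmN_lincomb V W)
      have "(L2_norm ?M (?T (?mid V W) k))\<^sup>2 \<le> ((L2_norm ?M (?T V k))\<^sup>2 + (L2_norm ?M (?T W k))\<^sup>2) / 2" for k
      proof -
        have "L2_norm ?M (?T (?mid V W) k) = L2_norm ?M (\<lambda>x. 1/2 * ?T V k x + 1/2 * ?T W k x)"
          by (intro L2_norm_cong_AE L2_measurable T_mid V W VW T_L2 L2_add L2_cmult)
        then show ?thesis
          by (simp only: L2_norm_midpoint[OF T_L2[OF V] T_L2[OF W]] diff_le_eq le_add_same_cancel1) simp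
      qed
      then have "(\<Sum>k\<in>UNIV. (L2_norm ?M (?T (?mid V W) k))\<^sup>2)
          \<le> (\<Sum>k\<in>UNIV. ((L2_norm ?M (?T V k))\<^sup>2 + (L2_norm ?M (?T W k))\<^sup>2) / 2)"
        by (intro sum_mono)
      also have "\<dots> = ((\<Sum>k\<in>UNIV. (L2_norm ?M (?T V k))\<^sup>2) + (\<Sum>k\<in>UNIV. (L2_norm ?M (?T W k))\<^sup>2)) / 2"
        by (simp add: sum.distrib flip: sum_divide_distrib)
      finally show ?thesis
        unfolding J_eq[OF V] J_eq[OF W] J_eq[OF VW] HmN_norm_midpoint[OF V W]
        by (simp add: field_simps)
    qed
    have complete: "\<exists>V\<in>H3_0_bscN A. (\<lambda>n. ?J (X n)) \<longlonglongrightarrow> ?J V"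
      if X: "\<And>n. X n \<in> H3_0_bscN A"
        and Cauchy: "\<And>e. 0 < e \<Longrightarrow> \<exists>N. \<forall>i\<ge>N. \<forall>j\<ge>N. ?nrm (\<lambda>x. X i x - X j x) < e" for X
    proof -
      have XH: "X n \<in> HmN 3 (cube A)" for n using X sub by blast
      obtain V where V: "V \<in> HmN 3 (cube A)" "(\<lambda>n. ?nrm (\<lambda>x. X n x - V x)) \<longlonglongrightarrow> 0"
        using HmN_complete[of X 3 A, OF XH Cauchy] by blast
      have "(\<lambda>n. ?nrm (X n) - ?nrm V) \<longlonglongrightarrow> 0"
        by (rule Lim_null_comparison[OF _ V(2)])
          (intro always_eventually allI, simp only: real_norm_def HmN_norm_diff_le[OF XH V(1)])
      then have nrm: "(\<lambda>n. ?nrm (X n)) \<longlonglongrightarrow> ?nrm V" by (rule LIM_zero_cancel)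
      have T: "(\<lambda>n. L2_norm ?M (?T (X n) k)) \<longlonglongrightarrow> L2_norm ?M (?T V k)" for k
      proof -
        have "norm (L2_norm ?M (?T (X n) k) - L2_norm ?M (?T V k)) \<le> C0 A * ?nrm (\<lambda>x. X n x - V x)" for n
        proof -
          have "norm (L2_norm ?M (?T (X n) k) - L2_norm ?M (?T V k)) \<le> L2_norm ?M (\<lambda>x. ?T (X n) k x - ?T V k x)"
            unfolding real_norm_def by (rule L2_norm_diff_le[OF T_L2[OF XH] T_L2[OF V(1)]])
          also have "\<dots> = L2_norm ?M (\<lambda>x. Lop A b d (\<lambda>y. X n y - V y) x $ k)"
            by (intro L2_norm_cong_AE L2_measurable T_diff XH V(1) L2_diff T_L2 Lop(1) HmN_diff)
          also have "\<dots> \<le> C0 A * ?nrm (\<lambda>x. X n x - V x)"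
            by (intro Lop(2) HmN_diff XH V(1))
          finally show ?thesis .
        qed
        then have "(\<lambda>n. L2_norm ?M (?T (X n) k) - L2_norm ?M (?T V k)) \<longlonglongrightarrow> 0"
          by (intro Lim_null_comparison[OF _ tendsto_mult_right_zero[OF V(2)]] always_eventually allI)
        then show ?thesis by (rule LIM_zero_cancel)
      qed
      have "(\<lambda>n. ?J (X n)) \<longlonglongrightarrow> ?J V"
        unfolding J_eq[OF XH] J_eq[OF V(1)] by (intro tendsto_intros T nrm)
      moreover have "V \<in> H3_0_bscN A" by (rule H3_0_bscN_closed[OF X V])
      ultimately show ?thesis by blast
    qed
    have J_nonneg: "0 \<le> ?J V" if "V \<in> H3_0_bscN A" for V
      unfolding J_eq[OF sub[OF that]] using \<gamma> by (intro add_nonneg_nonneg sum_nonneg) auto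
    obtain V where V: "V \<in> H3_0_bscN A" "\<And>W. W \<in> H3_0_bscN A \<Longrightarrow> ?J V \<le> ?J W"
      "\<And>W. W \<in> H3_0_bscN A \<Longrightarrow> ?J W \<le> ?J V \<Longrightarrow> ?nrm (\<lambda>x. W x - V x) = 0"
    proof (rule uniformly_convex_minimizer[where z = "\<lambda>_. 0" and K = "H3_0_bscN A" and J = "?J" and mid = ?mid
          and c = "\<gamma> / 4" and \<delta> = "\<lambda>V W. ?nrm (\<lambda>x. V x - W x)"])
      show "(\<lambda>_. 0) \<in> H3_0_bscN A" by (rule H3_0_bscN_zero)
      show "?mid V W \<in> H3_0_bscN A" if "V \<in> H3_0_bscN A" "W \<in> H3_0_bscN A" for V W
        using that by (rule H3_0_bscN_lincomb)
    qed (use \<gamma> J_nonneg HmN_norm_nonneg conv complete in auto)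
    have VH: "V \<in> HmN 3 (cube A)" using V(1) sub by blast
    have "?nrm V \<le> C A / sqrt \<gamma> * ?nrm F1"
    proof -
      have zero: "(\<lambda>_. 0) \<in> HmN 3 (cube A)" using sub[OF H3_0_bscN_zero] .
      have "?nrm (\<lambda>_. 0) = 0"
        using HmN_norm_midpoint[OF zero zero] by simp
      then have J0: "?J (\<lambda>_. 0) = (\<Sum>k\<in>UNIV. (L2_norm ?M (\<lambda>x. Lop A b d F1 x $ k))\<^sup>2)"
        by (simp add: J_eq[OF zero])
      have "\<gamma> * (?nrm V)\<^sup>2 \<le> ?J V"
        unfolding J_eq[OF VH] by (simp add: sum_nonneg)
      also have "\<dots> \<le> ?J (\<lambda>_. 0)" by (rule V(2)[OF H3_0_bscN_zero])
      also have "\<dots> \<le> (\<Sum>k\<in>(UNIV :: 'n set). (C0 A * ?nrm F1)\<^sup>2)"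
        unfolding J0 by (intro sum_mono power_mono Lop(2) F1 L2_norm_nonneg)
      also have "\<dots> = (C A * ?nrm F1)\<^sup>2"
        by (simp add: C_def power_mult_distrib)
      finally have "sqrt (\<gamma> * (?nrm V)\<^sup>2) \<le> sqrt ((C A * ?nrm F1)\<^sup>2)" by (rule real_sqrt_le_mono)
      then have "sqrt \<gamma> * ?nrm V \<le> C A * ?nrm F1"
        using C[of A] HmN_norm_nonneg[of 3 "cube A" V] HmN_norm_nonneg[of 3 "cube A" F1]
        by (simp add: real_sqrt_mult)
      then show ?thesis using \<gamma> by (simp add: field_simps)
    qed
    moreover have "is_arg_min ?J (\<lambda>V. V \<in> H3_0_bscN A) V"
      using V(1,2) by (auto simp: is_arg_min_def not_less)
    moreover have "AE x in ?M. W x = V x" if "is_arg_min ?J (\<lambda>V. V \<in> H3_0_bscN A) W" for W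
    proof -
      have W: "W \<in> H3_0_bscN A" "?J W \<le> ?J V"
        using that V(1) by (auto simp: is_arg_min_def not_less)
      show ?thesis by (rule HmN_norm_diff_eq_0[OF sub[OF W(1)] VH V(3)[OF W]])
    qed
    ultimately show ?thesis by blast
  qed
  show ?thesis
    by (intro exI[of _ "\<lambda>A R. C A"] allI impI conjI C) (blast intro: main)
qed

end
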